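(* The group $\mathrm{IET}([0,\infty))$ is $\mathfrak{X}^{\mathrm{sep}}$-boundedly acyclic, and so are all of its derived subgroups.
   Context: **Interval exchanges.** $\mathrm{IET}([0,\infty))$ is the group of right-continuous bijections of $[0,\infty)$ obtained by cutting $[0,\infty)$ into finitely many half-open subintervals (closed on the left, open on the right; one of them has infinite length) and rearranging them by translations. Derived subgroups of a group $\Gamma$: $\Gamma^{(1)}=[\Gamma,\Gamma]$ and $\Gamma^{(d)}=[\Gamma^{(d-1)},\Gamma^{(d-1)}]$ for $d>1$. **Bounded cohomology.** All groups are discrete. A Banach $\Gamma$-module is a real Banach space $E$ with an action of $\Gamma$ by linear isometries. $C^k_b(\Gamma;E)$ is the space of bounded functions $\Gamma^{k+1}\to E$, with the action $(\gamma\cdot f)(\gamma_0,\dots,\gamma_k)=\gamma f(\gamma^{-1}\gamma_0,\dots,\gamma^{-1}\gamma_k)$ and the simplicial coboundary; $H^\bullet_b(\Gamma;E)$ is the cohomology of the complex $C^\bullet_b(\Gamma;E)^\Gamma$ of invariants. $E$ is dual if it is isometrically $\Gamma$-isomorphic to the dual of some Banach $\Gamma$-module (with the contragredient action); separable means norm-separable. A group $\Gamma$ is $\mathfrak{X}^{\mathrm{sep}}$-boundedly acyclic if $H^n_b(\Gamma;E)=0$ for all $n\ge1$ and every separable dual Banach $\Gamma$-module $E$. *)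

theory Defs
  imports "HOL-Analysis.Analysis" "HOL-Algebra.Algebra"
begin

text \<open>Groups are discrete groups in the sense of HOL-Algebra; a Banach module over \<open>G\<close> is a Banach
  space type \<open>'e\<close> with an action \<open>\<rho>\<close> of \<open>carrier G\<close> by linear isometries (they are bijective since
  \<open>\<rho>\<close> respects the group law).\<close>

definition banach_module :: "('g, 'm) monoid_scheme \<Rightarrow> ('g \<Rightarrow> 'e::banach \<Rightarrow> 'e) \<Rightarrow> bool" where
  "banach_module G \<rho> \<longleftrightarrow>
     (\<forall>g\<in>carrier G. linear (\<rho> g) \<and> (\<forall>v. norm (\<rho> g v) = norm v)) \<and>
     (\<forall>v. \<rho> \<one>\<^bsub>G\<^esub> v = v) \<and>
     (\<forall>g\<in>carrier G. \<forall>h\<in>carrier G. \<forall>v. \<rho> (g \<otimes>\<^bsub>G\<^esub> h) v = \<rho> g (\<rho> h v))"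

text \<open>The Banach dual of \<open>'f\<close> is \<open>'f \<Rightarrow>\<^sub>L real\<close> with the operator norm.\<close>

definition contragredient ::
  "('g, 'm) monoid_scheme \<Rightarrow> ('g \<Rightarrow> 'f::banach \<Rightarrow> 'f) \<Rightarrow> 'g \<Rightarrow> ('f \<Rightarrow>\<^sub>L real) \<Rightarrow> ('f \<Rightarrow>\<^sub>L real)" where
  "contragredient G \<sigma> g \<phi> = Blinfun (\<lambda>v. blinfun_apply \<phi> (\<sigma> (inv\<^bsub>G\<^esub> g) v))"

text \<open>The type argument is the type of the predual: being dual means that this predicate
  holds for some Banach space type \<open>'f\<close>.\<close>

definition dual_banach_module ::
  "'f::banach itself \<Rightarrow> ('g, 'm) monoid_scheme \<Rightarrow> ('g \<Rightarrow> 'e::banach \<Rightarrow> 'e) \<Rightarrow> bool" where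
  "dual_banach_module TYPE('f) G \<rho> \<longleftrightarrow>
     banach_module G \<rho> \<and>
     (\<exists>(\<sigma> :: 'g \<Rightarrow> 'f \<Rightarrow> 'f) (T :: 'e \<Rightarrow> ('f \<Rightarrow>\<^sub>L real)).
        banach_module G \<sigma> \<and> linear T \<and> surj T \<and> (\<forall>v. norm (T v) = norm v) \<and>
        (\<forall>g\<in>carrier G. \<forall>v. T (\<rho> g v) = contragredient G \<sigma> g (T v)))"


text \<open>Elements of \<open>\<Gamma>\<^sup>k\<^sup>+\<^sup>1\<close> are lists of length \<open>k + 1\<close>; cochains are extensional functions on them.\<close>

definition tuples :: "('g, 'm) monoid_scheme \<Rightarrow> nat \<Rightarrow> 'g list set" where
  "tuples G k = {xs. set xs \<subseteq> carrier G \<and> length xs = Suc k}"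

definition bounded_cochains :: "('g, 'm) monoid_scheme \<Rightarrow> nat \<Rightarrow> ('g list \<Rightarrow> 'e::banach) set" where
  "bounded_cochains G k = {f \<in> extensional (tuples G k). bounded (f ` tuples G k)}"

definition cochain_action ::
  "('g, 'm) monoid_scheme \<Rightarrow> ('g \<Rightarrow> 'e::banach \<Rightarrow> 'e) \<Rightarrow> nat \<Rightarrow> 'g \<Rightarrow> ('g list \<Rightarrow> 'e) \<Rightarrow> ('g list \<Rightarrow> 'e)" where
  "cochain_action G \<rho> k g f =
     (\<lambda>xs\<in>tuples G k. \<rho> g (f (map (\<lambda>x. inv\<^bsub>G\<^esub> g \<otimes>\<^bsub>G\<^esub> x) xs)))"

definition coboundary ::
  "('g, 'm) monoid_scheme \<Rightarrow> nat \<Rightarrow> ('g list \<Rightarrow> 'e::banach) \<Rightarrow> ('g list \<Rightarrow> 'e)" where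
  "coboundary G k f =
     (\<lambda>xs\<in>tuples G (Suc k). \<Sum>i\<le>Suc k. (-1) ^ i *\<^sub>R f (take i xs @ drop (Suc i) xs))"

definition invariant_cochain_group ::
  "('g, 'm) monoid_scheme \<Rightarrow> ('g \<Rightarrow> 'e::banach \<Rightarrow> 'e) \<Rightarrow> nat \<Rightarrow> ('g list \<Rightarrow> 'e) monoid" where
  "invariant_cochain_group G \<rho> k =
     \<lparr>carrier = {f \<in> bounded_cochains G k. \<forall>g\<in>carrier G. cochain_action G \<rho> k g f = f},
      mult = \<lambda>f f'. \<lambda>xs\<in>tuples G k. f xs + f' xs,
      one = \<lambda>xs\<in>tuples G k. 0\<rparr>"

definition bounded_cocycles ::
  "('g, 'm) monoid_scheme \<Rightarrow> ('g \<Rightarrow> 'e::banach \<Rightarrow> 'e) \<Rightarrow> nat \<Rightarrow> ('g list \<Rightarrow> 'e) set" where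
  "bounded_cocycles G \<rho> k =
     kernel (invariant_cochain_group G \<rho> k) (invariant_cochain_group G \<rho> (Suc k)) (coboundary G k)"

definition bounded_coboundaries ::
  "('g, 'm) monoid_scheme \<Rightarrow> ('g \<Rightarrow> 'e::banach \<Rightarrow> 'e) \<Rightarrow> nat \<Rightarrow> ('g list \<Rightarrow> 'e) set" where
  "bounded_coboundaries G \<rho> k =
     (case k of
        0 \<Rightarrow> {\<one>\<^bsub>invariant_cochain_group G \<rho> 0\<^esub>}
      | Suc j \<Rightarrow> coboundary G j ` carrier (invariant_cochain_group G \<rho> j))"

definition bounded_cohomology_group ::
  "('g, 'm) monoid_scheme \<Rightarrow> ('g \<Rightarrow> 'e::banach \<Rightarrow> 'e) \<Rightarrow> nat \<Rightarrow> ('g list \<Rightarrow> 'e) set monoid" where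
  "bounded_cohomology_group G \<rho> k =
     (invariant_cochain_group G \<rho> k)\<lparr>carrier := bounded_cocycles G \<rho> k\<rparr>
       Mod bounded_coboundaries G \<rho> k"

text \<open>\<open>G\<close> is boundedly acyclic for separable dual Banach modules if the following holds for
  all Banach space types \<open>'e\<close> (the module) and \<open>'f\<close> (its predual). Both types are parameters, since
  HOL has no quantification over types; a theorem with free \<open>'e\<close> and \<open>'f\<close> asserts it for all of them.
  In particular, as \<open>'f\<close> occurs only in a hypothesis, its universal quantification amounts to the
  existential one in the notion of a dual module.\<close>

definition Xsep_boundedly_acyclic ::
  "'e::banach itself \<Rightarrow> 'f::banach itself \<Rightarrow> ('g, 'm) monoid_scheme \<Rightarrow> bool" where
  "Xsep_boundedly_acyclic TYPE('e) TYPE('f) G \<longleftrightarrow>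
     (\<forall>\<rho> :: 'g \<Rightarrow> 'e \<Rightarrow> 'e.
        separable_space (euclidean :: 'e topology) \<and> dual_banach_module TYPE('f) G \<rho> \<longrightarrow>
        (\<forall>n\<ge>1. trivial_group (bounded_cohomology_group G \<rho> n)))"


text \<open>On a finite partition of \<open>[0,\<infinity>)\<close> into half-open intervals exactly one piece is infinite, so it
  suffices to allow both kinds of pieces. Right continuity is automatic.\<close>

definition interval_exchanges :: "(real \<Rightarrow> real) set" where
  "interval_exchanges =
     {f \<in> Bij {0..}. \<exists>P. finite P \<and> partition_on {0..} P \<and>
        (\<forall>J\<in>P. ((\<exists>a b. J = {a..<b}) \<or> (\<exists>a. J = {a..})) \<and> (\<exists>c. \<forall>x\<in>J. f x = x + c))}"

definition IET :: "(real \<Rightarrow> real) monoid" where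
  "IET = (BijGroup {0..})\<lparr>carrier := interval_exchanges\<rparr>"

lemma interval_exchangesI:
  assumes "f \<in> Bij {0..}" "finite P" "partition_on {0..} P"
    "\<And>J. J \<in> P \<Longrightarrow> ((\<exists>a b. J = {a..<b}) \<or> (\<exists>a. J = {a..})) \<and> (\<exists>c. \<forall>x\<in>J. f x = x + c)"
  shows "f \<in> interval_exchanges"
  using assms unfolding interval_exchanges_def by blast

lemma interval_exchangesE:
  assumes "f \<in> interval_exchanges"
  obtains P where "finite P" "partition_on {0..} P"
    "\<forall>J\<in>P. (\<exists>a b. J = {a..<b}) \<or> (\<exists>a. J = {a..})" "\<forall>J\<in>P. \<exists>c. \<forall>x\<in>J. f x = x + c"
    "f \<in> Bij {0..}"
  using assms unfolding interval_exchanges_def mem_Collect_eq ball_conj_distrib by (elim conjE exE)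

lemma interval_exchanges_subgroup: "subgroup interval_exchanges (BijGroup {0..})"
proof
  show "interval_exchanges \<subseteq> carrier (BijGroup {0..})"
    by (auto simp: interval_exchanges_def BijGroup_def)
next
  fix f g assume f: "f \<in> interval_exchanges" and g: "g \<in> interval_exchanges"
  obtain P where P0: "finite P" "partition_on {0..} P"
    "\<forall>J\<in>P. (\<exists>a b. J = {a..<b}) \<or> (\<exists>a. J = {a..})" "\<forall>J\<in>P. \<exists>c. \<forall>x\<in>J. f x = x + c"
    and f': "f \<in> Bij {0..}"
    using f by (rule interval_exchangesE)
  note P = P0(1,2) bspec[OF P0(3)] bspec[OF P0(4)]
  obtain Q where Q0: "finite Q" "partition_on {0..} Q"
    "\<forall>J\<in>Q. (\<exists>a b. J = {a..<b}) \<or> (\<exists>a. J = {a..})" "\<forall>J\<in>Q. \<exists>c. \<forall>x\<in>J. g x = x + c"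
    and g': "g \<in> Bij {0..}"
    using g by (rule interval_exchangesE)
  note Q = Q0(1,2) bspec[OF Q0(3)] bspec[OF Q0(4)]
  have gpos: "g x \<ge> 0" if "x \<ge> 0" for x
    using g' that by (auto simp: Bij_def bij_betw_def)
  define R where "R = (\<lambda>(J, K). {x\<in>J. g x \<in> K}) ` (Q \<times> P) - {{}}"
  have "finite R" using P Q by (simp add: R_def)
  moreover have "partition_on {0..} R"
  proof (rule partition_onI)
    show "\<Union>R = {0..}"
    proof (intro equalityI subsetI)
      fix x assume "x \<in> \<Union>R" then show "x \<in> {0..}"
        using partition_onD1[OF Q(2)] by (auto simp: R_def)
    next
      fix x :: real assume x: "x \<in> {0..}"
      then obtain J where J: "J \<in> Q" "x \<in> J" using partition_onD1[OF Q(2)] by auto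
      have "g x \<in> {0..}" using x gpos by auto
      then obtain K where K: "K \<in> P" "g x \<in> K" using partition_onD1[OF P(2)] by auto
      have "{y\<in>J. g y \<in> K} \<in> R" "x \<in> {y\<in>J. g y \<in> K}" using J K by (auto simp: R_def)
      then show "x \<in> \<Union>R" by blast
    qed
    show "disjnt A B" if A: "A \<in> R" and B: "B \<in> R" and AB: "A \<noteq> B" for A B
    proof -
      obtain J K where JK: "J \<in> Q" "K \<in> P" "A = {x\<in>J. g x \<in> K}" using A by (auto simp: R_def)
      obtain J' K' where JK': "J' \<in> Q" "K' \<in> P" "B = {x\<in>J'. g x \<in> K'}" using B by (auto simp: R_def)
      have "J \<noteq> J' \<or> K \<noteq> K'" using AB JK JK' by auto
      then have "J \<inter> J' = {} \<or> K \<inter> K' = {}"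
        using partition_onD2[OF P(2)] partition_onD2[OF Q(2)] JK JK' by (auto dest: disjointD)
      then show ?thesis using JK JK' by (auto simp: disjnt_def)
    qed
    show "{} \<notin> R" by (simp add: R_def)
  qed
  moreover have "((\<exists>a b. A = {a..<b}) \<or> (\<exists>a. A = {a..})) \<and> (\<exists>c. \<forall>x\<in>A. compose {0..} f g x = x + c)"
    if A: "A \<in> R" for A
  proof -
    obtain J K where JK: "J \<in> Q" "K \<in> P" "A = {x\<in>J. g x \<in> K}" using A by (auto simp: R_def)
    obtain c where c: "\<And>x. x \<in> J \<Longrightarrow> g x = x + c" using Q(4) JK by blast
    obtain e where e: "\<And>x. x \<in> K \<Longrightarrow> f x = x + e" using P(4) JK by blast
    have "x \<ge> 0" if "x \<in> J" for x using partition_onD1[OF Q(2)] JK that by auto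
    then have "\<forall>x\<in>A. compose {0..} f g x = x + (c + e)"
      using JK c e by (auto simp: compose_def)
    moreover have A': "A = {x\<in>J. x + c \<in> K}" using JK c by auto
    have "(\<exists>a b. A = {a..<b}) \<or> (\<exists>a. A = {a..})"
      using Q(3)[OF JK(1)] P(3)[OF JK(2)]
    proof (elim disjE exE)
      fix a b a' b' assume "J = {a..<b}" "K = {a'..<b'}"
      then have "A = {max a (a' - c)..<min b (b' - c)}" unfolding A' by auto
      then show ?thesis by blast
    next
      fix a b a' assume "J = {a..<b}" "K = {a'..}"
      then have "A = {max a (a' - c)..<b}" unfolding A' by auto
      then show ?thesis by blast
    next
      fix a a' b' assume "J = {a..}" "K = {a'..<b'}"
      then have "A = {max a (a' - c)..<b' - c}" unfolding A' by auto
      then show ?thesis by blast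
    next
      fix a a' assume "J = {a..}" "K = {a'..}"
      then have "A = {max a (a' - c)..}" unfolding A' by auto
      then show ?thesis by blast
    qed
    ultimately show ?thesis by blast
  qed
  moreover have "compose {0..} f g \<in> Bij {0..}" using f' g' by (rule compose_Bij)
  ultimately have "compose {0..} f g \<in> interval_exchanges"
    by (intro interval_exchangesI[of _ R]) simp_all
  then show "f \<otimes>\<^bsub>BijGroup {0..}\<^esub> g \<in> interval_exchanges"
    using f' g' by (simp add: BijGroup_def)
next
  have "partition_on {0..} {{0::real..}}" by (auto intro!: partition_onI)
  moreover have "(\<lambda>x\<in>{0..}. x) \<in> Bij {0::real..}" by (rule id_Bij)
  ultimately show "\<one>\<^bsub>BijGroup {0..}\<^esub> \<in> interval_exchanges"
    by (auto simp: BijGroup_def intro!: interval_exchangesI[of _ "{{0::real..}}"] exI[of _ "0::real"])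
next
  fix f assume f: "f \<in> interval_exchanges"
  obtain P where P0: "finite P" "partition_on {0..} P"
    "\<forall>J\<in>P. (\<exists>a b. J = {a..<b}) \<or> (\<exists>a. J = {a..})" "\<forall>J\<in>P. \<exists>c. \<forall>x\<in>J. f x = x + c"
    and f': "f \<in> Bij {0..}"
    using f by (rule interval_exchangesE)
  note P = P0(1,2) bspec[OF P0(3)] bspec[OF P0(4)]
  have inj: "inj_on f {0..}" and im: "f ` {0..} = {0..}" using f' by (auto simp: Bij_def bij_betw_def)
  have sub: "J \<subseteq> {0..}" if "J \<in> P" for J using partition_onD1[OF P(2)] that by auto
  define R where "R = (\<lambda>J. f ` J) ` P"
  have "finite R" using P by (simp add: R_def)
  moreover have "partition_on {0..} R"
  proof (rule partition_onI)
    show "\<Union>R = {0..}" using partition_onD1[OF P(2)] im unfolding R_def by (metis image_Union)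
    show "disjnt A B" if A: "A \<in> R" and B: "B \<in> R" and AB: "A \<noteq> B" for A B
    proof -
      obtain J K where JK: "J \<in> P" "A = f ` J" "K \<in> P" "B = f ` K" using A B by (auto simp: R_def)
      then have "J \<inter> K = {}" using AB partition_onD2[OF P(2)] by (auto dest: disjointD)
      then show ?thesis
        using JK inj_on_image_Int[OF inj sub sub, of J K] by (simp add: disjnt_def)
    qed
    show "{} \<notin> R" using partition_onD3[OF P(2)] by (auto simp: R_def)
  qed
  moreover have "((\<exists>a b. A = {a..<b}) \<or> (\<exists>a. A = {a..})) \<and>
      (\<exists>c. \<forall>x\<in>A. (\<lambda>x\<in>{0..}. inv_into {0..} f x) x = x + c)"
    if A: "A \<in> R" for A
  proof -
    obtain J where J: "J \<in> P" "A = f ` J" using A by (auto simp: R_def)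
    obtain c where c: "\<And>x. x \<in> J \<Longrightarrow> f x = x + c" using P(4) J by blast
    have A': "A = (\<lambda>x. x + c) ` J" using J c by auto
    have "f x \<ge> 0" if "x \<in> J" for x using im sub[OF J(1)] that by auto
    then have "(\<lambda>x\<in>{0..}. inv_into {0..} f x) y = y + (- c)" if "y \<in> A" for y
      using that J c sub[OF J(1)] inv_into_f_f[OF inj] by fastforce
    then have "\<exists>c. \<forall>x\<in>A. (\<lambda>x\<in>{0..}. inv_into {0..} f x) x = x + c" by blast
    moreover have "(\<exists>a b. A = {a..<b}) \<or> (\<exists>a. A = {a..})"
      using P(3)[OF J(1)]
    proof (elim disjE exE)
      fix a b assume "J = {a..<b}"
      then have "A = {a + c..<b + c}" unfolding A' by simp
      then show ?thesis by blast
    next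
      fix a assume "J = {a..}"
      then have "A = {a + c..}" unfolding A' using image_add_atLeast[of c a] by (simp add: add.commute)
      then show ?thesis by blast
    qed
    ultimately show ?thesis by blast
  qed
  moreover have "(\<lambda>x\<in>{0..}. inv_into {0..} f x) \<in> Bij {0..}" using f' by (rule restrict_inv_into_Bij)
  ultimately have "(\<lambda>x\<in>{0..}. inv_into {0..} f x) \<in> interval_exchanges"
    by (intro interval_exchangesI[of _ R]) simp_all
  then show "inv\<^bsub>BijGroup {0..}\<^esub> f \<in> interval_exchanges" using f' by (simp add: inv_BijGroup)
qed

lemma IET_group: "group IET"
  unfolding IET_def
  by (rule subgroup.subgroup_is_group[OF interval_exchanges_subgroup group_BijGroup])

definition derived_subgroup :: "('g, 'm) monoid_scheme \<Rightarrow> nat \<Rightarrow> ('g, 'm) monoid_scheme" where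
  "derived_subgroup G d = G\<lparr>carrier := (derived G ^^ d) (carrier G)\<rparr>"

end

theory Submission
  imports Defs
begin

text \<open>
  Let \<open>\<Gamma>\<close> be the group or one of its derived subgroups, \<open>c\<close> a bounded cocycle of degree
  \<open>n \<ge> 1\<close> with values in a separable dual module. For a random \<open>y\<close> in \<open>\<Gamma>\<close>, the cocycle
  \<open>(x\<^sub>0, \<dots>, x\<^sub>n) \<mapsto> \<bbbE> c (x\<^sub>0 y\<^sub>0, \<dots>, x\<^sub>n y\<^sub>n)\<close>, with independent copies \<open>y\<^sub>i\<close> of \<open>y\<close>, is
  cohomologous to \<open>c\<close> through a primitive bounded by \<open>n \<parallel>c\<parallel>\<close>. By weak-* compactness the same holds for
  limits of such averages, and it suffices to find one that is constant: a constant cocycle of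
  positive degree is a coboundary.

  A finite set \<open>S\<close> of interval exchanges lives on a block \<open>[0, r)\<close>, and even permutations of the
  blocks \<open>[rj, rj + r)\<close> lie in every derived subgroup. Take \<open>y\<close> to be a product of independent
  elements of \<open>S \<union> {1}\<close>, mostly \<open>1\<close>, one in each of the first \<open>N\<close> blocks, followed by a uniform random
  permutation of these blocks. For \<open>x\<^sub>i\<close> in \<open>S\<close>, left multiplication by \<open>x\<^sub>i\<close> then essentially
  prescribes the letters in block \<open>0\<close>. Let \<open>s(J)\<close> be the limit for \<open>N \<rightarrow> \<infinity>\<close> of the averages
  conditioned to have these letters in all blocks of \<open>J\<close>. By the law of large numbers the mean of
  \<open>s(J \<union> {j})\<close> over many \<open>j\<close> is close to \<open>s(J)\<close>, and by equivariance the norms of differences are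
  invariant under permutations of the blocks. If \<open>s({0}) \<noteq> s({})\<close>, then adding any block to any \<open>J\<close>
  moves \<open>s(J)\<close> by a definite amount in norm, while it converges weak-* to \<open>s(J)\<close> as the block goes to
  infinity; so there is an increasing sequence of sets \<open>J\<close> along which \<open>s(J)\<close> escapes from every point of a given
  countable set, which contradicts separability.
\<close>

section \<open>Chains of words and averaging\<close>

text \<open>The simplicial coboundary on words of every length at once and without extensionality,
  so that identities follow by induction on the word from \<open>delta_Nil\<close> and
  \<open>delta_Cons\<close>.\<close>

definition delta :: "('a list \<Rightarrow> 'e::real_vector) \<Rightarrow> 'a list \<Rightarrow> 'e" where
  "delta f xs = (\<Sum>i<length xs. (-1) ^ i *\<^sub>R f (take i xs @ drop (Suc i) xs))"

lemma delta_Nil [simp]: "delta f [] = 0"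
  by (simp add: delta_def)

lemma delta_Cons [simp]: "delta f (x # xs) = f xs - delta (\<lambda>ys. f (x # ys)) xs"
  by (simp add: delta_def sum.lessThan_Suc_shift sum_negf del: sum.lessThan_Suc)

lemma delta_add: "delta (\<lambda>xs. f xs + g xs) xs = delta f xs + delta g xs"
  by (simp add: delta_def scaleR_add_right sum.distrib)

lemma delta_diff: "delta (\<lambda>xs. f xs - g xs) xs = delta f xs - delta g xs"
  by (simp add: delta_def scaleR_diff_right sum_subtractf)

lemma delta_scaleR: "delta (\<lambda>xs. r *\<^sub>R f xs) xs = r *\<^sub>R delta f xs"
  by (simp add: delta_def scaleR_sum_right mult.commute)

lemma delta_sum: "delta (\<lambda>xs. \<Sum>i\<in>I. f i xs) xs = (\<Sum>i\<in>I. delta (f i) xs)"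
  unfolding delta_def scaleR_sum_right by (rule sum.swap)

lemma delta_map: "delta (\<lambda>xs. f (map g xs)) xs = delta f (map g xs)"
  by (simp add: delta_def take_map drop_map)

lemma delta_const: "delta (\<lambda>_. v) xs = (if odd (length xs) then v else 0)"
  by (induction xs) auto

text \<open>The prism operator of the simplicial homotopy between \<open>p\<close> and
  \<open>q\<close>: the vertex in position \<open>i\<close> occurs twice, once through each map, so
  \<open>f\<close> is evaluated on words one entry longer than \<open>vs\<close>.\<close>

definition prism :: "('v \<Rightarrow> 'a) \<Rightarrow> ('v \<Rightarrow> 'a) \<Rightarrow> ('a list \<Rightarrow> 'e::real_vector) \<Rightarrow> 'v list \<Rightarrow> 'e" where
  "prism p q f vs =
     (\<Sum>i<length vs. (-1) ^ i *\<^sub>R f (map p (take (Suc i) vs) @ map q (drop i vs)))"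

lemma prism_Nil [simp]: "prism p q f [] = 0"
  by (simp add: prism_def)

lemma prism_Cons [simp]:
  "prism p q f (v # vs) = f (p v # q v # map q vs) - prism p q (\<lambda>ys. f (p v # ys)) vs"
  by (simp add: prism_def sum.lessThan_Suc_shift sum_negf del: sum.lessThan_Suc)

lemma prism_diff: "prism p q (\<lambda>xs. f xs - g xs) vs = prism p q f vs - prism p q g vs"
  by (simp add: prism_def scaleR_diff_right sum_subtractf)

text \<open>Split off the first vertex \<open>v\<close>. The induction hypothesis for
  \<open>\<lambda>ys. f (p v # ys)\<close> replaces \<open>f (p v # map q vs)\<close> by
  \<open>f (p v # map p vs)\<close>; the remaining terms cancel in pairs.\<close>

lemma prism_homotopy:
  "delta (prism p q f) vs + prism p q (delta f) vs = f (map q vs) - f (map p vs)"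
proof (induction vs arbitrary: f)
  case (Cons v vs)
  show ?case
    using Cons.IH[of "\<lambda>ys. f (p v # ys)"]
    by (simp add: delta_diff prism_diff delta_map[of "\<lambda>ys. f (p v # q v # ys)"] algebra_simps)
qed simp

section \<open>Averages over finite sets and over independent random tuples\<close>

definition average :: "'b set \<Rightarrow> ('b \<Rightarrow> 'e::real_vector) \<Rightarrow> 'e" where
  "average W f = (1 / real (card W)) *\<^sub>R sum f W"

lemma average_cong: "(\<And>x. x \<in> W \<Longrightarrow> f x = g x) \<Longrightarrow> average W f = average W g"
  by (simp add: average_def cong: sum.cong)

lemma average_diff: "average W (\<lambda>x. f x - g x) = average W f - average W g"
  by (simp add: average_def sum_subtractf scaleR_diff_right)

lemma average_const: "finite W \<Longrightarrow> W \<noteq> {} \<Longrightarrow> average W (\<lambda>_. v) = v"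
  by (simp add: average_def sum_constant_scaleR)

lemma norm_average_le:
  fixes f :: "'b \<Rightarrow> 'e::real_normed_vector"
  assumes "\<And>x. x \<in> W \<Longrightarrow> norm (f x) \<le> C" and "C \<ge> 0"
  shows "norm (average W f) \<le> C"
proof (cases "card W = 0")
  case False
  have "norm (sum f W) \<le> real (card W) * C"
    by (rule sum_norm_bound) (rule assms)
  with False show ?thesis by (simp add: average_def field_simps)
qed (use assms in \<open>simp add: average_def\<close>)

lemma norm_average_le_average:
  fixes f :: "'b \<Rightarrow> 'e::real_normed_vector"
  assumes "\<And>x. x \<in> W \<Longrightarrow> norm (f x) \<le> g x"
  shows "norm (average W f) \<le> average W g"
proof -
  have "norm (sum f W) \<le> sum g W" by (rule sum_norm_le) (rule assms)
  then show ?thesis by (simp add: average_def divide_right_mono)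
qed

lemma linear_average: "linear F \<Longrightarrow> F (average W f) = average W (\<lambda>x. F (f x))"
  by (simp add: average_def linear_scale linear_sum)

lemma average_delta: "delta (\<lambda>xs. average W (\<lambda>w. f w xs)) xs = average W (\<lambda>w. delta (f w) xs)"
  by (simp add: average_def delta_scaleR delta_sum)

definition words :: "'b set \<Rightarrow> nat \<Rightarrow> 'b list set" where
  "words W k = {ws. set ws \<subseteq> W \<and> length ws = k}"

lemma finite_words: "finite W \<Longrightarrow> finite (words W k)"
  unfolding words_def by (rule finite_lists_length_eq)

lemma card_words: "finite W \<Longrightarrow> card (words W k) = card W ^ k"
  unfolding words_def by (rule card_lists_length_eq)

lemma words_nonempty: "W \<noteq> {} \<Longrightarrow> words W k \<noteq> {}"
proof -
  assume "W \<noteq> {}"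
  then obtain w where "w \<in> W" by auto
  then have "replicate k w \<in> words W k" by (auto simp: words_def)
  then show ?thesis by auto
qed

lemma words_0 [simp]: "words W 0 = {[]}"
  by (auto simp: words_def)

text \<open>Fubini for a uniform random word: its first letter is independent of the rest.\<close>

lemma average_words_Suc:
  assumes "finite W"
  shows "average (words W (Suc k)) f = average W (\<lambda>w. average (words W k) (\<lambda>ws. f (w # ws)))"
proof -
  have "sum f (words W (Suc k)) = (\<Sum>(w, ws)\<in>W \<times> words W k. f (w # ws))"
    by (rule sum.reindex_bij_witness[of _ "\<lambda>(w, ws). w # ws" "\<lambda>ws. (hd ws, tl ws)"])
       (auto simp: words_def length_Suc_conv)
  then show ?thesis
    by (simp add: average_def card_words assms sum.cartesian_product scaleR_sum_right case_prod_unfold)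
qed

text \<open>The expectation of \<open>f\<close> when the entries of \<open>xs\<close> are paired
  with independent uniform elements of \<open>W\<close>.\<close>

definition smear :: "'b set \<Rightarrow> (('a \<times> 'b) list \<Rightarrow> 'e::real_vector) \<Rightarrow> 'a list \<Rightarrow> 'e" where
  "smear W f xs = average (words W (length xs)) (\<lambda>ws. f (zip xs ws))"

lemma smear_Nil [simp]: "smear W f [] = f []"
  by (simp add: smear_def average_def)

lemma smear_Cons:
  "finite W \<Longrightarrow> smear W f (x # xs) = average W (\<lambda>w. smear W (\<lambda>vs. f ((x, w) # vs)) xs)"
  by (simp add: smear_def average_words_Suc)

lemma smear_diff: "smear W (\<lambda>vs. f vs - g vs) xs = smear W f xs - smear W g xs"
  by (simp add: smear_def average_diff)

lemma smear_map_fst: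
  assumes "finite W" "W \<noteq> {}"
  shows "smear W (\<lambda>vs. f (map fst vs)) xs = f xs"
proof -
  have "smear W (\<lambda>vs. f (map fst vs)) xs = average (words W (length xs)) (\<lambda>_. f xs)"
    unfolding smear_def by (rule average_cong) (simp add: words_def)
  then show ?thesis using assms by (simp add: average_const finite_words words_nonempty)
qed

text \<open>A face of the random word forgets one independent letter, and averaging over a forgotten
  letter changes nothing as long as \<open>W\<close> is nonempty.\<close>

lemma delta_smear:
  assumes "finite W" "W \<noteq> {}"
  shows "delta (smear W f) xs = smear W (delta f) xs"
proof (induction xs arbitrary: f)
  case (Cons x xs)
  then show ?case
    using assms by (simp add: smear_Cons smear_diff average_diff average_const average_delta)
qed simp

section \<open>Weak-* limits\<close>

definition ultra :: "'a filter \<Rightarrow> bool" where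
  "ultra U \<longleftrightarrow> U \<noteq> bot \<and> (\<forall>P. eventually P U \<or> eventually (\<lambda>x. \<not> P x) U)"

text \<open>Zorn's lemma for the proper filters below \<open>F\<close> in reverse order; a minimal
  one decides every predicate.\<close>

lemma ultra_exists:
  fixes F :: "'a filter"
  assumes F: "F \<noteq> bot"
  obtains U where "ultra U" "U \<le> F"
proof -
  define A where "A = {G. G \<noteq> bot \<and> G \<le> F}"
  have "\<exists>m\<in>A. \<forall>a\<in>A. m \<ge> a \<longrightarrow> a = m"
  proof (rule predicate_Zorn)
    show "partial_order_on A (relation_of (\<ge>) A)"
      by (rule partial_order_on_relation_ofI) auto
  next
    fix C assume C: "C \<in> Chains (relation_of (\<ge>) A)"
    have CA: "C \<subseteq> A" using Chains_relation_of[OF C] .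
    have tot: "x \<le> y \<or> y \<le> x" if "x \<in> C" "y \<in> C" for x y
      using C that by (auto simp: Chains_def relation_of_def)
    show "\<exists>u\<in>A. \<forall>a\<in>C. a \<ge> u"
    proof (cases "C = {}")
      case True
      then show ?thesis using F by (auto simp: A_def)
    next
      case False
      \<comment> \<open>A nonempty finite part of a chain contains its own infimum, so finite infima
        stay proper and \<open>Inf_filter_not_bot\<close> applies.\<close>
      have *: "\<exists>x\<in>Y. Inf Y = x" if "finite Y" "Y \<noteq> {}" "Y \<subseteq> C" for Y
        using that
      proof (induction Y rule: finite_ne_induct)
        case (insert x Y)
        then obtain y where y: "y \<in> Y" "Inf Y = y" by auto
        have "x \<le> y \<or> y \<le> x" using tot insert y by auto
        then show ?case using y by (auto simp: inf_absorb1 inf_absorb2)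
      qed simp
      have "Inf C \<noteq> bot"
      proof (rule Inf_filter_not_bot)
        fix Y assume Y: "Y \<subseteq> C" "finite Y"
        show "Inf Y \<noteq> bot"
        proof (cases "Y = {}")
          case True
          then have "F \<le> Inf Y" by simp
          then show ?thesis using F by (metis bot.extremum_uniqueI)
        next
          case False
          then show ?thesis using *[OF Y(2) False Y(1)] CA Y(1) by (auto simp: A_def)
        qed
      qed
      moreover have "Inf C \<le> F"
        using False CA by (metis (no_types, lifting) A_def Inf_lower2 equals0I mem_Collect_eq subsetD)
      ultimately have "Inf C \<in> A" by (simp add: A_def)
      then show ?thesis by (auto intro: Inf_lower)
    qed
  qed
  then obtain U where U: "U \<noteq> bot" "U \<le> F" and max: "\<And>G. G \<noteq> bot \<Longrightarrow> G \<le> U \<Longrightarrow> G = U"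
    by (auto simp: A_def intro: order_trans)
  \<comment> \<open>Restricting \<open>U\<close> to \<open>P\<close> gives either the trivial
    filter, and then \<open>P\<close> eventually fails, or \<open>U\<close> itself by
    minimality.\<close>
  have "eventually P U \<or> eventually (\<lambda>x. \<not> P x) U" for P
  proof (cases "inf U (principal {x. P x}) = bot")
    case True
    then show ?thesis by (auto simp: trivial_limit_def eventually_inf_principal)
  next
    case False
    then have "inf U (principal {x. P x}) = U" by (intro max) auto
    then have "U \<le> principal {x. P x}" by (simp add: inf.absorb_iff1)
    then show ?thesis by (simp add: le_principal)
  qed
  with U that show thesis by (auto simp: ultra_def)
qed

text \<open>Compactness yields a cluster point, and an ultrafilter converges to each of its cluster
  points.\<close>

lemma ultra_converges:
  assumes U: "ultra U" and K: "compact K" and s: "eventually (\<lambda>i. s i \<in> K) U"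
  obtains x where "x \<in> K" "(s \<longlongrightarrow> x) U"
proof -
  have "filtermap s U \<noteq> bot" using U by (simp add: ultra_def filtermap_bot_iff)
  moreover have "eventually (\<lambda>y. y \<in> K) (filtermap s U)" using s by (simp add: eventually_filtermap)
  ultimately obtain x where x: "x \<in> K" "inf (nhds x) (filtermap s U) \<noteq> bot"
    using K unfolding compact_filter by blast
  have "(s \<longlongrightarrow> x) U"
  proof (rule topological_tendstoI, rule ccontr)
    fix V assume V: "open V" "x \<in> V" "\<not> (\<forall>\<^sub>F i in U. s i \<in> V)"
    then have "\<forall>\<^sub>F i in U. s i \<notin> V" using U unfolding ultra_def by blast
    then have "eventually (\<lambda>y. y \<notin> V) (filtermap s U)" by (simp add: eventually_filtermap)
    moreover have "eventually (\<lambda>y. y \<in> V) (nhds x)" using V by (auto simp: eventually_nhds)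
    ultimately have "eventually (\<lambda>_. False) (inf (nhds x) (filtermap s U))"
      unfolding eventually_inf by blast
    then show False using x by (simp add: trivial_limit_def)
  qed
  with x that show thesis by blast
qed

section \<open>Dual Banach spaces and weak-* limits of bounded families\<close>

locale dual_pairing =
  fixes T :: "'e::banach \<Rightarrow> ('f::banach \<Rightarrow>\<^sub>L real)"
  assumes T_linear: "linear T" and T_surj: "surj T" and T_norm: "norm (T v) = norm v"
begin

lemma T_diff: "T (v - w) = T v - T w"
  using T_linear by (rule linear_diff)

lemma T_eqI: "(\<And>\<phi>. T v \<phi> = T w \<phi>) \<Longrightarrow> v = w"
proof -
  assume "\<And>\<phi>. T v \<phi> = T w \<phi>"
  then have "T v = T w" by (intro blinfun_eqI)
  then have "norm (v - w) = 0" unfolding T_norm[symmetric] T_diff by simp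
  then show "v = w" by simp
qed

lemma T_abs_le: "\<bar>T v \<phi>\<bar> \<le> norm v * norm \<phi>"
  using norm_blinfun[of "T v" \<phi>] by (simp add: T_norm)

text \<open>One-sided tests suffice because the unit ball of the predual is symmetric under
  \<open>\<phi>\<close> to \<open>- \<phi>\<close>.\<close>

lemma norm_leI:
  assumes "B \<ge> 0" "\<And>\<phi>. norm \<phi> \<le> 1 \<Longrightarrow> T v \<phi> \<le> B"
  shows "norm v \<le> B"
proof -
  have "\<bar>T v \<phi>\<bar> \<le> B * norm \<phi>" for \<phi>
  proof (cases "\<phi> = 0")
    case False
    have "T v (\<phi> /\<^sub>R norm \<phi>) \<le> B" "T v ((- \<phi>) /\<^sub>R norm \<phi>) \<le> B"
      by (intro assms(2); use False in simp)+
    then show ?thesis using False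
      by (simp add: blinfun.scaleR_right blinfun.minus_right field_simps)
  qed (simp add: blinfun.zero_right)
  then have "norm (T v) \<le> B" using assms(1) by (intro norm_blinfun_bound) auto
  then show ?thesis by (simp add: T_norm)
qed

text \<open>Weak-* convergence along \<open>U\<close>, once \<open>'e\<close> is identified with the
  dual of \<open>'f\<close> through \<open>T\<close>.\<close>

definition wlim :: "'i filter \<Rightarrow> ('i \<Rightarrow> 'e) \<Rightarrow> 'e \<Rightarrow> bool" where
  "wlim U e v \<longleftrightarrow> (\<forall>\<phi>. ((\<lambda>i. T (e i) \<phi>) \<longlongrightarrow> T v \<phi>) U)"

lemma wlimD: "wlim U e v \<Longrightarrow> ((\<lambda>i. T (e i) \<phi>) \<longlongrightarrow> T v \<phi>) U"
  by (simp add: wlim_def)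

text \<open>Banach-Alaoglu along an ultrafilter: the pointwise limit of the functionals is linear
  with the same bound, hence represented by a vector since \<open>T\<close> is onto.\<close>

lemma wlim_exists:
  fixes e :: "'i \<Rightarrow> 'e"
  assumes U: "ultra U" and B: "\<And>i. norm (e i) \<le> B"
  obtains v where "wlim U e v"
proof -
  have Ubot: "U \<noteq> bot" using U by (simp add: ultra_def)
  have bd: "\<bar>T (e i) \<phi>\<bar> \<le> B * norm \<phi>" for i \<phi>
    using T_abs_le[of "e i" \<phi>] mult_right_mono[OF B[of i] norm_ge_zero[of \<phi>]] by linarith
  have "\<exists>x. ((\<lambda>i. T (e i) \<phi>) \<longlongrightarrow> x) U" for \<phi>
  proof -
    have "\<forall>\<^sub>F i in U. T (e i) \<phi> \<in> {- (B * norm \<phi>)..B * norm \<phi>}"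
      using bd by (intro always_eventually) (simp add: abs_le_iff minus_le_iff)
    then show ?thesis using ultra_converges[OF U compact_Icc] by metis
  qed
  then obtain l where l: "\<And>\<phi>. ((\<lambda>i. T (e i) \<phi>) \<longlongrightarrow> l \<phi>) U" by metis
  have "bounded_linear l"
  proof (rule bounded_linear_intro[of _ B])
    show "l (x + y) = l x + l y" for x y
      using tendsto_unique[OF Ubot l[of "x + y"]] tendsto_add[OF l[of x] l[of y]]
      by (simp add: blinfun.add_right)
    show "l (r *\<^sub>R x) = r *\<^sub>R l x" for r x
      using tendsto_unique[OF Ubot l[of "r *\<^sub>R x"]] tendsto_mult_left[OF l[of x], of r]
      by (simp add: blinfun.scaleR_right)
    show "norm (l x) \<le> norm x * B" for x
      using tendsto_upperbound[OF tendsto_rabs[OF l[of x]] always_eventually Ubot] bd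
      by (simp add: mult.commute)
  qed
  moreover obtain v where "T v = Blinfun l" using T_surj by (metis surjD)
  ultimately have "wlim U e v" using l by (simp add: wlim_def bounded_linear_Blinfun_apply)
  then show thesis by (rule that)
qed

lemma wlim_unique: "U \<noteq> bot \<Longrightarrow> wlim U e v \<Longrightarrow> wlim U e w \<Longrightarrow> v = w"
  unfolding wlim_def by (intro T_eqI) (metis tendsto_unique)

lemma wlim_const: "wlim U (\<lambda>_. v) v"
  by (simp add: wlim_def)

lemma wlim_add: "wlim U e v \<Longrightarrow> wlim U e' v' \<Longrightarrow> wlim U (\<lambda>i. e i + e' i) (v + v')"
  by (simp add: wlim_def linear_add[OF T_linear] blinfun.add_left tendsto_add)

lemma wlim_scaleR: "wlim U e v \<Longrightarrow> wlim U (\<lambda>i. r *\<^sub>R e i) (r *\<^sub>R v)"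
  by (simp add: wlim_def linear_scale[OF T_linear] blinfun.scaleR_left tendsto_mult_left)

lemma wlim_diff: "wlim U e v \<Longrightarrow> wlim U e' v' \<Longrightarrow> wlim U (\<lambda>i. e i - e' i) (v - v')"
  by (simp add: wlim_def T_diff blinfun.diff_left tendsto_diff)

lemma wlim_sum: "(\<And>j. j \<in> I \<Longrightarrow> wlim U (e j) (v j)) \<Longrightarrow> wlim U (\<lambda>i. \<Sum>j\<in>I. e j i) (\<Sum>j\<in>I. v j)"
  by (induction I rule: infinite_finite_induct) (auto intro: wlim_const wlim_add)

lemma wlim_cong:
  assumes "eventually (\<lambda>i. e i = e' i) U"
  shows "wlim U e v \<longleftrightarrow> wlim U e' v"
  unfolding wlim_def by (intro all_cong1 tendsto_cong eventually_mono[OF assms]) simp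

text \<open>Weak-* lower semicontinuity of the norm, tested on the unit ball of the predual.\<close>

lemma wlim_norm_le:
  assumes "U \<noteq> bot" "wlim U e v" "eventually (\<lambda>i. norm (e i) \<le> B) U"
  shows "norm v \<le> B"
proof (rule norm_leI)
  obtain i where "norm (e i) \<le> B" using eventually_happens'[OF assms(1,3)] by blast
  then show "B \<ge> 0" using norm_ge_zero order_trans by blast
  fix \<phi> :: 'f assume \<phi>: "norm \<phi> \<le> 1"
  show "T v \<phi> \<le> B"
  proof (rule tendsto_upperbound[OF wlimD[OF assms(2)] _ assms(1)])
    show "\<forall>\<^sub>F i in U. T (e i) \<phi> \<le> B"
      using assms(3)
    proof eventually_elim
      case (elim i)
      have "\<bar>T (e i) \<phi>\<bar> \<le> norm (e i) * norm \<phi>" by (rule T_abs_le)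
      also have "\<dots> \<le> norm (e i) * 1" using \<phi> by (intro mult_left_mono) auto
      finally show ?case using elim by linarith
    qed
  qed
qed

end

section \<open>Families indexed by finite sets, and separability\<close>

lemma average_lower:
  fixes a :: "nat \<Rightarrow> real"
  assumes "\<And>i. a i \<le> t" "(\<lambda>M. (1 / real M) * (\<Sum>i<M. a i)) \<longlonglongrightarrow> l"
  shows "l \<le> t"
proof (rule tendsto_upperbound[OF assms(2)])
  show "\<forall>\<^sub>F M in sequentially. (1 / real M) * (\<Sum>i<M. a i) \<le> t"
    using eventually_gt_at_top[of 0]
  proof eventually_elim
    case (elim M)
    have "(\<Sum>i<M. a i) \<le> real M * t"
      using sum_mono[of "{..<M}" a "\<lambda>_. t"] assms(1) by simp
    then show ?case using elim by (simp add: field_simps)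
  qed
qed simp

text \<open>In the application, \<open>s J\<close> is an average conditioned on the blocks in \<open>J\<close>.\<close>

locale insertion_family = dual_pairing T
  for T :: "'e::banach \<Rightarrow> ('f::banach \<Rightarrow>\<^sub>L real)" +
  fixes s :: "nat set \<Rightarrow> 'e" and C :: real
  assumes bounded: "finite J \<Longrightarrow> norm (s J) \<le> C"
    and averages: "finite J \<Longrightarrow> inj j \<Longrightarrow> range j \<inter> J = {} \<Longrightarrow>
      (\<lambda>M. (1 / real M) *\<^sub>R (\<Sum>i<M. s (insert (j i) J))) \<longlonglongrightarrow> s J"
    and symmetric: "finite A \<Longrightarrow> finite B \<Longrightarrow>
      norm (s (Transposition.transpose a b ` A) - s (Transposition.transpose a b ` B)) = norm (s A - s B)"
begin

text \<open>The base case is the transposition of \<open>0\<close> and \<open>l\<close>. In the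
  step, \<open>j\<close> is moved to far away points \<open>f i\<close>, which by symmetry keeps the
  norm; averaging over \<open>i\<close> removes the point in the limit, and the norm of an average
  does not exceed the common norm of its terms.\<close>

lemma insert_ge:
  assumes "finite J" "l \<notin> J"
  shows "norm (s {0} - s {}) \<le> norm (s (insert l J) - s J)"
  using assms
proof (induction J)
  case empty
  show ?case using symmetric[of "{0}" "{}" 0 l] by simp
next
  case (insert j J)
  obtain m where m: "\<And>i. i \<in> insert l J \<Longrightarrow> i < m"
    using insert(1) by (meson finite_insert finite_nat_set_iff_bounded)
  define f where "f i = m + i" for i
  have f: "f i \<notin> insert l J" for i using m[of "f i"] by (auto simp: f_def)
  let ?v = "norm (s (insert l (insert j J)) - s (insert j J))"
  have eq: "norm (s (insert (f i) (insert l J)) - s (insert (f i) J)) = ?v" for i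
  proof -
    have "Transposition.transpose j (f i) ` J = J"
      using insert f[of i] by (auto simp: Transposition.transpose_def image_def)
    moreover have "Transposition.transpose j (f i) l = l"
      using insert f[of i] by (auto simp: Transposition.transpose_def)
    ultimately show ?thesis
      using symmetric[of "insert l (insert j J)" "insert j J" j "f i"] insert(1)
      by (simp add: insert_commute)
  qed
  have "(\<lambda>M. (1 / real M) *\<^sub>R (\<Sum>i<M. s (insert (f i) (insert l J)))) \<longlonglongrightarrow> s (insert l J)"
    using insert f by (intro averages) (auto simp: f_def inj_def)
  moreover have "(\<lambda>M. (1 / real M) *\<^sub>R (\<Sum>i<M. s (insert (f i) J))) \<longlonglongrightarrow> s J"
    using insert f by (intro averages) (auto simp: f_def inj_def)
  ultimately have "(\<lambda>M. norm ((1 / real M) *\<^sub>R (\<Sum>i<M. s (insert (f i) (insert l J)))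
      - (1 / real M) *\<^sub>R (\<Sum>i<M. s (insert (f i) J)))) \<longlonglongrightarrow> norm (s (insert l J) - s J)"
    by (intro tendsto_norm tendsto_diff)
  moreover have "norm ((1 / real M) *\<^sub>R (\<Sum>i<M. s (insert (f i) (insert l J)))
      - (1 / real M) *\<^sub>R (\<Sum>i<M. s (insert (f i) J))) \<le> ?v" for M
  proof (cases "M = 0")
    case False
    have "norm (\<Sum>i<M. s (insert (f i) (insert l J)) - s (insert (f i) J)) \<le> real (card {..<M}) * ?v"
      by (rule sum_norm_bound) (simp only: eq order.refl)
    then show ?thesis
      using False by (simp add: scaleR_diff_right[symmetric] sum_subtractf[symmetric] field_simps)
  qed simp
  ultimately have "norm (s (insert l J) - s J) \<le> ?v"
    by (intro LIMSEQ_le_const2) auto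
  then show ?case using insert by simp
qed

text \<open>One half of the weak-* convergence of \<open>s (insert l J)\<close> to
  \<open>s J\<close> for \<open>l\<close> tending to infinity: infinitely many exceptions could be
  enumerated, and averaging over them would force \<open>T (s J) \<phi> \<le> t\<close>.\<close>

lemma eventually_insert:
  assumes J: "finite J" and t: "t < T (s J) \<phi>"
  shows "eventually (\<lambda>l. t < T (s (insert l J)) \<phi>) sequentially"
proof (rule ccontr)
  assume "\<not> ?thesis"
  then have "\<exists>\<^sub>\<infinity>l. T (s (insert l J)) \<phi> \<le> t"
    by (simp add: not_eventually not_less cofinite_eq_sequentially)
  then have "infinite {l. T (s (insert l J)) \<phi> \<le> t}"
    by (simp add: INFM_iff_infinite)
  then have inf: "infinite ({l. T (s (insert l J)) \<phi> \<le> t} - J)" (is "infinite ?B")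
    using J by simp
  define j where "j = enumerate ?B"
  have j: "j i \<in> ?B" for i unfolding j_def by (rule enumerate_in_set[OF inf])
  have "inj j" unfolding j_def
    using strict_mono_enumerate[OF inf] by (rule strict_mono_imp_inj_on)
  then have "(\<lambda>M. (1 / real M) *\<^sub>R (\<Sum>i<M. s (insert (j i) J))) \<longlonglongrightarrow> s J"
    using J j by (intro averages) auto
  then have "(\<lambda>M. T ((1 / real M) *\<^sub>R (\<Sum>i<M. s (insert (j i) J))) \<phi>) \<longlonglongrightarrow> T (s J) \<phi>"
  proof (rule bounded_linear.tendsto[rotated])
    show "bounded_linear (\<lambda>v. T v \<phi>)"
      by (rule bounded_linear_intro[of _ "norm \<phi>"])
         (use T_abs_le in \<open>auto simp: linear_add[OF T_linear] linear_scale[OF T_linear] blinfun.add_left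
           blinfun.scaleR_left mult.commute\<close>)
  qed
  then have "(\<lambda>M. (1 / real M) * (\<Sum>i<M. T (s (insert (j i) J)) \<phi>)) \<longlonglongrightarrow> T (s J) \<phi>"
    by (simp add: linear_scale[OF T_linear] linear_sum[OF T_linear] blinfun.scaleR_left blinfun.sum_left)
  moreover have "T (s (insert (j i) J)) \<phi> \<le> t" for i using j[of i] by simp
  ultimately have "T (s J) \<phi> \<le> t" by (rule average_lower[rotated])
  with t show False by simp
qed

lemma insertion_trivial:
  assumes D: "countable D" "closure D = (UNIV :: 'e set)"
  shows "s {0} = s {}"
proof (rule ccontr)
  define r where "r = norm (s {0} - s {}) / 3"
  assume "s {0} \<noteq> s {}"
  then have r: "r > 0" by (simp add: r_def)
  have "D \<noteq> {}" using D by auto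
  then obtain d :: "nat \<Rightarrow> 'e" where d: "range d = D"
    using D(1) range_from_nat_into by metis
  define ok where "ok = (\<lambda>(J, K). finite J \<and> finite K \<and> (\<forall>\<phi> t. (\<phi>, t) \<in> K \<longrightarrow> t < T (s J) \<phi>))"
  define Q where "Q n x y \<longleftrightarrow> snd x \<subseteq> snd y \<and> (\<exists>\<phi>. norm \<phi> \<le> 1 \<and> (\<phi>, T (d n) \<phi> + r) \<in> snd y)"
    for n and x y :: "nat set \<times> ('f \<times> real) set"
  \<comment> \<open>A state \<open>(J, K)\<close> carries strict weak-* inequalities \<open>K\<close> satisfied by \<open>s J\<close>. They survive the insertion
    of a far away point; step \<open>n\<close> adds one that keeps all later values at distance \<open>r\<close> from \<open>d n\<close>.\<close>
  have "\<exists>x. \<forall>n. ok (x n) \<and> Q n (x n) (x (Suc n))"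
  proof (rule dependent_nat_choice)
    show "\<exists>x. ok x" by (rule exI[of _ "({}, {})"]) (simp add: ok_def)
  next
    fix x :: "nat set \<times> ('f \<times> real) set" and n assume "ok x"
    then obtain J K where x: "x = (J, K)" "finite J" "finite K" "\<And>\<phi> t. (\<phi>, t) \<in> K \<Longrightarrow> t < T (s J) \<phi>"
      by (cases x) (simp add: ok_def)
    have "eventually (\<lambda>l. \<forall>p\<in>K. snd p < T (s (insert l J)) (fst p)) sequentially"
      using x by (intro eventually_ball_finite ballI eventually_insert) auto
    moreover have "eventually (\<lambda>l. l \<notin> J) sequentially"
      using x(2) unfolding cofinite_eq_sequentially[symmetric] eventually_cofinite by simp
    ultimately have "eventually (\<lambda>l. l \<notin> J \<and> (\<forall>p\<in>K. snd p < T (s (insert l J)) (fst p))) sequentially"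
      by eventually_elim auto
    from eventually_happens'[OF sequentially_bot this]
    obtain l where l': "l \<notin> J \<and> (\<forall>p\<in>K. snd p < T (s (insert l J)) (fst p))" ..
    then have l: "l \<notin> J" "\<And>\<phi> t. (\<phi>, t) \<in> K \<Longrightarrow> t < T (s (insert l J)) \<phi>"
      by fastforce+
    \<comment> \<open>Two points at distance at least \<open>3 * r\<close> cannot both lie within
      \<open>r\<close> of \<open>d n\<close>; accordingly \<open>J\<close> is kept or enlarged by
      \<open>l\<close>.\<close>
    have "3 * r \<le> norm (s (insert l J) - s J)"
      using insert_ge[OF x(2) l(1)] by (simp add: r_def)
    also have "\<dots> \<le> norm (s (insert l J) - d n) + norm (s J - d n)"
      using norm_triangle_ineq4[of "s (insert l J) - d n" "s J - d n"] by simp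
    finally have "r < norm (s (insert l J) - d n) \<or> r < norm (s J - d n)" using r by linarith
    then obtain J' where J': "J' \<in> {insert l J, J}" "r < norm (s J' - d n)" by auto
    have "\<exists>\<phi>. norm \<phi> \<le> 1 \<and> r < T (s J' - d n) \<phi>"
    proof (rule ccontr)
      assume "\<nexists>\<phi>. norm \<phi> \<le> 1 \<and> r < T (s J' - d n) \<phi>"
      then have "norm (s J' - d n) \<le> r" using r by (intro norm_leI) (auto simp: not_less)
      then show False using J'(2) by simp
    qed
    then obtain \<phi> where \<phi>: "norm \<phi> \<le> 1" "r < T (s J' - d n) \<phi>" by blast
    have "ok (J', insert (\<phi>, T (d n) \<phi> + r) K)"
      using J'(1) x l \<phi>(2) by (auto simp: ok_def T_diff blinfun.diff_left)
    then show "\<exists>y. ok y \<and> Q n x y"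
      using \<phi>(1) x(1) by (intro exI[of _ "(J', insert (\<phi>, T (d n) \<phi> + r) K)"]) (auto simp: Q_def)
  qed
  then obtain x where x': "\<forall>n. ok (x n) \<and> Q n (x n) (x (Suc n))" ..
  have x: "ok (x n)" "Q n (x n) (x (Suc n))" for n using x' by simp_all
  have "snd (x n) \<subseteq> snd (x (Suc n))" for n using x(2)[of n] by (simp add: Q_def)
  then have mono: "snd (x m) \<subseteq> snd (x n)" if "m \<le> n" for m n
    using that by (rule lift_Suc_mono_le)
  \<comment> \<open>The accumulated inequalities pass, as non-strict ones, to a weak-* limit of the
    values along the construction. It therefore has distance at least \<open>r\<close> from every
    point of \<open>D\<close>, against density.\<close>
  obtain U :: "nat filter" where U: "ultra U" "U \<le> sequentially"
    using ultra_exists[OF sequentially_bot] .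
  have "finite (fst (x n))" for n using x(1)[of n] by (auto simp: ok_def split: prod.splits)
  then have "norm (s (fst (x n))) \<le> C" for n by (rule bounded)
  from wlim_exists[OF U(1) this]
  obtain e where e: "wlim U (\<lambda>n. s (fst (x n))) e" .
  have far: "r \<le> norm (e - d n)" for n
  proof -
    obtain \<phi> where \<phi>: "norm \<phi> \<le> 1" "(\<phi>, T (d n) \<phi> + r) \<in> snd (x (Suc n))"
      using x(2)[of n] by (auto simp: Q_def)
    have "T (d n) \<phi> + r \<le> T e \<phi>"
    proof (rule tendsto_lowerbound[OF wlimD[OF e]])
      have "T (d n) \<phi> + r \<le> T (s (fst (x m))) \<phi>" if "m \<ge> Suc n" for m
        using x(1)[of m] mono[OF that] \<phi>(2) by (fastforce simp: ok_def split: prod.splits)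
      then have "eventually (\<lambda>m. T (d n) \<phi> + r \<le> T (s (fst (x m))) \<phi>) sequentially"
        unfolding eventually_sequentially by blast
      then show "eventually (\<lambda>m. T (d n) \<phi> + r \<le> T (s (fst (x m))) \<phi>) U"
        using U(2) by (simp add: le_filter_def)
    qed (use U in \<open>simp add: ultra_def\<close>)
    then have "r \<le> T (e - d n) \<phi>" by (simp add: T_diff blinfun.diff_left)
    also have "\<dots> \<le> norm (e - d n) * norm \<phi>" using T_abs_le[of "e - d n" \<phi>] by linarith
    also have "\<dots> \<le> norm (e - d n) * 1" using \<phi> by (intro mult_left_mono) auto
    finally show ?thesis by simp
  qed
  obtain v where "v \<in> D" "dist v e < r"
    using D(2) r closure_approachable[of e D] by auto
  moreover from this(1) d obtain n where "v = d n" by blast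
  ultimately show False using far[of n] by (simp add: dist_norm norm_minus_commute)
qed

end

section \<open>Independent coordinates\<close>

text \<open>A finite uniform sample space \<open>W\<close> with independent uniform coordinates in
  \<open>Z\<close>, axiomatised by reading (\<open>ev\<close>) and overwriting (\<open>up\<close>) a
  coordinate. In this form it applies to lists of states, which are not literally functions on
  \<open>I\<close>.\<close>

locale product_coordinates =
  fixes W :: "'w set" and Z :: "'z set" and I :: "'i set"
    and ev :: "'i \<Rightarrow> 'w \<Rightarrow> 'z" and up :: "'i \<Rightarrow> 'z \<Rightarrow> 'w \<Rightarrow> 'w"
  assumes finite_W: "finite W" and finite_Z: "finite Z"
    and up_in: "\<And>i z w. i \<in> I \<Longrightarrow> z \<in> Z \<Longrightarrow> w \<in> W \<Longrightarrow> up i z w \<in> W"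
    and ev_in: "\<And>i w. i \<in> I \<Longrightarrow> w \<in> W \<Longrightarrow> ev i w \<in> Z"
    and ev_up: "\<And>i z w. i \<in> I \<Longrightarrow> z \<in> Z \<Longrightarrow> w \<in> W \<Longrightarrow> ev i (up i z w) = z"
    and up_ev: "\<And>i w. i \<in> I \<Longrightarrow> w \<in> W \<Longrightarrow> up i (ev i w) w = w"
    and up_up: "\<And>i z z' w. i \<in> I \<Longrightarrow> z \<in> Z \<Longrightarrow> z' \<in> Z \<Longrightarrow> w \<in> W \<Longrightarrow> up i z (up i z' w) = up i z w"
    and ev_up_other: "\<And>i j z w. i \<in> I \<Longrightarrow> j \<in> I \<Longrightarrow> j \<noteq> i \<Longrightarrow> z \<in> Z \<Longrightarrow> w \<in> W \<Longrightarrow>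
      ev j (up i z w) = ev j w"
begin

text \<open>Exchanging coordinate \<open>i\<close> of \<open>w\<close> with \<open>z\<close> is an
  involution of \<open>W \<times> Z\<close>.\<close>

lemma resample:
  fixes F :: "'w \<Rightarrow> 'e::real_vector"
  assumes i: "i \<in> I"
  shows "(\<Sum>w\<in>W. \<Sum>z\<in>Z. F (up i z w)) = real (card Z) *\<^sub>R sum F W"
proof -
  have "(\<Sum>(w, z)\<in>W \<times> Z. F (up i z w)) = (\<Sum>(w, z)\<in>W \<times> Z. F w)"
    by (rule sum.reindex_bij_witness[of _ "\<lambda>(w, z). (up i z w, ev i w)" "\<lambda>(w, z). (up i z w, ev i w)"])
       (auto simp: i up_in ev_in ev_up up_ev up_up)
  then show ?thesis
    by (simp add: sum.cartesian_product[symmetric] sum_constant_scaleR scaleR_sum_right)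
qed

text \<open>Overwriting coordinate \<open>i\<close> by \<open>z\<close> has the same effect as
  conditioning on \<open>ev i w = z\<close>; the factor on the right is the density of this
  conditioning.\<close>

lemma sum_up:
  fixes F :: "'w \<Rightarrow> 'e::real_vector"
  assumes i: "i \<in> I" and z: "z \<in> Z"
  shows "(\<Sum>w\<in>W. F (up i z w)) = (\<Sum>w\<in>W. (real (card Z) * of_bool (ev i w = z)) *\<^sub>R F w)"
proof -
  \<comment> \<open>The indicator picks out \<open>z' = z\<close> and brings the sum into the form
    of \<open>resample\<close>.\<close>
  have "(\<Sum>w\<in>W. F (up i z w)) = (\<Sum>w\<in>W. \<Sum>z'\<in>Z. of_bool (ev i (up i z' w) = z) *\<^sub>R F (up i z' w))"
  proof (rule sum.cong[OF refl])
    fix w assume w: "w \<in> W"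
    have "(\<Sum>z'\<in>Z. of_bool (ev i (up i z' w) = z) *\<^sub>R F (up i z' w)) =
        (\<Sum>z'\<in>Z. if z' = z then F (up i z w) else 0)"
      using i w by (intro sum.cong) (auto simp: ev_up)
    then show "F (up i z w) = (\<Sum>z'\<in>Z. of_bool (ev i (up i z' w) = z) *\<^sub>R F (up i z' w))"
      using z finite_Z by simp
  qed
  also have "\<dots> = real (card Z) *\<^sub>R (\<Sum>w\<in>W. of_bool (ev i w = z) *\<^sub>R F w)"
    by (rule resample[OF i])
  finally show ?thesis by (simp add: scaleR_sum_right)
qed

text \<open>The density of conditioning on \<open>ev i w = z\<close>, centred to have mean
  zero.\<close>

definition excess :: "'z \<Rightarrow> 'i \<Rightarrow> 'w \<Rightarrow> real" where
  "excess z i w = real (card Z) * of_bool (ev i w = z) - 1"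

text \<open>Excesses at distinct coordinates are uncorrelated: by \<open>sum_up\<close>, the density
  at \<open>j\<close> overwrites coordinate \<open>j\<close>, which the excess at \<open>i\<close>
  does not see, and the centring cancels what is left.\<close>

lemma sum_excess_mult:
  assumes i: "i \<in> I" and j: "j \<in> I" and "i \<noteq> j" and z: "z \<in> Z"
  shows "(\<Sum>w\<in>W. excess z i w * excess z j w) = 0"
proof -
  have "(\<Sum>w\<in>W. excess z i w * excess z j w) =
      (\<Sum>w\<in>W. excess z i (up j z w) - excess z i w)"
    using sum_up[OF j z, of "excess z i"]
    by (simp add: excess_def[of _ j] algebra_simps sum_subtractf)
  also have "\<dots> = 0"
    using assms by (intro sum.neutral) (auto simp: excess_def ev_up_other)
  finally show ?thesis .
qed

lemma sum_excess_square:
  assumes i: "i \<in> I" and z: "z \<in> Z"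
  shows "(\<Sum>w\<in>W. excess z i w * excess z i w) = real (card W) * (real (card Z) - 1)"
proof -
  have "excess z i (up i z w) = real (card Z) - 1" if "w \<in> W" for w
    using i z that by (simp add: excess_def ev_up)
  then have up: "(\<Sum>w\<in>W. excess z i (up i z w)) = real (card W) * (real (card Z) - 1)"
    by simp
  have "(\<Sum>w\<in>W. excess z i w) = 0"
    using sum_up[OF i z, of "\<lambda>_. 1 :: real"] by (simp add: excess_def sum_subtractf)
  moreover have "excess z i w * excess z i w =
      (real (card Z) * of_bool (ev i w = z)) *\<^sub>R excess z i w - excess z i w" for w
    by (simp add: excess_def algebra_simps)
  ultimately show ?thesis
    using sum_up[OF i z, of "excess z i"] up by (simp add: sum_subtractf)
qed

lemma sum_excess_sum_square:
  assumes K: "finite K" "K \<subseteq> I" and z: "z \<in> Z"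
  shows "(\<Sum>w\<in>W. (\<Sum>i\<in>K. excess z i w)\<^sup>2) \<le> real (card W) * real (card K) * real (card Z)"
proof -
  have "(\<Sum>w\<in>W. (\<Sum>i\<in>K. excess z i w)\<^sup>2) = (\<Sum>w\<in>W. \<Sum>i\<in>K. \<Sum>j\<in>K. excess z i w * excess z j w)"
    by (simp add: power2_eq_square sum_product)
  also have "\<dots> = (\<Sum>i\<in>K. \<Sum>w\<in>W. \<Sum>j\<in>K. excess z i w * excess z j w)"
    by (rule sum.swap)
  also have "\<dots> = (\<Sum>i\<in>K. \<Sum>j\<in>K. \<Sum>w\<in>W. excess z i w * excess z j w)"
    by (intro sum.cong[OF refl] sum.swap)
  also have "\<dots> = (\<Sum>i\<in>K. \<Sum>j\<in>K. if j = i then real (card W) * (real (card Z) - 1) else 0)"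
    using K z by (intro sum.cong[OF refl]) (auto simp: sum_excess_mult sum_excess_square subset_iff)
  also have "\<dots> = real (card W) * real (card K) * (real (card Z) - 1)"
    using K by simp
  also have "\<dots> \<le> real (card W) * real (card K) * real (card Z)"
    by (intro mult_left_mono) auto
  finally show ?thesis .
qed

text \<open>The difference is the mean of \<open>F\<close> weighted by the averaged excess. Since
  \<open>F\<close> is bounded, only the second moment of a real random variable has to be estimated,
  which works in every normed space.\<close>

lemma law_of_large_numbers:
  fixes F :: "'w \<Rightarrow> 'e::real_normed_vector"
  assumes K: "finite K" "K \<subseteq> I" "K \<noteq> {}" and z: "z \<in> Z" and F: "\<And>w. w \<in> W \<Longrightarrow> norm (F w) \<le> C"
    and W: "W \<noteq> {}"
  shows "norm ((1 / real (card K)) *\<^sub>R (\<Sum>i\<in>K. average W (\<lambda>w. F (up i z w))) - average W F)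
      \<le> C * sqrt (real (card Z) / real (card K))"
proof -
  \<comment> \<open>An upper bound for the standard deviation of the summed excess; with this choice
    both terms of the estimate \<open>am\<close> get the same bound.\<close>
  define a where "a = sqrt (real (card K) * real (card Z))"
  have k: "card K > 0" and zz: "card Z > 0" and ww: "card W > 0"
    using K z W finite_Z finite_W by (auto simp: card_gt_0_iff)
  have a: "a > 0" "a * a = real (card K) * real (card Z)"
    using k zz by (auto simp: a_def)
  have C: "C \<ge> 0" using W F norm_ge_zero order_trans by blast
  have "(\<Sum>i\<in>K. \<Sum>w\<in>W. F (up i z w)) - real (card K) *\<^sub>R sum F W
      = (\<Sum>i\<in>K. \<Sum>w\<in>W. excess z i w *\<^sub>R F w)"
    using K z by (simp add: excess_def scaleR_diff_left sum_subtractf sum_up subset_iff sum_constant_scaleR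
       cong: sum.cong)
  also have "\<dots> = (\<Sum>w\<in>W. (\<Sum>i\<in>K. excess z i w) *\<^sub>R F w)"
    by (subst sum.swap) (simp add: scaleR_sum_left)
  finally have eq: "(\<Sum>i\<in>K. \<Sum>w\<in>W. F (up i z w)) - real (card K) *\<^sub>R sum F W
      = (\<Sum>w\<in>W. (\<Sum>i\<in>K. excess z i w) *\<^sub>R F w)" .
  \<comment> \<open>AM-GM turns the second moment into a bound on the first absolute moment.\<close>
  have am: "\<bar>x\<bar> \<le> (x\<^sup>2 / a + a) / 2" for x
  proof -
    have "0 \<le> (\<bar>x\<bar> - a)\<^sup>2" by simp
    then show ?thesis using a(1) by (simp add: power2_diff field_simps power2_eq_square)
  qed
  have "norm (\<Sum>w\<in>W. (\<Sum>i\<in>K. excess z i w) *\<^sub>R F w) \<le> (\<Sum>w\<in>W. \<bar>\<Sum>i\<in>K. excess z i w\<bar> * C)"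
    by (rule sum_norm_le) (simp add: F mult_left_mono)
  also have "\<dots> \<le> (\<Sum>w\<in>W. ((\<Sum>i\<in>K. excess z i w)\<^sup>2 / a + a) / 2 * C)"
    by (intro sum_mono mult_right_mono am C)
  also have "\<dots> = ((\<Sum>w\<in>W. (\<Sum>i\<in>K. excess z i w)\<^sup>2) / a + real (card W) * a) / 2 * C"
    by (simp add: sum_distrib_right[symmetric] sum_divide_distrib[symmetric] sum.distrib)
  also have "\<dots> \<le> (real (card W) * (a * a) / a + real (card W) * a) / 2 * C"
    using sum_excess_sum_square[OF K(1,2) z] a C
    by (intro mult_right_mono divide_right_mono add_right_mono) (auto simp: mult.assoc)
  also have "\<dots> = real (card W) * a * C" using a(1) by simp
  finally have *: "norm ((\<Sum>i\<in>K. \<Sum>w\<in>W. F (up i z w)) - real (card K) *\<^sub>R sum F W)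
      \<le> real (card W) * a * C" unfolding eq .
  have "(1 / real (card K)) *\<^sub>R (\<Sum>i\<in>K. average W (\<lambda>w. F (up i z w))) - average W F =
     (1 / (real (card K) * real (card W))) *\<^sub>R
       ((\<Sum>i\<in>K. \<Sum>w\<in>W. F (up i z w)) - real (card K) *\<^sub>R sum F W)"
    using k by (simp add: average_def scaleR_diff_right scaleR_sum_right)
  then have "norm ((1 / real (card K)) *\<^sub>R (\<Sum>i\<in>K. average W (\<lambda>w. F (up i z w))) - average W F)
      = (1 / (real (card K) * real (card W))) *
       norm ((\<Sum>i\<in>K. \<Sum>w\<in>W. F (up i z w)) - real (card K) *\<^sub>R sum F W)"
    using k ww by simp
  also have "\<dots> \<le> (1 / (real (card K) * real (card W))) * (real (card W) * a * C)"
    by (intro mult_left_mono *) simp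
  also have "\<dots> = C * (a / real (card K))" using k ww by simp
  also have "a / real (card K) = sqrt (real (card Z) / real (card K))"
    using k by (simp add: a_def real_sqrt_mult real_sqrt_divide field_simps)
  finally show ?thesis .
qed

lemma average_ev:
  fixes P :: "'z \<Rightarrow> bool"
  assumes i: "i \<in> I"
  shows "average W (\<lambda>w. of_bool (P (ev i w)) :: real) = (if W = {} then 0 else real (card {z\<in>Z. P z}) / real (card Z))"
proof -
  have "(\<Sum>w\<in>W. \<Sum>z\<in>Z. of_bool (P (ev i (up i z w))) :: real) = (\<Sum>w\<in>W. \<Sum>z\<in>Z. of_bool (P z))"
    using i by (intro sum.cong) (auto simp: ev_up)
  also have "\<dots> = real (card W) * real (card {z\<in>Z. P z})"
    using finite_Z by (simp add: of_bool_def sum.If_cases Int_def)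
  finally have "real (card Z) * (\<Sum>w\<in>W. of_bool (P (ev i w))) = real (card W) * real (card {z\<in>Z. P z})"
    using resample[OF i, of "\<lambda>w. of_bool (P (ev i w)) :: real"] by simp
  moreover have "card Z > 0" if "w \<in> W" for w
    using ev_in[OF i that] finite_Z by (auto simp: card_gt_0_iff)
  ultimately show ?thesis
    using finite_W by (auto simp: average_def field_simps)
qed

end

section \<open>Bounded cocycles of lamplighter groups\<close>

lemma banach_module_linear: "banach_module G \<rho> \<Longrightarrow> g \<in> carrier G \<Longrightarrow> linear (\<rho> g)"
  by (simp add: banach_module_def)

lemma banach_module_norm: "banach_module G \<rho> \<Longrightarrow> g \<in> carrier G \<Longrightarrow> norm (\<rho> g v) = norm v"
  by (simp add: banach_module_def)

text \<open>Invariance is phrased as equivariance, and the bound \<open>C\<close> is explicit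
  because weak-* limits of cochains exist thanks to uniform bounds.\<close>

definition inv_cochain ::
  "('g, 'm) monoid_scheme \<Rightarrow> ('g \<Rightarrow> 'e::banach \<Rightarrow> 'e) \<Rightarrow> nat \<Rightarrow> real \<Rightarrow> ('g list \<Rightarrow> 'e) \<Rightarrow> bool" where
  "inv_cochain G \<rho> k C c \<longleftrightarrow> (\<forall>xs\<in>tuples G k. norm (c xs) \<le> C \<and>
     (\<forall>g\<in>carrier G. c (map (\<lambda>x. g \<otimes>\<^bsub>G\<^esub> x) xs) = \<rho> g (c xs)))"

lemma inv_cochain_norm: "inv_cochain G \<rho> k C c \<Longrightarrow> xs \<in> tuples G k \<Longrightarrow> norm (c xs) \<le> C"
  by (simp add: inv_cochain_def)

lemma inv_cochain_act: "inv_cochain G \<rho> k C c \<Longrightarrow> xs \<in> tuples G k \<Longrightarrow> g \<in> carrier G \<Longrightarrow>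
    c (map (\<lambda>x. g \<otimes>\<^bsub>G\<^esub> x) xs) = \<rho> g (c xs)"
  by (simp add: inv_cochain_def)

lemma (in group) replicate_one_in_tuples: "replicate (Suc k) \<one> \<in> tuples G k"
  by (auto simp: tuples_def)

lemma (in group) inv_cochain_nonneg: "inv_cochain G \<rho> k C c \<Longrightarrow> C \<ge> 0"
  using inv_cochain_norm[OF _ replicate_one_in_tuples] norm_ge_zero order_trans by blast

text \<open>Smear the prism between \<open>x\<close> and \<open>x \<otimes> y w\<close>. Left
  translations commute with right multiplications, which gives equivariance; the
  \<open>k + 1\<close> terms of the prism give the bound; \<open>prism_homotopy\<close> gives the
  formula, as its summand with \<open>delta c\<close> vanishes.\<close>

lemma (in group) averaging_homotopy:
  fixes c :: "'a list \<Rightarrow> 'e::banach" and y :: "'w \<Rightarrow> 'a"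
  assumes \<rho>: "banach_module G \<rho>" and c: "inv_cochain G \<rho> (Suc k) C c"
    and cocycle: "\<And>xs. xs \<in> tuples G (Suc (Suc k)) \<Longrightarrow> delta c xs = 0"
    and W: "finite W" "W \<noteq> {}" and y: "\<And>w. w \<in> W \<Longrightarrow> y w \<in> carrier G"
  defines "b \<equiv> smear W (prism fst (\<lambda>(x, w). x \<otimes> y w) c)"
  shows "inv_cochain G \<rho> k (real (Suc k) * C) b"
    and "xs \<in> tuples G (Suc k) \<Longrightarrow> c xs + delta b xs =
      average (words W (Suc (Suc k))) (\<lambda>ws. c (map2 (\<lambda>x w. x \<otimes> y w) xs ws))"
proof -
  let ?q = "\<lambda>(x, w). x \<otimes> y w"
  \<comment> \<open>A prism term has one entry more than \<open>vs\<close>, and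
    \<open>tuples G m\<close> contains lists of length \<open>m + 1\<close>; hence the index is
    exactly \<open>length vs\<close>.\<close>
  have tup: "map fst (take (Suc i) vs) @ map ?q (drop i vs) \<in> tuples G (length vs)"
    if "set vs \<subseteq> carrier G \<times> W" "i < length vs" for vs i
  proof -
    have "fst v \<in> carrier G" "?q v \<in> carrier G" if "v \<in> set vs" for v
      using that \<open>set vs \<subseteq> carrier G \<times> W\<close> y by auto
    then have "set (map fst (take (Suc i) vs) @ map ?q (drop i vs)) \<subseteq> carrier G"
      using set_take_subset[of "Suc i" vs] set_drop_subset[of i vs] by auto
    then show ?thesis using \<open>i < length vs\<close> by (simp add: tuples_def)
  qed
  have zip: "set (zip xs ws) \<subseteq> carrier G \<times> W" "length (zip xs ws) = Suc k"
    if "xs \<in> tuples G k" "ws \<in> words W (length xs)" for xs ws k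
    using that by (auto simp: tuples_def words_def dest: set_zip_leftD set_zip_rightD)
  show "inv_cochain G \<rho> k (real (Suc k) * C) b"
    unfolding inv_cochain_def
  proof (intro ballI conjI)
    fix xs assume xs: "xs \<in> tuples G k"
    show "norm (b xs) \<le> real (Suc k) * C"
      unfolding b_def smear_def
    proof (rule norm_average_le)
      fix ws assume ws: "ws \<in> words W (length xs)"
      note vs = zip[OF xs ws]
      have "norm (prism fst ?q c (zip xs ws)) \<le> (\<Sum>i<length (zip xs ws). C)"
        unfolding prism_def
      proof (rule sum_norm_le)
        fix i assume "i \<in> {..<length (zip xs ws)}"
        then have "map fst (take (Suc i) (zip xs ws)) @ map ?q (drop i (zip xs ws)) \<in> tuples G (Suc k)"
          using tup[OF vs(1), of i] vs(2) by (simp only: lessThan_iff)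
        from inv_cochain_norm[OF c this]
        show "norm ((-1) ^ i *\<^sub>R c (map fst (take (Suc i) (zip xs ws)) @ map ?q (drop i (zip xs ws)))) \<le> C"
          by simp
      qed
      then show "norm (prism fst ?q c (zip xs ws)) \<le> real (Suc k) * C"
        using vs(2) by simp
    qed (use inv_cochain_nonneg[OF c] in simp)
    fix g assume g: "g \<in> carrier G"
    have "prism fst ?q c (zip (map (\<lambda>x. g \<otimes> x) xs) ws) = \<rho> g (prism fst ?q c (zip xs ws))"
      if ws: "ws \<in> words W (length xs)" for ws
    proof -
      note vs = zip[OF xs ws]
      let ?vs = "zip xs ws"
      have "map fst (take (Suc i) (zip (map (\<lambda>x. g \<otimes> x) xs) ws))
          @ map ?q (drop i (zip (map (\<lambda>x. g \<otimes> x) xs) ws))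
          = map (\<lambda>x. g \<otimes> x) (map fst (take (Suc i) ?vs) @ map ?q (drop i ?vs))" for i
        using vs(1) g y unfolding zip_map1
        by (auto simp: take_map drop_map m_assoc dest!: in_set_dropD)
      then have "prism fst ?q c (zip (map (\<lambda>x. g \<otimes> x) xs) ws) =
          (\<Sum>i<length ?vs. (-1) ^ i *\<^sub>R c (map (\<lambda>x. g \<otimes> x)
            (map fst (take (Suc i) ?vs) @ map ?q (drop i ?vs))))"
        by (simp only: prism_def length_zip length_map)
      also have "\<dots> =
          (\<Sum>i<length ?vs. (-1) ^ i *\<^sub>R \<rho> g (c (map fst (take (Suc i) ?vs) @ map ?q (drop i ?vs))))"
      proof (rule sum.cong[OF refl])
        fix i assume "i \<in> {..<length ?vs}"
        then have "map fst (take (Suc i) ?vs) @ map ?q (drop i ?vs) \<in> tuples G (Suc k)"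
          using tup[OF vs(1), of i] vs(2) by (simp only: lessThan_iff)
        from inv_cochain_act[OF c this g]
        show "(-1) ^ i *\<^sub>R c (map (\<lambda>x. g \<otimes> x) (map fst (take (Suc i) ?vs) @ map ?q (drop i ?vs)))
            = (-1) ^ i *\<^sub>R \<rho> g (c (map fst (take (Suc i) ?vs) @ map ?q (drop i ?vs)))"
          by (simp only:)
      qed
      finally show ?thesis
        unfolding prism_def
        by (simp add: linear_sum[OF banach_module_linear[OF \<rho> g]]
            linear_scale[OF banach_module_linear[OF \<rho> g]])
    qed
    then show "b (map (\<lambda>x. g \<otimes> x) xs) = \<rho> g (b xs)"
      unfolding b_def smear_def linear_average[OF banach_module_linear[OF \<rho> g]]
      by (auto intro: average_cong)
  qed
  assume xs: "xs \<in> tuples G (Suc k)"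
  have "delta b xs = smear W (\<lambda>vs. c (map ?q vs) - c (map fst vs) - prism fst ?q (delta c) vs) xs"
    unfolding b_def delta_smear[OF W]
    by (rule arg_cong[where f = "\<lambda>f. smear W f xs"]) (simp add: prism_homotopy[symmetric])
  also have "smear W (prism fst ?q (delta c)) xs = average (words W (length xs)) (\<lambda>_. 0)"
    unfolding smear_def
  proof (rule average_cong)
    fix ws assume ws: "ws \<in> words W (length xs)"
    note vs = zip[OF xs ws]
    show "prism fst ?q (delta c) (zip xs ws) = 0"
      unfolding prism_def
    proof (rule sum.neutral, rule ballI)
      fix i assume "i \<in> {..<length (zip xs ws)}"
      then have "map fst (take (Suc i) (zip xs ws)) @ map ?q (drop i (zip xs ws)) \<in> tuples G (Suc (Suc k))"
        using tup[OF vs(1), of i] vs(2) by (simp only: lessThan_iff)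
      from cocycle[OF this]
      show "(-1) ^ i *\<^sub>R delta c (map fst (take (Suc i) (zip xs ws)) @ map ?q (drop i (zip xs ws))) = 0"
        by (simp only: scaleR_zero_right)
    qed
  qed
  then have "smear W (\<lambda>vs. c (map ?q vs) - c (map fst vs) - prism fst ?q (delta c) vs) xs =
      smear W (\<lambda>vs. c (map ?q vs)) xs - c xs"
    by (simp add: smear_diff smear_map_fst[OF W] average_def)
  finally show "c xs + delta b xs =
      average (words W (Suc (Suc k))) (\<lambda>ws. c (map2 (\<lambda>x w. x \<otimes> y w) xs ws))"
    using xs by (simp add: smear_def tuples_def)
qed

locale dual_module = group G + dual_pairing T
  for G (structure) and T :: "'e::banach \<Rightarrow> ('f::banach \<Rightarrow>\<^sub>L real)" +
  fixes \<rho> :: "'a \<Rightarrow> 'e \<Rightarrow> 'e" and \<sigma> :: "'a \<Rightarrow> 'f \<Rightarrow> 'f"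
  assumes module: "banach_module G \<rho>"
    and dual_action: "\<And>g v \<phi>. g \<in> carrier G \<Longrightarrow> T (\<rho> g v) \<phi> = T v (\<sigma> (inv g) \<phi>)"
begin

text \<open>The action is adjoint to the action on the predual, hence weak-* continuous.\<close>

lemma wlim_action: "g \<in> carrier G \<Longrightarrow> wlim U e v \<Longrightarrow> wlim U (\<lambda>i. \<rho> g (e i)) (\<rho> g v)"
  by (simp add: wlim_def dual_action)

lemma wlim_delta:
  assumes xs: "xs \<in> tuples G (Suc k)"
    and b: "\<forall>xs\<in>tuples G k. wlim U (\<lambda>i. b i xs) (b' xs)"
  shows "wlim U (\<lambda>i. c xs + delta (b i) xs) (c xs + delta b' xs)"
  unfolding delta_def
proof (intro wlim_add wlim_const wlim_sum wlim_scaleR b[rule_format])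
  fix i assume "i \<in> {..<length xs}"
  then show "take i xs @ drop (Suc i) xs \<in> tuples G k"
    using xs by (auto simp: tuples_def dest!: in_set_takeD in_set_dropD)
qed

text \<open>Pointwise weak-* limits exist by the common bound, and both the bound and equivariance
  survive the limit.\<close>

lemma cochain_limit:
  assumes U: "ultra U" and b: "\<And>i. inv_cochain G \<rho> k C (b i)"
  obtains b' where "inv_cochain G \<rho> k C b'" "\<forall>xs\<in>tuples G k. wlim U (\<lambda>i. b i xs) (b' xs)"
proof -
  have "\<forall>xs\<in>tuples G k. \<exists>v. wlim U (\<lambda>i. b i xs) v"
  proof
    fix xs assume "xs \<in> tuples G k"
    then have "norm (b i xs) \<le> C" for i by (rule inv_cochain_norm[OF b])
    from wlim_exists[OF U this] obtain v where "wlim U (\<lambda>i. b i xs) v" .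
    then show "\<exists>v. wlim U (\<lambda>i. b i xs) v" by (rule exI)
  qed
  from bchoice[OF this] obtain b' where b': "xs \<in> tuples G k \<Longrightarrow> wlim U (\<lambda>i. b i xs) (b' xs)" for xs
    by blast
  have Ubot: "U \<noteq> bot" using U by (simp add: ultra_def)
  have "inv_cochain G \<rho> k C b'"
    unfolding inv_cochain_def
  proof (intro ballI conjI)
    fix xs assume xs: "xs \<in> tuples G k"
    show "norm (b' xs) \<le> C"
      using inv_cochain_norm[OF b xs] by (intro wlim_norm_le[OF Ubot b'[OF xs]]) simp
    fix g assume g: "g \<in> carrier G"
    then have gxs: "map (\<lambda>x. g \<otimes> x) xs \<in> tuples G k" using xs by (auto simp: tuples_def)
    show "b' (map (\<lambda>x. g \<otimes> x) xs) = \<rho> g (b' xs)"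
      using wlim_unique[OF Ubot b'[OF gxs]] wlim_action[OF g b'[OF xs]]
      by (simp add: inv_cochain_act[OF b xs g])
  qed
  then show thesis using b' that by blast
qed

end

section \<open>Lamplighter structures\<close>

definition lamps :: "('g, 'm) monoid_scheme \<Rightarrow> 'g set \<Rightarrow> (nat \<Rightarrow> 'g) set" where
  "lamps G S = {z. range z \<subseteq> insert \<one>\<^bsub>G\<^esub> S \<and> finite {j. z j \<noteq> \<one>\<^bsub>G\<^esub>}}"

lemma lamps_comp:
  assumes "z \<in> lamps G S" "inj \<pi>"
  shows "z \<circ> \<pi> \<in> lamps G S"
proof -
  have "finite (\<pi> -` {j. z j \<noteq> \<one>\<^bsub>G\<^esub>})"
    using assms by (intro finite_vimageI) (auto simp: lamps_def)
  then show ?thesis using assms(1) by (auto simp: lamps_def vimage_def)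
qed

text \<open>\<open>lamp z\<close> plays the role of the product over all blocks \<open>j\<close> of a copy of \<open>z j\<close> acting in block \<open>j\<close>, block
  \<open>0\<close> being the one where \<open>S\<close> itself acts; \<open>A N\<close> consists of permutations of the first \<open>N\<close> blocks. a
  transposition only has to be matched on a given finite set, because it is not even.\<close>

locale lamplighter = group G for G (structure) +
  fixes S :: "'a set" and lamp :: "(nat \<Rightarrow> 'a) \<Rightarrow> 'a" and A :: "nat \<Rightarrow> 'a set"
  assumes S: "finite S" "S \<subseteq> carrier G"
    and lamp_closed: "z \<in> lamps G S \<Longrightarrow> lamp z \<in> carrier G"
    and lamp_mult: "z \<in> lamps G S \<Longrightarrow> z 0 = \<one> \<Longrightarrow> s \<in> S \<Longrightarrow> s \<otimes> lamp z = lamp (z(0 := s))"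
    and finite_A: "finite (A N)" and A_nonempty: "A N \<noteq> {}" and A_closed: "A N \<subseteq> carrier G"
    and transpositions: "finite B \<Longrightarrow> \<exists>\<pi> N0 t. (\<forall>j. \<pi> (\<pi> j) = j) \<and>
        (\<forall>j\<in>B. \<pi> j = Transposition.transpose a b j) \<and>
        (\<forall>N\<ge>N0. (\<forall>j<N. \<pi> j < N) \<and> t \<in> A N \<and> (\<forall>x\<in>A N. t \<otimes> x \<in> A N)) \<and>
        (\<forall>z\<in>lamps G S. t \<otimes> lamp z = lamp (z \<circ> \<pi>) \<otimes> t)"

section \<open>Random group elements and conditional means\<close>

locale lamplighter_cocycle = dual_module G T \<rho> \<sigma> + lamplighter G S lamp A
  for G (structure) and T :: "'e::banach \<Rightarrow> ('f::banach \<Rightarrow>\<^sub>L real)" and \<rho> \<sigma> S lamp A +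
  fixes c :: "'a list \<Rightarrow> 'e" and k :: nat and C :: real and L :: nat
  assumes c: "inv_cochain G \<rho> (Suc k) C c" and L: "L > 0"
begin

text \<open>The second component of a letter is a tag: tags below \<open>L\<close> mark copies of \<open>\<one>\<close>, so that a uniformly
  random letter is \<open>\<one>\<close> with probability close to \<open>1\<close> for large \<open>L\<close>.\<close>

definition letters :: "('a \<times> nat) set" where
  "letters = {\<one>} \<times> {..<L} \<union> S \<times> {L}"

text \<open>With the uniform measure, this is the law of the random element: independent letters in
  the first \<open>N\<close> blocks and an independent element of \<open>A N\<close>.\<close>

definition states :: "nat \<Rightarrow> ((nat \<Rightarrow> 'a \<times> nat) \<times> 'a) set" where
  "states N = {z. \<forall>j. (j \<in> {..<N} \<longrightarrow> z j \<in> letters) \<and> (j \<notin> {..<N} \<longrightarrow> z j = (\<one>, 0))} \<times> A N"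

definition elt :: "(nat \<Rightarrow> 'a \<times> nat) \<times> 'a \<Rightarrow> 'a" where
  "elt = (\<lambda>(z, a). lamp (fst \<circ> z) \<otimes> a)"

definition samples :: "nat \<Rightarrow> ((nat \<Rightarrow> 'a \<times> nat) \<times> 'a) list set" where
  "samples N = words (states N) (Suc (Suc k))"

definition ev :: "nat \<Rightarrow> ((nat \<Rightarrow> 'a \<times> nat) \<times> 'a) list \<Rightarrow> ('a \<times> nat) list" where
  "ev j = map (\<lambda>(z, a). z j)"

text \<open>Entry \<open>i\<close> of \<open>\<gamma>\<close> is written into the blocks of
  \<open>J\<close> in sample number \<open>i\<close>. Blocks beyond the first \<open>N\<close> may
  be written as well, so that \<open>mean N\<close> makes sense for every finite
  \<open>J\<close>.\<close>

definition set_at ::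
  "nat set \<Rightarrow> ('a \<times> nat) list \<Rightarrow> ((nat \<Rightarrow> 'a \<times> nat) \<times> 'a) list \<Rightarrow> ((nat \<Rightarrow> 'a \<times> nat) \<times> 'a) list" where
  "set_at J = map2 (\<lambda>l (z, a). (\<lambda>j. if j \<in> J then l else z j, a))"

lemma finite_letters: "finite letters"
  using S by (simp add: letters_def)

lemma card_letters: "card letters = L + card S"
proof -
  have "card letters = card ({\<one>} \<times> {..<L}) + card (S \<times> {L})"
    unfolding letters_def using S by (intro card_Un_disjoint) auto
  then show ?thesis by (simp add: card_cartesian_product)
qed

lemma blank_letter: "(\<one>, 0) \<in> letters"
  using L by (simp add: letters_def)

lemma finite_states: "finite (states N)"
  unfolding states_def
  by (intro finite_cartesian_product finite_set_of_finite_funs finite_letters finite_A) simp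

lemma states_nonempty: "states N \<noteq> {}"
proof -
  obtain a where "a \<in> A N" using A_nonempty by blast
  then have "(\<lambda>_. (\<one>, 0), a) \<in> states N" using blank_letter by (simp add: states_def)
  then show ?thesis by blast
qed

lemma finite_samples: "finite (samples N)" and samples_nonempty: "samples N \<noteq> {}"
  by (simp_all add: samples_def finite_words finite_states words_nonempty states_nonempty)

lemma length_sample: "ws \<in> samples N \<Longrightarrow> length ws = Suc (Suc k)"
  by (simp add: samples_def words_def)

lemma nth_sample: "ws \<in> samples N \<Longrightarrow> i < Suc (Suc k) \<Longrightarrow> ws ! i \<in> states N"
  by (auto simp: samples_def words_def)

lemma length_set_at: "length (set_at J \<gamma> ws) = min (length \<gamma>) (length ws)"
  by (simp add: set_at_def)

lemma nth_set_at_pair: "i < length \<gamma> \<Longrightarrow> i < length ws \<Longrightarrow> ws ! i = (z, a) \<Longrightarrow>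
    set_at J \<gamma> ws ! i = (\<lambda>j. if j \<in> J then \<gamma> ! i else z j, a)"
  by (simp add: set_at_def)

lemma nth_set_at: "i < length \<gamma> \<Longrightarrow> i < length ws \<Longrightarrow>
    set_at J \<gamma> ws ! i = (\<lambda>j. if j \<in> J then \<gamma> ! i else fst (ws ! i) j, snd (ws ! i))"
  by (rule nth_set_at_pair) simp_all

lemma nth_ev: "i < length ws \<Longrightarrow> ev j ws ! i = fst (ws ! i) j"
  by (simp add: ev_def split: prod.splits)

lemma length_ev [simp]: "length (ev j ws) = length ws"
  by (simp add: ev_def)

lemma set_at_empty: "length \<gamma> = length ws \<Longrightarrow> set_at {} \<gamma> ws = ws"
  by (rule nth_equalityI) (simp_all add: length_set_at nth_set_at)

lemma set_at_set_at: "length \<gamma> = length ws \<Longrightarrow> set_at J \<gamma> (set_at J' \<gamma> ws) = set_at (J \<union> J') \<gamma> ws"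
  by (rule nth_equalityI) (auto simp: length_set_at nth_set_at)

lemma in_wordsI: "length xs = n \<Longrightarrow> (\<And>i. i < n \<Longrightarrow> xs ! i \<in> W) \<Longrightarrow> xs \<in> words W n"
  by (auto simp: words_def in_set_conv_nth)

lemma words_nth: "xs \<in> words W n \<Longrightarrow> i < n \<Longrightarrow> xs ! i \<in> W" and words_length: "xs \<in> words W n \<Longrightarrow> length xs = n"
  by (auto simp: words_def)

text \<open>A single coordinate consists of the letters that all \<open>k + 2\<close> samples have
  in one block, since \<open>set_at\<close> writes them simultaneously.\<close>

lemma coordinates:
  "product_coordinates (samples N) (words letters (Suc (Suc k))) {..<N} ev (\<lambda>j. set_at {j})"
proof
  fix i z w assume i: "i \<in> {..<N}" and z: "z \<in> words letters (Suc (Suc k))" and w: "w \<in> samples N"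
  note len = length_sample[OF w] words_length[OF z]
  show "set_at {i} z w \<in> samples N"
    unfolding samples_def
  proof (rule in_wordsI)
    fix l assume l: "l < Suc (Suc k)"
    show "set_at {i} z w ! l \<in> states N"
      using nth_sample[OF w l] words_nth[OF z l] i l len
      by (auto simp: nth_set_at states_def)
  qed (simp add: length_set_at len)
  show "ev i (set_at {i} z w) = z"
    by (rule nth_equalityI) (simp_all add: length_set_at nth_set_at nth_ev len)
  show "set_at {i} z (set_at {i} z' w) = set_at {i} z w" if "z' \<in> words letters (Suc (Suc k))" for z'
    by (rule nth_equalityI) (simp_all add: length_set_at nth_set_at fun_eq_iff len words_length[OF that])
  show "ev j (set_at {i} z w) = ev j w" if "j \<noteq> i" for j
    by (rule nth_equalityI) (simp_all add: length_set_at nth_set_at nth_ev len that)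
next
  fix i w assume i: "i \<in> {..<N}" and w: "w \<in> samples N"
  note len = length_sample[OF w]
  show "ev i w \<in> words letters (Suc (Suc k))"
  proof (rule in_wordsI)
    show "ev i w ! l \<in> letters" if l: "l < Suc (Suc k)" for l
      using nth_sample[OF w l] i l len by (auto simp: nth_ev states_def)
  qed (simp add: len)
  show "set_at {i} (ev i w) w = w"
    by (rule nth_equalityI) (auto simp: length_set_at nth_set_at nth_ev len fun_eq_iff prod_eq_iff)
qed (simp_all add: finite_samples finite_words finite_letters)

lemma lamp_state:
  assumes "finite J" "l \<in> letters" "(z, a) \<in> states N"
  shows "fst \<circ> (\<lambda>j. if j \<in> J then l else z j) \<in> lamps G S"
proof -
  have zj: "z j \<in> letters" for j
    using assms(3) blank_letter by (cases "j < N") (auto simp: states_def)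
  have "(fst \<circ> (\<lambda>j. if j \<in> J then l else z j)) j = \<one>" if "j \<notin> J \<union> {..<N}" for j
    using that assms(3) by (simp add: states_def)
  then have "{j. (fst \<circ> (\<lambda>j. if j \<in> J then l else z j)) j \<noteq> \<one>} \<subseteq> J \<union> {..<N}" by blast
  then have "finite {j. (fst \<circ> (\<lambda>j. if j \<in> J then l else z j)) j \<noteq> \<one>}"
    by (rule finite_subset) (simp add: assms(1))
  moreover have "fst x \<in> insert \<one> S" if "x \<in> letters" for x
    using that by (auto simp: letters_def)
  then have "(fst \<circ> (\<lambda>j. if j \<in> J then l else z j)) j \<in> insert \<one> S" for j
    using zj[of j] assms(2) by (cases "j \<in> J") simp_all
  ultimately show ?thesis unfolding lamps_def by blast
qed

lemma elt_closed:
  assumes "(z, a) \<in> states N"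
  shows "elt (z, a) \<in> carrier G"
  using lamp_state[OF finite.emptyI blank_letter assms] assms A_closed
  by (auto simp: elt_def states_def intro!: m_closed lamp_closed)

lemma set_at_in_tuples:
  assumes "finite J" and \<gamma>: "\<gamma> \<in> words letters (Suc (Suc k))" and ws: "ws \<in> samples N"
  shows "map elt (set_at J \<gamma> ws) \<in> tuples G (Suc k)"
proof -
  note len = length_sample[OF ws] words_length[OF \<gamma>]
  have "elt (set_at J \<gamma> ws ! i) \<in> carrier G" if i: "i < Suc (Suc k)" for i
  proof -
    obtain z a where za: "ws ! i = (z, a)" by (cases "ws ! i")
    have *: "(z, a) \<in> states N" using nth_sample[OF ws i] za by simp
    then have "a \<in> carrier G" using A_closed by (auto simp: states_def)
    then show ?thesis
      using lamp_state[OF assms(1) words_nth[OF \<gamma> i] *] i len za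
      by (simp add: nth_set_at_pair elt_def lamp_closed)
  qed
  then have "elt x \<in> carrier G" if "x \<in> set (set_at J \<gamma> ws)" for x
  proof -
    from that obtain i where "i < length (set_at J \<gamma> ws)" "x = set_at J \<gamma> ws ! i"
      unfolding in_set_conv_nth by blast
    then show ?thesis using \<open>\<And>i. i < Suc (Suc k) \<Longrightarrow> elt (set_at J \<gamma> ws ! i) \<in> carrier G\<close> len
      by (simp add: length_set_at)
  qed
  then show ?thesis using len by (auto simp: tuples_def length_set_at)
qed

text \<open>For \<open>J\<close> within the first \<open>N\<close> blocks, the average conditioned
  on having the letters \<open>\<gamma>\<close> in every block of \<open>J\<close>; the limit over
  \<open>N\<close> will be the family to which \<open>insertion_trivial\<close> applies.\<close>

definition mean :: "nat \<Rightarrow> ('a \<times> nat) list \<Rightarrow> nat set \<Rightarrow> 'e" where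
  "mean N \<gamma> J = average (samples N) (\<lambda>ws. c (map elt (set_at J \<gamma> ws)))"

lemma norm_mean:
  "finite J \<Longrightarrow> \<gamma> \<in> words letters (Suc (Suc k)) \<Longrightarrow> norm (mean N \<gamma> J) \<le> C"
  unfolding mean_def
  by (intro norm_average_le inv_cochain_norm[OF c] set_at_in_tuples inv_cochain_nonneg[OF c])

text \<open>The law of large numbers over the blocks in \<open>K\<close>, for the function that
  already has \<open>\<gamma>\<close> written in \<open>J\<close>. The bound does not depend on
  \<open>N\<close>.\<close>

lemma mean_insert:
  assumes J: "finite J" and K: "finite K" "K \<noteq> {}" "K \<subseteq> {..<N}" and \<gamma>: "\<gamma> \<in> words letters (Suc (Suc k))"
  shows "norm ((1 / real (card K)) *\<^sub>R (\<Sum>j\<in>K. mean N \<gamma> (insert j J)) - mean N \<gamma> J)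
    \<le> C * sqrt (real (card (words letters (Suc (Suc k)))) / real (card K))"
proof -
  interpret product_coordinates "samples N" "words letters (Suc (Suc k))" "{..<N}" ev "\<lambda>j. set_at {j}"
    by (rule coordinates)
  have "mean N \<gamma> (insert j J) = average (samples N) (\<lambda>ws. c (map elt (set_at J \<gamma> (set_at {j} \<gamma> ws))))" for j
    unfolding mean_def
    by (rule average_cong) (simp add: set_at_set_at length_sample words_length[OF \<gamma>])
  moreover have "norm (c (map elt (set_at J \<gamma> ws))) \<le> C" if "ws \<in> samples N" for ws
    by (rule inv_cochain_norm[OF c set_at_in_tuples[OF J \<gamma> that]])
  ultimately show ?thesis
    using law_of_large_numbers[OF K(1,3,2) \<gamma> _ samples_nonempty, of "\<lambda>ws. c (map elt (set_at J \<gamma> ws))" C]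
    by (simp add: mean_def)
qed

lemma mean_action:
  assumes \<pi>: "\<And>j. \<pi> (\<pi> j) = j" "\<And>j. j < N \<Longrightarrow> \<pi> j < N"
    and t: "t \<in> A N" "\<And>x. x \<in> A N \<Longrightarrow> t \<otimes> x \<in> A N"
      "\<And>z. z \<in> lamps G S \<Longrightarrow> t \<otimes> lamp z = lamp (z \<circ> \<pi>) \<otimes> t"
    and J: "finite J" and \<gamma>: "\<gamma> \<in> words letters (Suc (Suc k))"
  shows "\<rho> t (mean N \<gamma> J) = mean N \<gamma> (\<pi> ` J)"
proof -
  have tG: "t \<in> carrier G" using t(1) A_closed by blast
  define act where "act = map (\<lambda>(z :: nat \<Rightarrow> 'a \<times> nat, a). (z \<circ> \<pi>, t \<otimes> a))"
  have \<pi>': "\<pi> j < N \<longleftrightarrow> j < N" for j using \<pi> by metis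
  have act_in: "act ws \<in> samples N" if ws: "ws \<in> samples N" for ws
    unfolding samples_def
  proof (rule in_wordsI)
    fix i assume i: "i < Suc (Suc k)"
    show "act ws ! i \<in> states N"
      using nth_sample[OF ws i] i length_sample[OF ws] t(2) \<pi>'
      by (cases "ws ! i") (auto simp: act_def states_def)
  qed (simp add: act_def length_sample[OF ws])
  have "inj_on act (samples N)"
  proof (rule inj_onI)
    fix ws ws' assume ws: "ws \<in> samples N" "ws' \<in> samples N" and eq: "act ws = act ws'"
    show "ws = ws'"
    proof (rule nth_equalityI)
      show "length ws = length ws'" using ws by (simp add: length_sample)
      fix i assume i: "i < length ws"
      obtain z a z' a' where za: "ws ! i = (z, a)" "ws' ! i = (z', a')" by fastforce
      have "(z, a) \<in> states N" "(z', a') \<in> states N"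
        using nth_sample[OF ws(1)] nth_sample[OF ws(2)] i za length_sample[OF ws(1)] by metis+
      then have "a \<in> carrier G" "a' \<in> carrier G" using A_closed by (auto simp: states_def)
      moreover have "z \<circ> \<pi> = z' \<circ> \<pi>" "t \<otimes> a = t \<otimes> a'"
        using arg_cong[OF eq, of "\<lambda>l. l ! i"] i za ws by (simp_all add: act_def length_sample)
      moreover have "z = z'"
      proof
        fix j show "z j = z' j" using fun_cong[OF \<open>z \<circ> \<pi> = z' \<circ> \<pi>\<close>, of "\<pi> j"] \<pi>(1) by simp
      qed
      ultimately show "ws ! i = ws' ! i" using za tG by simp
    qed
  qed
  then have bij: "bij_betw act (samples N) (samples N)"
    using act_in finite_samples by (simp add: bij_betw_def endo_inj_surj image_subsetI)
  have "\<rho> t (c (map elt (set_at J \<gamma> ws))) = c (map elt (set_at (\<pi> ` J) \<gamma> (act ws)))"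
    if ws: "ws \<in> samples N" for ws
  proof -
    note len = length_sample[OF ws] words_length[OF \<gamma>]
    have "map (\<lambda>x. t \<otimes> x) (map elt (set_at J \<gamma> ws)) = map elt (set_at (\<pi> ` J) \<gamma> (act ws))"
    proof (rule nth_equalityI)
      fix i assume "i < length (map (\<lambda>x. t \<otimes> x) (map elt (set_at J \<gamma> ws)))"
      then have i: "i < Suc (Suc k)" by (simp add: length_set_at len)
      obtain z a where za: "ws ! i = (z, a)" by (cases "ws ! i")
      have st: "(z, a) \<in> states N" using nth_sample[OF ws i] za by simp
      then have a: "a \<in> carrier G" using A_closed by (auto simp: states_def)
      let ?z = "fst \<circ> (\<lambda>j. if j \<in> J then \<gamma> ! i else z j)"
      have lz: "?z \<in> lamps G S" by (rule lamp_state[OF J words_nth[OF \<gamma> i] st])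
      have "?z \<circ> \<pi> \<in> lamps G S"
        by (rule lamps_comp[OF lz]) (use \<pi>(1) in \<open>auto intro: inj_on_inverseI\<close>)
      then have "t \<otimes> (lamp ?z \<otimes> a) = lamp (?z \<circ> \<pi>) \<otimes> (t \<otimes> a)"
        using t(3)[OF lz] a tG lamp_closed lz by (simp add: m_assoc[symmetric])
      moreover have "?z \<circ> \<pi> = fst \<circ> (\<lambda>j. if j \<in> \<pi> ` J then \<gamma> ! i else (z \<circ> \<pi>) j)"
      proof
        fix j
        have "\<pi> j \<in> J \<longleftrightarrow> j \<in> \<pi> ` J" using \<pi>(1) by (metis image_iff)
        then show "(?z \<circ> \<pi>) j = (fst \<circ> (\<lambda>j. if j \<in> \<pi> ` J then \<gamma> ! i else (z \<circ> \<pi>) j)) j" by simp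
      qed
      ultimately show "map (\<lambda>x. t \<otimes> x) (map elt (set_at J \<gamma> ws)) ! i = map elt (set_at (\<pi> ` J) \<gamma> (act ws)) ! i"
        using i za len by (simp add: nth_set_at_pair length_set_at act_def elt_def)
    qed (simp add: length_set_at act_def)
    then show ?thesis
      using inv_cochain_act[OF c set_at_in_tuples[OF J \<gamma> ws] tG] by simp
  qed
  then have "\<rho> t (mean N \<gamma> J) = average (samples N) (\<lambda>ws. c (map elt (set_at (\<pi> ` J) \<gamma> (act ws))))"
    unfolding mean_def linear_average[OF banach_module_linear[OF module tG]]
    by (rule average_cong)
  also have "\<dots> = mean N \<gamma> (\<pi> ` J)"
    unfolding mean_def average_def
    using sum.reindex_bij_betw[OF bij, of "\<lambda>ws. c (map elt (set_at (\<pi> ` J) \<gamma> ws))"] by (simp only:)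
  finally show ?thesis .
qed

end

section \<open>Limits over growing numbers of blocks\<close>

context lamplighter_cocycle
begin

text \<open>The weak-* limits of \<open>mean N \<gamma> J\<close> form an insertion family, so by
  \<open>insertion_trivial\<close> conditioning on block \<open>0\<close> has no effect in the
  limit.\<close>

lemma mean_limit:
  assumes D: "countable D" "closure D = (UNIV :: 'e set)"
    and U: "ultra U" "U \<le> sequentially" and \<gamma>: "\<gamma> \<in> words letters (Suc (Suc k))"
  obtains v where "wlim U (\<lambda>N. mean N \<gamma> {0}) v" "wlim U (\<lambda>N. mean N \<gamma> {}) v"
proof -
  have Ubot: "U \<noteq> bot" using U(1) by (simp add: ultra_def)
  have ev: "eventually P U" if "eventually P sequentially" for P
    using that U(2) by (simp add: le_filter_def)
  have "\<forall>J\<in>Collect finite. \<exists>v. wlim U (\<lambda>N. mean N \<gamma> J) v"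
  proof
    fix J :: "nat set" assume "J \<in> Collect finite"
    then have "norm (mean N \<gamma> J) \<le> C" for N by (intro norm_mean \<gamma>) simp
    from wlim_exists[OF U(1) this] obtain v where "wlim U (\<lambda>N. mean N \<gamma> J) v" .
    then show "\<exists>v. wlim U (\<lambda>N. mean N \<gamma> J) v" by (rule exI)
  qed
  from bchoice[OF this] obtain s where "\<forall>J\<in>Collect finite. wlim U (\<lambda>N. mean N \<gamma> J) (s J)" ..
  then have s: "wlim U (\<lambda>N. mean N \<gamma> J) (s J)" if "finite J" for J using that by simp
  interpret insertion_family T s C
  proof
    show "norm (s J) \<le> C" if "finite J" for J
      using norm_mean[OF that \<gamma>] by (intro wlim_norm_le[OF Ubot s[OF that]]) simp
  next
    fix J and j :: "nat \<Rightarrow> nat" assume J: "finite J" "inj j" "range j \<inter> J = {}"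
    let ?K = "real (card (words letters (Suc (Suc k))))"
    \<comment> \<open>For fixed \<open>M\<close> the law of large numbers holds with the same bound
      for all large \<open>N\<close>, so the bound survives the limit over \<open>N\<close>;
      afterwards \<open>M\<close> tends to infinity.\<close>
    have bound: "norm ((1 / real M) *\<^sub>R (\<Sum>i<M. s (insert (j i) J)) - s J) \<le> C * sqrt (?K / real M)"
      if M: "M > 0" for M
    proof (rule wlim_norm_le[OF Ubot wlim_diff[OF wlim_scaleR[OF wlim_sum] s[OF J(1)]]])
      show "wlim U (\<lambda>N. mean N \<gamma> (insert (j i) J)) (s (insert (j i) J))" for i
        using J by (intro s) simp
      obtain m where m: "\<And>l. l \<in> j ` {..<M} \<Longrightarrow> l < m"
        using finite_nat_set_iff_bounded[of "j ` {..<M}"] by blast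
      have inj: "inj_on j {..<M}" using J(2) by (rule inj_on_subset) simp
      have "norm ((1 / real M) *\<^sub>R (\<Sum>i<M. mean N \<gamma> (insert (j i) J)) - mean N \<gamma> J) \<le> C * sqrt (?K / real M)"
        if N: "N \<ge> m" for N
      proof -
        have "j ` {..<M} \<subseteq> {..<N}" using m N by fastforce
        moreover have "j ` {..<M} \<noteq> {}" using M by auto
        ultimately show ?thesis
          using mean_insert[OF J(1) _ _ _ \<gamma>, of "j ` {..<M}" N]
          by (simp add: card_image[OF inj] sum.reindex[OF inj])
      qed
      then show "\<forall>\<^sub>F N in U. norm ((1 / real M) *\<^sub>R (\<Sum>i<M. mean N \<gamma> (insert (j i) J)) - mean N \<gamma> J)
          \<le> C * sqrt (?K / real M)"
        by (intro ev) (auto simp: eventually_sequentially)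
    qed
    have "(\<lambda>M. C * sqrt (?K / real M)) \<longlonglongrightarrow> C * sqrt 0"
      by (intro tendsto_intros tendsto_real_sqrt lim_const_over_n)
    then have lim: "(\<lambda>M. C * sqrt (?K / real M)) \<longlonglongrightarrow> 0" by simp
    have "(\<lambda>M. (1 / real M) *\<^sub>R (\<Sum>i<M. s (insert (j i) J)) - s J) \<longlonglongrightarrow> 0"
      by (rule Lim_null_comparison[OF _ lim])
         (rule eventually_mono[OF eventually_gt_at_top[of 0]], rule bound)
    then show "(\<lambda>M. (1 / real M) *\<^sub>R (\<Sum>i<M. s (insert (j i) J))) \<longlonglongrightarrow> s J"
      by (rule LIM_zero_cancel)
  next
    fix A' B' :: "nat set" and a b :: nat assume AB: "finite A'" "finite B'"
    have "finite (A' \<union> B')" using AB by simp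
    \<comment> \<open>One element \<open>t\<close> realises the transposition on both sets and
      serves for all large \<open>N\<close>, so \<open>\<rho> t\<close> commutes with the limit over
      \<open>N\<close>.\<close>
    from transpositions[OF this, of a b]
    obtain \<pi> N0 t where *: "\<forall>j. \<pi> (\<pi> j) = j" "\<forall>j\<in>A' \<union> B'. \<pi> j = Transposition.transpose a b j"
      "\<forall>N\<ge>N0. (\<forall>j<N. \<pi> j < N) \<and> t \<in> A N \<and> (\<forall>x\<in>A N. t \<otimes> x \<in> A N)"
      "\<forall>z\<in>lamps G S. t \<otimes> lamp z = lamp (z \<circ> \<pi>) \<otimes> t"
      by (elim exE conjE)
    have \<pi>: "\<pi> (\<pi> j) = j" "j \<in> A' \<union> B' \<Longrightarrow> \<pi> j = Transposition.transpose a b j" for j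
      using *(1,2) by simp_all
    have N0: "N \<ge> N0 \<Longrightarrow> j < N \<Longrightarrow> \<pi> j < N" "N \<ge> N0 \<Longrightarrow> t \<in> A N"
        "N \<ge> N0 \<Longrightarrow> x \<in> A N \<Longrightarrow> t \<otimes> x \<in> A N" for N j x
      using *(3) by simp_all
    have t: "z \<in> lamps G S \<Longrightarrow> t \<otimes> lamp z = lamp (z \<circ> \<pi>) \<otimes> t" for z
      using *(4) by simp
    have tG: "t \<in> carrier G" using N0(2)[OF order.refl] A_closed by blast
    have move: "\<rho> t (s E) = s (\<pi> ` E)" if E: "finite E" for E
    proof -
      have "mean N \<gamma> (\<pi> ` E) = \<rho> t (mean N \<gamma> E)" if "N \<ge> N0" for N
        by (rule mean_action[symmetric]) (use that \<pi> N0 t E \<gamma> in auto)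
      then have "eventually (\<lambda>N. mean N \<gamma> (\<pi> ` E) = \<rho> t (mean N \<gamma> E)) U"
        by (intro ev) (auto simp: eventually_sequentially)
      then have "wlim U (\<lambda>N. \<rho> t (mean N \<gamma> E)) (s (\<pi> ` E))"
        using s[of "\<pi> ` E"] E by (simp add: wlim_cong)
      then show ?thesis using wlim_unique[OF Ubot wlim_action[OF tG s[OF E]]] by simp
    qed
    have im: "Transposition.transpose a b ` A' = \<pi> ` A'" "Transposition.transpose a b ` B' = \<pi> ` B'"
      using \<pi>(2) by (auto intro!: image_cong)
    show "norm (s (Transposition.transpose a b ` A') - s (Transposition.transpose a b ` B')) = norm (s A' - s B')"
      unfolding im move[OF AB(1), symmetric] move[OF AB(2), symmetric]
      by (simp add: linear_diff[OF banach_module_linear[OF module tG], symmetric]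
          banach_module_norm[OF module tG])
  qed
  have "s {0} = s {}" by (rule insertion_trivial[OF D])
  then show thesis using s[of "{0}"] s[of "{}"] that by simp
qed

text \<open>The averaged cocycle that \<open>averaging_homotopy\<close> produces for
  \<open>y = elt\<close> on \<open>states N\<close>.\<close>

definition shift_mean :: "nat \<Rightarrow> 'a list \<Rightarrow> 'e" where
  "shift_mean N xs = average (samples N) (\<lambda>ws. c (map2 (\<lambda>x w. x \<otimes> elt w) xs ws))"

lemma shift_mean_one:
  assumes "\<gamma> \<in> words letters (Suc (Suc k))"
  shows "shift_mean N (replicate (Suc (Suc k)) \<one>) = mean N \<gamma> {}"
  unfolding shift_mean_def mean_def
proof (rule average_cong)
  fix ws assume ws: "ws \<in> samples N"
  note len = length_sample[OF ws] words_length[OF assms]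
  have "map2 (\<lambda>x w. x \<otimes> elt w) (replicate (Suc (Suc k)) \<one>) ws = map elt ws"
  proof (rule nth_equalityI)
    fix i assume "i < length (map2 (\<lambda>x w. x \<otimes> elt w) (replicate (Suc (Suc k)) \<one>) ws)"
    then have i: "i < Suc (Suc k)" by (simp add: len)
    have "elt (ws ! i) \<in> carrier G"
      using nth_sample[OF ws i] elt_closed by (cases "ws ! i") simp
    then show "map2 (\<lambda>x w. x \<otimes> elt w) (replicate (Suc (Suc k)) \<one>) ws ! i = map elt ws ! i"
      using i len by (simp del: replicate_Suc)
  qed (simp add: len)
  then show "c (map2 (\<lambda>x w. x \<otimes> elt w) (replicate (Suc (Suc k)) \<one>) ws) = c (map elt (set_at {} \<gamma> ws))"
    by (simp only: set_at_empty len)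
qed

definition blank_words :: "('a \<times> nat) list set" where
  "blank_words = words ({\<one>} \<times> {..<L}) (Suc (Suc k))"

text \<open>By \<open>lamp_mult\<close>, left multiplication by an element of \<open>S\<close>
  writes it into an empty block \<open>0\<close>; the tag \<open>L\<close> makes it a letter and is
  ignored by \<open>elt\<close>.\<close>

lemma shift_mult_blank:
  assumes gs: "gs \<in> words S (Suc (Suc k))" and ws: "ws \<in> samples N" and blank: "ev 0 ws \<in> blank_words"
  shows "map2 (\<lambda>x w. x \<otimes> elt w) gs ws = map elt (set_at {0} (map (\<lambda>g. (g, L)) gs) ws)"
proof (rule nth_equalityI)
  note len = length_sample[OF ws] words_length[OF gs]
  fix i assume "i < length (map2 (\<lambda>x w. x \<otimes> elt w) gs ws)"
  then have i: "i < Suc (Suc k)" by (simp add: len)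
  obtain z a where za: "ws ! i = (z, a)" by (cases "ws ! i")
  have st: "(z, a) \<in> states N" using nth_sample[OF ws i] za by simp
  have "ev 0 ws ! i \<in> {\<one>} \<times> {..<L}" using words_nth[OF blank[unfolded blank_words_def] i] .
  then have z0: "(fst \<circ> z) 0 = \<one>" using i za len by (simp add: nth_ev) auto
  have z: "fst \<circ> z \<in> lamps G S" using lamp_state[OF finite.emptyI blank_letter st] by simp
  have g: "gs ! i \<in> S" by (rule words_nth[OF gs i])
  have "fst \<circ> (\<lambda>j. if j \<in> {0} then map (\<lambda>g. (g, L)) gs ! i else z j) = (fst \<circ> z)(0 := gs ! i)"
    using i len by (auto simp: fun_eq_iff)
  then have "elt (set_at {0} (map (\<lambda>g. (g, L)) gs) ws ! i) = lamp ((fst \<circ> z)(0 := gs ! i)) \<otimes> a"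
    using i len za by (simp add: nth_set_at_pair elt_def)
  also have "\<dots> = gs ! i \<otimes> elt (z, a)"
  proof -
    have "a \<in> carrier G" "gs ! i \<in> carrier G" using st A_closed S(2) g by (auto simp: states_def)
    then show ?thesis
      unfolding lamp_mult[OF z z0 g, symmetric]
      using lamp_closed[OF z] by (simp only: elt_def prod.case m_assoc)
  qed
  finally show "map2 (\<lambda>x w. x \<otimes> elt w) gs ws ! i = map elt (set_at {0} (map (\<lambda>g. (g, L)) gs) ws) ! i"
    using i len za by (simp add: length_set_at)
qed (use length_sample[OF ws] words_length[OF gs] in \<open>simp add: length_set_at\<close>)

text \<open>Outside the event of \<open>shift_mult_blank\<close> the two integrands differ by at
  most \<open>2 * C\<close>. Block \<open>0\<close> is one of the coordinates because
  \<open>N > 0\<close>, and it is blank in each of the \<open>k + 2\<close> samples independently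
  with probability \<open>real L / real (L + card S)\<close>.\<close>

lemma shift_mean_near:
  assumes gs: "gs \<in> words S (Suc (Suc k))" and N: "N > 0"
  shows "norm (shift_mean N gs - mean N (map (\<lambda>g. (g, L)) gs) {0})
    \<le> 2 * C * (1 - (real L / real (L + card S)) ^ Suc (Suc k))"
proof -
  let ?\<gamma> = "map (\<lambda>g. (g, L)) gs" and ?Z = "words letters (Suc (Suc k))"
  have \<gamma>: "?\<gamma> \<in> ?Z" using gs by (auto simp: words_def letters_def)
  interpret product_coordinates "samples N" ?Z "{..<N}" ev "\<lambda>j. set_at {j}"
    by (rule coordinates)
  have bound: "norm (c (map2 (\<lambda>x w. x \<otimes> elt w) gs ws) - c (map elt (set_at {0} ?\<gamma> ws)))
      \<le> 2 * C * of_bool (ev 0 ws \<notin> blank_words)" if ws: "ws \<in> samples N" for ws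
  proof (cases "ev 0 ws \<in> blank_words")
    case True
    then show ?thesis by (simp add: shift_mult_blank[OF gs ws])
  next
    case False
    have "x \<otimes> elt w \<in> carrier G" if "(x, w) \<in> set (zip gs ws)" for x w
    proof -
      have "x \<in> carrier G" using set_zip_leftD[OF that] gs S by (auto simp: words_def)
      moreover have "w \<in> states N"
        using set_zip_rightD[OF that] ws unfolding samples_def words_def by blast
      then have "elt w \<in> carrier G" using elt_closed by (cases w) blast
      ultimately show ?thesis by simp
    qed
    then have "map2 (\<lambda>x w. x \<otimes> elt w) gs ws \<in> tuples G (Suc k)"
      using length_sample[OF ws] words_length[OF gs] by (auto simp: tuples_def)
    from inv_cochain_norm[OF c this] inv_cochain_norm[OF c set_at_in_tuples[OF _ \<gamma> ws, of "{0}"]]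
    show ?thesis using False by (intro norm_triangle_le_diff) simp
  qed
  have "norm (shift_mean N gs - mean N ?\<gamma> {0})
      \<le> average (samples N) (\<lambda>ws. 2 * C * of_bool (ev 0 ws \<notin> blank_words))"
    unfolding shift_mean_def mean_def average_diff[symmetric]
    by (rule norm_average_le_average) (rule bound)
  also have "\<dots> = 2 * C * average (samples N) (\<lambda>ws. of_bool (ev 0 ws \<notin> blank_words))"
    by (simp add: average_def sum_distrib_left mult_ac)
  also have "average (samples N) (\<lambda>ws. of_bool (ev 0 ws \<notin> blank_words) :: real) =
      real (card {z \<in> ?Z. z \<notin> blank_words}) / real (card ?Z)"
    using average_ev[of 0 "\<lambda>z. z \<notin> blank_words"] N samples_nonempty by simp
  also have "{z \<in> ?Z. z \<notin> blank_words} = ?Z - blank_words" by auto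
  also have "real (card (?Z - blank_words)) = real (card ?Z) - real (card blank_words)"
  proof -
    have sub: "blank_words \<subseteq> ?Z" by (auto simp: blank_words_def words_def letters_def)
    then have "card blank_words \<le> card ?Z" by (rule card_mono[OF finite_Z])
    then show ?thesis
      using card_Diff_subset[OF finite_subset[OF sub finite_Z] sub] by simp
  qed
  also have "\<dots> / real (card ?Z) = 1 - (real L / real (L + card S)) ^ Suc (Suc k)"
    unfolding blank_words_def card_words[OF finite_letters] card_letters
    using L by (subst card_words) (simp_all add: card_cartesian_product diff_divide_distrib power_divide
       del: power_Suc)
  finally show ?thesis .
qed

text \<open>The limit of \<open>shift_mean\<close> at \<open>gs\<close> is close to the limit of the
  mean conditioned on block \<open>0\<close>. By \<open>mean_limit\<close> the latter is the limit
  of the unconditioned mean, which is \<open>shift_mean\<close> at the trivial tuple. The bound on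
  \<open>b\<close> involves neither \<open>S\<close> nor \<open>L\<close>.\<close>

lemma nearly_constant:
  assumes D: "countable D" "closure D = (UNIV :: 'e set)"
    and cocycle: "\<And>xs. xs \<in> tuples G (Suc (Suc k)) \<Longrightarrow> delta c xs = 0"
  obtains b where "inv_cochain G \<rho> k (real (Suc k) * C) b"
    "\<And>gs. gs \<in> words S (Suc (Suc k)) \<Longrightarrow>
      norm ((c gs + delta b gs) -
        (c (replicate (Suc (Suc k)) \<one>) + delta b (replicate (Suc (Suc k)) \<one>)))
      \<le> 2 * C * (1 - (real L / real (L + card S)) ^ Suc (Suc k))"
proof -
  obtain U :: "nat filter" where U: "ultra U" "U \<le> sequentially"
    using ultra_exists[OF sequentially_bot] .
  have Ubot: "U \<noteq> bot" using U by (simp add: ultra_def)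
  define b where "b N = smear (states N) (prism fst (\<lambda>(x, w). x \<otimes> elt w) c)" for N
  have elt: "elt w \<in> carrier G" if "w \<in> states N" for w N
    using elt_closed that by (cases w) simp
  have b: "inv_cochain G \<rho> k (real (Suc k) * C) (b N)" for N
    unfolding b_def
    by (rule averaging_homotopy(1)[OF module c])
       (use cocycle finite_states states_nonempty elt in auto)
  have hom: "c xs + delta (b N) xs = shift_mean N xs" if "xs \<in> tuples G (Suc k)" for N xs
    unfolding b_def shift_mean_def samples_def
    by (rule averaging_homotopy(2)[OF module c])
       (use cocycle finite_states states_nonempty elt that in auto)
  from cochain_limit[where b = b, OF U(1) b]
  obtain b' where b': "inv_cochain G \<rho> k (real (Suc k) * C) b'"
    "\<forall>xs\<in>tuples G k. wlim U (\<lambda>N. b N xs) (b' xs)" .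
  have lim: "wlim U (\<lambda>N. shift_mean N xs) (c xs + delta b' xs)" if xs: "xs \<in> tuples G (Suc k)" for xs
    using wlim_delta[where c = c, OF xs b'(2)] by (simp only: hom[OF xs])
  show thesis
  proof (rule that[OF b'(1)])
    fix gs assume gs: "gs \<in> words S (Suc (Suc k))"
    have "map (\<lambda>g. (g, L)) gs \<in> words letters (Suc (Suc k))" (is "?\<gamma> \<in> _")
      using gs by (auto simp: words_def letters_def)
    note \<gamma> = this
    obtain v where v0: "wlim U (\<lambda>N. mean N ?\<gamma> {0}) v" "wlim U (\<lambda>N. mean N ?\<gamma> {}) v"
      using mean_limit[OF D U \<gamma>] .
    then have v: "wlim U (\<lambda>N. mean N ?\<gamma> {0}) v"
        "wlim U (\<lambda>N. shift_mean N (replicate (Suc (Suc k)) \<one>)) v"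
      by (simp_all only: shift_mean_one[OF \<gamma>])
    have one: "c (replicate (Suc (Suc k)) \<one>) + delta b' (replicate (Suc (Suc k)) \<one>) = v"
      by (rule wlim_unique[OF Ubot lim[OF replicate_one_in_tuples] v(2)])
    have gsG: "gs \<in> tuples G (Suc k)" using gs S by (auto simp: words_def tuples_def)
    show "norm ((c gs + delta b' gs) -
        (c (replicate (Suc (Suc k)) \<one>) + delta b' (replicate (Suc (Suc k)) \<one>)))
      \<le> 2 * C * (1 - (real L / real (L + card S)) ^ Suc (Suc k))"
      unfolding one
    proof (rule wlim_norm_le[OF Ubot wlim_diff[OF lim[OF gsG] v(1)]])
      have "eventually (\<lambda>N. N > 0) U"
        using U(2) eventually_gt_at_top[of "0::nat"] by (simp add: le_filter_def)
      then show "\<forall>\<^sub>F N in U. norm (shift_mean N gs - mean N ?\<gamma> {0})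
          \<le> 2 * C * (1 - (real L / real (L + card S)) ^ Suc (Suc k))"
        by eventually_elim (rule shift_mean_near[OF gs])
    qed
  qed
qed

end

section \<open>From nearly constant cocycles to bounded primitives\<close>

lemma delta_delta: "delta (delta f) xs = 0"
proof (induction xs arbitrary: f)
  case (Cons x xs)
  then show ?case by (simp add: delta_diff)
qed simp

lemma delta_cong:
  assumes xs: "xs \<in> tuples G (Suc k)" and eq: "\<And>xs. xs \<in> tuples G k \<Longrightarrow> f xs = g xs"
  shows "delta f xs = delta g xs"
  unfolding delta_def
proof (rule sum.cong[OF refl])
  fix i assume "i \<in> {..<length xs}"
  then have "take i xs @ drop (Suc i) xs \<in> tuples G k"
    using xs by (auto simp: tuples_def dest!: in_set_takeD in_set_dropD)
  then show "(-1) ^ i *\<^sub>R f (take i xs @ drop (Suc i) xs) = (-1) ^ i *\<^sub>R g (take i xs @ drop (Suc i) xs)"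
    by (simp add: eq)
qed

lemma (in group) delta_action:
  assumes \<rho>: "banach_module G \<rho>" and b: "inv_cochain G \<rho> k C b" and xs: "xs \<in> tuples G (Suc k)"
    and g: "g \<in> carrier G"
  shows "delta b (map (\<lambda>x. g \<otimes> x) xs) = \<rho> g (delta b xs)"
proof -
  have "delta b (map (\<lambda>x. g \<otimes> x) xs) = delta (\<lambda>xs. \<rho> g (b xs)) xs"
    unfolding delta_map[symmetric] by (rule delta_cong[OF xs]) (rule inv_cochain_act[OF b _ g])
  then show ?thesis
    by (simp add: delta_def linear_sum[OF banach_module_linear[OF \<rho> g]]
        linear_scale[OF banach_module_linear[OF \<rho> g]])
qed

text \<open>A second ultralimit, over growing finite sets \<open>S\<close> and shrinking errors: the
  cochains \<open>b\<close> have a common bound, and every tuple eventually has all its entries in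
  \<open>S\<close>.\<close>

lemma (in dual_module) constant_cocycle:
  assumes D: "countable D" "closure D = (UNIV :: 'e set)"
    and lamplighter: "\<And>S. finite S \<Longrightarrow> S \<subseteq> carrier G \<Longrightarrow> \<exists>lamp A. lamplighter G S lamp A"
    and c: "inv_cochain G \<rho> (Suc k) C c"
    and cocycle: "\<And>xs. xs \<in> tuples G (Suc (Suc k)) \<Longrightarrow> delta c xs = 0"
  obtains b v where "inv_cochain G \<rho> k (real (Suc k) * C) b"
    "\<And>xs. xs \<in> tuples G (Suc k) \<Longrightarrow> c xs + delta b xs = v"
proof -
  let ?o = "replicate (Suc (Suc k)) \<one>"
  have "\<exists>b. inv_cochain G \<rho> k (real (Suc k) * C) b \<and> (finite S \<longrightarrow> S \<subseteq> carrier G \<longrightarrow>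
      (\<forall>gs\<in>words S (Suc (Suc k)). norm ((c gs + delta b gs) - (c ?o + delta b ?o)) \<le> 1 / real (Suc m)))"
    for S m
  proof -
    \<comment> \<open>An inadmissible \<open>S\<close> is replaced by \<open>{}\<close>, so that
      every index of the limit carries a cochain with the common bound.\<close>
    define S' where "S' = (if finite S \<and> S \<subseteq> carrier G then S else {})"
    have S': "finite S'" "S' \<subseteq> carrier G" by (auto simp: S'_def)
    obtain lamp A where "lamplighter G S' lamp A" using lamplighter[OF S'] by blast
    then interpret lamplighter G S' lamp A .
    \<comment> \<open>The probability of a blank letter tends to \<open>1\<close> as
      \<open>L\<close> grows, so the error of \<open>nearly_constant\<close> tends to
      \<open>0\<close>.\<close>
    have "(\<lambda>L. 2 * C * (1 - (real L / real (L + card S')) ^ Suc (Suc k)))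
        \<longlonglongrightarrow> 2 * C * (1 - 1 ^ Suc (Suc k))"
    proof (intro tendsto_intros)
      have "(\<lambda>L. 1 - real (card S') / real (L + card S')) \<longlonglongrightarrow> 1 - 0"
        by (intro tendsto_diff tendsto_const LIMSEQ_ignore_initial_segment[OF lim_const_over_n])
      moreover have "\<forall>\<^sub>F L in sequentially. 1 - real (card S') / real (L + card S') = real L / real (L + card S')"
        using eventually_gt_at_top[of 0] by eventually_elim (simp add: field_simps)
      ultimately show "(\<lambda>L. real L / real (L + card S')) \<longlonglongrightarrow> 1"
        by (simp add: tendsto_cong)
    qed
    then have "\<forall>\<^sub>F L in sequentially. 2 * C * (1 - (real L / real (L + card S')) ^ Suc (Suc k)) < 1 / real (Suc m)"
      by (rule order_tendstoD(2)) (simp del: of_nat_Suc)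
    then have "\<forall>\<^sub>F L in sequentially. L > 0 \<and>
        2 * C * (1 - (real L / real (L + card S')) ^ Suc (Suc k)) < 1 / real (Suc m)"
      using eventually_gt_at_top[of "0 :: nat"] by eventually_elim simp
    from eventually_happens'[OF sequentially_bot this] obtain L where
      Lok: "L > 0" "2 * C * (1 - (real L / real (L + card S')) ^ Suc (Suc k)) < 1 / real (Suc m)" by blast
    interpret lamplighter_cocycle G T \<rho> \<sigma> S' lamp A c k C L
      by unfold_locales (use c Lok in auto)
    obtain b where b: "inv_cochain G \<rho> k (real (Suc k) * C) b"
      "\<And>gs. gs \<in> words S' (Suc (Suc k)) \<Longrightarrow> norm ((c gs + delta b gs) - (c ?o + delta b ?o))
        \<le> 2 * C * (1 - (real L / real (L + card S')) ^ Suc (Suc k))"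
      using nearly_constant[OF D cocycle] by blast
    have "norm ((c gs + delta b gs) - (c ?o + delta b ?o)) \<le> 1 / real (Suc m)"
      if "finite S" "S \<subseteq> carrier G" "gs \<in> words S (Suc (Suc k))" for gs
    proof -
      have "S' = S" using that by (simp add: S'_def)
      then have "gs \<in> words S' (Suc (Suc k))" using that by simp
      from order.trans[OF b(2)[OF this] less_imp_le[OF Lok(2)]] show ?thesis .
    qed
    then show ?thesis using b(1) by blast
  qed
  then obtain b where b: "\<And>S m. inv_cochain G \<rho> k (real (Suc k) * C) (b S m)"
    and small: "\<And>S m gs. finite S \<Longrightarrow> S \<subseteq> carrier G \<Longrightarrow> gs \<in> words S (Suc (Suc k)) \<Longrightarrow>
      norm ((c gs + delta (b S m) gs) - (c ?o + delta (b S m) ?o)) \<le> 1 / real (Suc m)"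
    by metis
  let ?F = "finite_subsets_at_top (carrier G) \<times>\<^sub>F (sequentially :: nat filter)"
  have "?F \<noteq> bot" by (simp add: prod_filter_eq_bot)
  from ultra_exists[OF this] obtain U where U: "ultra U" "U \<le> ?F" .
  have Ubot: "U \<noteq> bot" using U(1) by (simp add: ultra_def)
  have "inv_cochain G \<rho> k (real (Suc k) * C) (case i of (S, m) \<Rightarrow> b S m)" for i
    by (cases i) (simp only: b prod.case)
  from cochain_limit[where b = "\<lambda>i. case i of (S, m) \<Rightarrow> b S m", OF U(1) this]
  obtain b' where b': "inv_cochain G \<rho> k (real (Suc k) * C) b'"
    "\<forall>xs\<in>tuples G k. wlim U (\<lambda>i. (case i of (S, m) \<Rightarrow> b S m) xs) (b' xs)" .
  have lim: "wlim U (\<lambda>i. c xs + delta (case i of (S, m) \<Rightarrow> b S m) xs) (c xs + delta b' xs)"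
    if "xs \<in> tuples G (Suc k)" for xs
    by (rule wlim_delta[OF that b'(2)])
  have "c gs + delta b' gs = c ?o + delta b' ?o" if gs: "gs \<in> tuples G (Suc k)" for gs
  proof -
    have "norm ((c gs + delta b' gs) - (c ?o + delta b' ?o)) \<le> 1 / real (Suc m)" for m
    proof (rule wlim_norm_le[OF Ubot wlim_diff[OF lim[OF gs] lim[OF replicate_one_in_tuples]]])
      have "\<forall>\<^sub>F S in finite_subsets_at_top (carrier G). finite S \<and> S \<subseteq> carrier G \<and> set gs \<subseteq> S"
        unfolding eventually_finite_subsets_at_top
        using gs by (intro exI[of _ "set gs"]) (auto simp: tuples_def)
      from eventually_prodI[OF this eventually_ge_at_top[of m]]
      have "\<forall>\<^sub>F i in U. (finite (fst i) \<and> fst i \<subseteq> carrier G \<and> set gs \<subseteq> fst i) \<and> m \<le> snd i"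
        using U(2) by (simp add: le_filter_def)
      then show "\<forall>\<^sub>F i in U. norm ((c gs + delta (case i of (S, m) \<Rightarrow> b S m) gs) -
          (c ?o + delta (case i of (S, m) \<Rightarrow> b S m) ?o)) \<le> 1 / real (Suc m)"
      proof eventually_elim
        case (elim i)
        obtain S n where i: "i = (S, n)" by (cases i)
        have "gs \<in> words S (Suc (Suc k))" using gs elim i by (simp add: words_def tuples_def)
        then have "norm ((c gs + delta (b S n) gs) - (c ?o + delta (b S n) ?o)) \<le> 1 / real (Suc n)"
          using elim i by (intro small) auto
        also have "\<dots> \<le> 1 / real (Suc m)" using elim i by (simp add: frac_le)
        finally show ?case using i by (simp del: replicate_Suc)
      qed
    qed
    then have "norm ((c gs + delta b' gs) - (c ?o + delta b' ?o)) \<le> 0"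
      using LIMSEQ_le_const[OF lim_inverse_n'[THEN LIMSEQ_Suc]] by blast
    then show ?thesis by simp
  qed
  with b'(1) show thesis by (rule that)
qed

text \<open>The constant \<open>v\<close> is invariant, so \<open>v - b\<close> is an invariant
  cochain, and parity makes it a primitive. For odd \<open>k\<close>, the coboundary of the constant
  \<open>v\<close> on words of length \<open>k + 2\<close> is \<open>v\<close>; for even
  \<open>k\<close> it is \<open>0\<close>, but the cocycle condition on words of length
  \<open>k + 3\<close> forces \<open>v = 0\<close>.\<close>

theorem (in dual_module) bounded_primitive:
  assumes D: "countable D" "closure D = (UNIV :: 'e set)"
    and lamplighter: "\<And>S. finite S \<Longrightarrow> S \<subseteq> carrier G \<Longrightarrow> \<exists>lamp A. lamplighter G S lamp A"
    and c: "inv_cochain G \<rho> (Suc k) C c"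
    and cocycle: "\<And>xs. xs \<in> tuples G (Suc (Suc k)) \<Longrightarrow> delta c xs = 0"
  obtains b K where "inv_cochain G \<rho> k K b" "\<And>xs. xs \<in> tuples G (Suc k) \<Longrightarrow> c xs = delta b xs"
proof -
  let ?o = "replicate (Suc (Suc k)) \<one>"
  obtain b v where b: "inv_cochain G \<rho> k (real (Suc k) * C) b"
    and v: "\<And>xs. xs \<in> tuples G (Suc k) \<Longrightarrow> c xs + delta b xs = v"
    using constant_cocycle[OF D lamplighter c cocycle] by metis
  have fixed: "\<rho> g v = v" if g: "g \<in> carrier G" for g
  proof -
    have "map (\<lambda>x. g \<otimes> x) ?o \<in> tuples G (Suc k)" using g by (auto simp: tuples_def)
    from v[OF this] show ?thesis
      unfolding inv_cochain_act[OF c replicate_one_in_tuples g]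
        delta_action[OF module b replicate_one_in_tuples g]
        linear_add[OF banach_module_linear[OF module g], symmetric] v[OF replicate_one_in_tuples] .
  qed
  have v0: "v = 0" if "even k"
  proof -
    have o: "replicate (Suc (Suc (Suc k))) \<one> \<in> tuples G (Suc (Suc k))" by (rule replicate_one_in_tuples)
    have "delta (\<lambda>xs. c xs + delta b xs) (replicate (Suc (Suc (Suc k))) \<one>) = delta (\<lambda>_. v) (replicate (Suc (Suc (Suc k))) \<one>)"
      by (rule delta_cong[OF o v])
    then show ?thesis
      using cocycle[OF o] that by (simp only: delta_add delta_delta delta_const length_replicate) simp
  qed
  show thesis
  proof (rule that[of "norm v + real (Suc k) * C" "\<lambda>xs. v - b xs"])
    show "inv_cochain G \<rho> k (norm v + real (Suc k) * C) (\<lambda>xs. v - b xs)"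
      unfolding inv_cochain_def
    proof (intro ballI conjI)
      fix xs assume xs: "xs \<in> tuples G k"
      show "norm (v - b xs) \<le> norm v + real (Suc k) * C"
        using norm_triangle_ineq4[of v "b xs"] inv_cochain_norm[OF b xs] by linarith
      show "v - b (map (\<lambda>x. g \<otimes> x) xs) = \<rho> g (v - b xs)" if g: "g \<in> carrier G" for g
        by (simp add: linear_diff[OF banach_module_linear[OF module g]] fixed[OF g] inv_cochain_act[OF b xs g])
    qed
    show "c xs = delta (\<lambda>xs. v - b xs) xs" if xs: "xs \<in> tuples G (Suc k)" for xs
    proof -
      have "length xs = Suc (Suc k)" using xs by (simp add: tuples_def)
      then show ?thesis using v[OF xs] v0 by (auto simp: delta_diff delta_const algebra_simps)
    qed
  qed
qed

section \<open>Bounded cohomology groups\<close>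

lemma coboundary_apply:
  "xs \<in> tuples G (Suc k) \<Longrightarrow> coboundary G k f xs = delta f xs"
  by (simp add: coboundary_def delta_def tuples_def lessThan_Suc_atMost del: sum.atMost_Suc)

lemma coboundary_extensional: "coboundary G k f \<in> extensional (tuples G (Suc k))"
  by (simp add: coboundary_def)

context group
begin

lemma trivial_self_quotient: "trivial_group (G Mod carrier G)"
proof -
  have normal: "carrier G \<lhd> G"
    by (rule normal_invI[OF subgroup_self]) simp
  have "carrier (G Mod carrier G) = {\<one>\<^bsub>G Mod carrier G\<^esub>}"
    using coset_join2[OF _ subgroup_self] one_closed by (auto simp: FactGroup_def RCOSETS_def)
  then show ?thesis
    using normal.factorgroup_is_group[OF normal] by (simp add: trivial_group_def)
qed

lemma map_mult_in_tuples: "g \<in> carrier G \<Longrightarrow> xs \<in> tuples G k \<Longrightarrow> map (\<lambda>x. g \<otimes> x) xs \<in> tuples G k"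
  by (auto simp: tuples_def)

lemma map_inv_mult:
  "g \<in> carrier G \<Longrightarrow> xs \<in> tuples G k \<Longrightarrow> map (\<lambda>x. inv g \<otimes> x) (map (\<lambda>x. g \<otimes> x) xs) = xs"
  by (auto simp: tuples_def m_assoc[symmetric] intro!: map_idI)

lemma map_mult_inv:
  "g \<in> carrier G \<Longrightarrow> xs \<in> tuples G k \<Longrightarrow> map (\<lambda>x. g \<otimes> x) (map (\<lambda>x. inv g \<otimes> x) xs) = xs"
  by (auto simp: tuples_def m_assoc[symmetric] intro!: map_idI)

text \<open>The dictionary to \<open>inv_cochain\<close>: evaluating the invariance condition at a
  translated tuple turns it into equivariance, and conversely.\<close>

lemma invariant_carrier_iff:
  "f \<in> carrier (invariant_cochain_group G \<rho> k) \<longleftrightarrow>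
    f \<in> extensional (tuples G k) \<and> (\<exists>C. inv_cochain G \<rho> k C f)"
proof
  assume f: "f \<in> carrier (invariant_cochain_group G \<rho> k)"
  then have ext: "f \<in> extensional (tuples G k)" and "bounded (f ` tuples G k)"
    and act: "\<And>g. g \<in> carrier G \<Longrightarrow> cochain_action G \<rho> k g f = f"
    by (auto simp: invariant_cochain_group_def bounded_cochains_def)
  then obtain C where C: "\<And>xs. xs \<in> tuples G k \<Longrightarrow> norm (f xs) \<le> C" by (auto simp: bounded_iff)
  have "f (map (\<lambda>x. g \<otimes> x) xs) = \<rho> g (f xs)" if g: "g \<in> carrier G" and xs: "xs \<in> tuples G k" for g xs
  proof -
    have "f (map (\<lambda>x. g \<otimes> x) xs) = cochain_action G \<rho> k g f (map (\<lambda>x. g \<otimes> x) xs)" by (simp only: act[OF g])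
    then show ?thesis
      by (simp only: cochain_action_def restrict_apply' map_mult_in_tuples[OF g xs] map_inv_mult[OF g xs])
  qed
  with C ext show "f \<in> extensional (tuples G k) \<and> (\<exists>C. inv_cochain G \<rho> k C f)"
    by (auto simp: inv_cochain_def)
next
  assume f: "f \<in> extensional (tuples G k) \<and> (\<exists>C. inv_cochain G \<rho> k C f)"
  then obtain C where C: "inv_cochain G \<rho> k C f" by blast
  have "bounded (f ` tuples G k)" using inv_cochain_norm[OF C] by (auto simp: bounded_iff)
  moreover have "cochain_action G \<rho> k g f = f" if g: "g \<in> carrier G" for g
  proof (rule extensionalityI[of _ "tuples G k"])
    fix xs assume xs: "xs \<in> tuples G k"
    have "map (\<lambda>x. inv g \<otimes> x) xs \<in> tuples G k" using g xs by (intro map_mult_in_tuples) auto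
    from inv_cochain_act[OF C this g] show "cochain_action G \<rho> k g f xs = f xs"
      by (simp only: map_mult_inv[OF g xs] cochain_action_def restrict_apply' xs)
  qed (use f in \<open>auto simp: cochain_action_def\<close>)
  ultimately show "f \<in> carrier (invariant_cochain_group G \<rho> k)"
    using f by (simp add: invariant_cochain_group_def bounded_cochains_def)
qed

lemma inv_cochain_cong:
  assumes "\<And>xs. xs \<in> tuples G k \<Longrightarrow> f xs = f' xs" "inv_cochain G \<rho> k C f"
  shows "inv_cochain G \<rho> k C f'"
  using assms map_mult_in_tuples by (simp add: inv_cochain_def)

lemma restrict_invariant:
  "inv_cochain G \<rho> k C f \<Longrightarrow> restrict f (tuples G k) \<in> carrier (invariant_cochain_group G \<rho> k)"
  unfolding invariant_carrier_iff using inv_cochain_cong[of k f "restrict f (tuples G k)" \<rho> C] by auto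

lemma inv_cochain_add:
  assumes \<rho>: "banach_module G \<rho>" and f: "inv_cochain G \<rho> k C f" and h: "inv_cochain G \<rho> k C' h"
  shows "inv_cochain G \<rho> k (C + C') (\<lambda>xs. f xs + h xs)"
  unfolding inv_cochain_def
  using inv_cochain_norm[OF f] inv_cochain_norm[OF h] inv_cochain_act[OF f] inv_cochain_act[OF h]
  by (auto simp: linear_add[OF banach_module_linear[OF \<rho>]] intro!: norm_triangle_le add_mono)

lemma inv_cochain_minus:
  assumes \<rho>: "banach_module G \<rho>" and f: "inv_cochain G \<rho> k C f"
  shows "inv_cochain G \<rho> k C (\<lambda>xs. - f xs)"
  unfolding inv_cochain_def
  using inv_cochain_norm[OF f] inv_cochain_act[OF f]
  by (auto simp: linear_neg[OF banach_module_linear[OF \<rho>]])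

lemma inv_cochain_zero: "banach_module G \<rho> \<Longrightarrow> inv_cochain G \<rho> k 0 (\<lambda>_. 0)"
  by (auto simp: inv_cochain_def linear_0[OF banach_module_linear])

lemma inv_cochain_delta:
  assumes \<rho>: "banach_module G \<rho>" and f: "inv_cochain G \<rho> k C f"
  shows "inv_cochain G \<rho> (Suc k) (real (Suc (Suc k)) * C) (delta f)"
  unfolding inv_cochain_def
proof (intro ballI conjI)
  fix xs assume xs: "xs \<in> tuples G (Suc k)"
  have "norm (delta f xs) \<le> (\<Sum>i<length xs. C)"
    unfolding delta_def
  proof (rule sum_norm_le)
    fix i assume "i \<in> {..<length xs}"
    then have "take i xs @ drop (Suc i) xs \<in> tuples G k"
      using xs by (auto simp: tuples_def dest!: in_set_takeD in_set_dropD)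
    then show "norm ((- 1) ^ i *\<^sub>R f (take i xs @ drop (Suc i) xs)) \<le> C"
      using inv_cochain_norm[OF f] by simp
  qed
  then show "norm (delta f xs) \<le> real (Suc (Suc k)) * C" using xs by (simp add: tuples_def)
  show "delta f (map (\<lambda>x. g \<otimes> x) xs) = \<rho> g (delta f xs)" if "g \<in> carrier G" for g
    by (rule delta_action[OF \<rho> f xs that])
qed

lemma group_invariant_cochains:
  assumes \<rho>: "banach_module G \<rho>"
  shows "group (invariant_cochain_group G \<rho> k)" (is "group ?K")
proof (rule groupI)
  have mult: "f \<otimes>\<^bsub>?K\<^esub> h = restrict (\<lambda>xs. f xs + h xs) (tuples G k)" for f h
    by (simp add: invariant_cochain_group_def)
  have one: "\<one>\<^bsub>?K\<^esub> = restrict (\<lambda>_. 0) (tuples G k)"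
    by (simp add: invariant_cochain_group_def)
  show "f \<otimes>\<^bsub>?K\<^esub> h \<in> carrier ?K" if fh: "f \<in> carrier ?K" "h \<in> carrier ?K" for f h
  proof -
    obtain C C' where "inv_cochain G \<rho> k C f" "inv_cochain G \<rho> k C' h"
      using fh unfolding invariant_carrier_iff by blast
    then show ?thesis unfolding mult by (rule restrict_invariant[OF inv_cochain_add[OF \<rho>]])
  qed
  show "\<one>\<^bsub>?K\<^esub> \<in> carrier ?K"
    unfolding one by (rule restrict_invariant[OF inv_cochain_zero[OF \<rho>]])
  show "f \<otimes>\<^bsub>?K\<^esub> g \<otimes>\<^bsub>?K\<^esub> h = f \<otimes>\<^bsub>?K\<^esub> (g \<otimes>\<^bsub>?K\<^esub> h)" for f g h
    unfolding mult by (rule restrict_ext) (simp add: add.assoc)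
  show "\<one>\<^bsub>?K\<^esub> \<otimes>\<^bsub>?K\<^esub> f = f" if "f \<in> carrier ?K" for f
    using that unfolding mult one invariant_carrier_iff
    by (intro extensionalityI[of _ "tuples G k"]) auto
  show "\<exists>h\<in>carrier ?K. h \<otimes>\<^bsub>?K\<^esub> f = \<one>\<^bsub>?K\<^esub>" if f: "f \<in> carrier ?K" for f
  proof
    obtain C where "inv_cochain G \<rho> k C f" using f unfolding invariant_carrier_iff by blast
    then show "restrict (\<lambda>xs. - f xs) (tuples G k) \<in> carrier ?K"
      by (rule restrict_invariant[OF inv_cochain_minus[OF \<rho>]])
    show "restrict (\<lambda>xs. - f xs) (tuples G k) \<otimes>\<^bsub>?K\<^esub> f = \<one>\<^bsub>?K\<^esub>"
      unfolding mult one by (rule restrict_ext) simp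
  qed
qed

lemma coboundary_in_carrier:
  assumes \<rho>: "banach_module G \<rho>" and f: "f \<in> carrier (invariant_cochain_group G \<rho> k)"
  shows "coboundary G k f \<in> carrier (invariant_cochain_group G \<rho> (Suc k))"
proof -
  obtain C where "inv_cochain G \<rho> k C f" using f by (auto simp: invariant_carrier_iff)
  from inv_cochain_delta[OF \<rho> this]
  have "inv_cochain G \<rho> (Suc k) (real (Suc (Suc k)) * C) (coboundary G k f)"
    by (rule inv_cochain_cong[rotated]) (simp add: coboundary_apply)
  then show ?thesis using coboundary_extensional invariant_carrier_iff by blast
qed

lemma coboundary_hom:
  assumes \<rho>: "banach_module G \<rho>"
  shows "group_hom (invariant_cochain_group G \<rho> k) (invariant_cochain_group G \<rho> (Suc k)) (coboundary G k)"
    (is "group_hom ?K ?K' _")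
proof (intro group_hom.intro group_hom_axioms.intro group_invariant_cochains[OF \<rho>] homI
    coboundary_in_carrier[OF \<rho>])
  fix f h assume "f \<in> carrier ?K" "h \<in> carrier ?K"
  show "coboundary G k (f \<otimes>\<^bsub>?K\<^esub> h) = coboundary G k f \<otimes>\<^bsub>?K'\<^esub> coboundary G k h"
  proof (rule extensionalityI[OF coboundary_extensional])
    fix xs assume xs: "xs \<in> tuples G (Suc k)"
    have "delta (f \<otimes>\<^bsub>?K\<^esub> h) xs = delta (\<lambda>xs. f xs + h xs) xs"
      by (rule delta_cong[OF xs]) (simp add: invariant_cochain_group_def)
    then show "coboundary G k (f \<otimes>\<^bsub>?K\<^esub> h) xs = (coboundary G k f \<otimes>\<^bsub>?K'\<^esub> coboundary G k h) xs"
      using xs by (simp add: coboundary_apply delta_add invariant_cochain_group_def)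
  qed (simp add: invariant_cochain_group_def)
qed

lemma bounded_cocycles_iff:
  "f \<in> bounded_cocycles G \<rho> k \<longleftrightarrow> f \<in> carrier (invariant_cochain_group G \<rho> k) \<and>
    (\<forall>xs\<in>tuples G (Suc k). delta f xs = 0)"
proof -
  have "coboundary G k f = \<one>\<^bsub>invariant_cochain_group G \<rho> (Suc k)\<^esub> \<longleftrightarrow> (\<forall>xs\<in>tuples G (Suc k). delta f xs = 0)"
    by (auto simp: invariant_cochain_group_def fun_eq_iff coboundary_def delta_def tuples_def
        lessThan_Suc_atMost simp del: sum.atMost_Suc)
  then show ?thesis by (simp add: bounded_cocycles_def kernel_def)
qed

text \<open>If all cocycles have bounded primitives, the coboundaries fill the group of cocycles,
  and a group modulo itself is trivial.\<close>

lemma trivial_bounded_cohomology: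
  assumes \<rho>: "banach_module G \<rho>"
    and primitive: "\<And>c C. inv_cochain G \<rho> (Suc k) C c \<Longrightarrow>
      (\<And>xs. xs \<in> tuples G (Suc (Suc k)) \<Longrightarrow> delta c xs = 0) \<Longrightarrow>
      \<exists>b K. inv_cochain G \<rho> k K b \<and> (\<forall>xs\<in>tuples G (Suc k). c xs = delta b xs)"
  shows "trivial_group (bounded_cohomology_group G \<rho> (Suc k))"
proof -
  let ?K = "(invariant_cochain_group G \<rho> (Suc k))\<lparr>carrier := bounded_cocycles G \<rho> (Suc k)\<rparr>"
  interpret hom: group_hom "invariant_cochain_group G \<rho> (Suc k)"
    "invariant_cochain_group G \<rho> (Suc (Suc k))" "coboundary G (Suc k)"
    by (rule coboundary_hom[OF \<rho>])
  have "group ?K"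
    unfolding bounded_cocycles_def
    by (rule subgroup.subgroup_is_group[OF hom.subgroup_kernel hom.G.is_group])
  then interpret K: group ?K .
  have "bounded_coboundaries G \<rho> (Suc k) = carrier ?K"
  proof (intro equalityI subsetI)
    fix f assume "f \<in> bounded_coboundaries G \<rho> (Suc k)"
    then obtain b where b: "b \<in> carrier (invariant_cochain_group G \<rho> k)" "f = coboundary G k b"
      by (auto simp: bounded_coboundaries_def)
    have "delta f xs = 0" if xs: "xs \<in> tuples G (Suc (Suc k))" for xs
      unfolding b(2) using delta_cong[OF xs, of "coboundary G k b" "delta b"]
      by (simp add: coboundary_apply delta_delta)
    then show "f \<in> carrier ?K"
      using coboundary_in_carrier[OF \<rho> b(1)] b(2) by (simp add: bounded_cocycles_iff)
  next
    fix f assume "f \<in> carrier ?K"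
    then have f: "f \<in> carrier (invariant_cochain_group G \<rho> (Suc k))"
      and zero: "\<And>xs. xs \<in> tuples G (Suc (Suc k)) \<Longrightarrow> delta f xs = 0"
      by (auto simp: bounded_cocycles_iff)
    obtain C where "inv_cochain G \<rho> (Suc k) C f" and ext: "f \<in> extensional (tuples G (Suc k))"
      using f by (auto simp: invariant_carrier_iff)
    from primitive[OF this(1) zero] obtain b B where b: "inv_cochain G \<rho> k B b"
      "\<And>xs. xs \<in> tuples G (Suc k) \<Longrightarrow> f xs = delta b xs" by blast
    have "f = coboundary G k (restrict b (tuples G k))"
    proof (rule extensionalityI[OF ext coboundary_extensional])
      fix xs assume xs: "xs \<in> tuples G (Suc k)"
      have "delta (restrict b (tuples G k)) xs = delta b xs" by (rule delta_cong[OF xs]) simp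
      then show "f xs = coboundary G k (restrict b (tuples G k)) xs"
        using xs b(2) by (simp add: coboundary_apply)
    qed
    then show "f \<in> bounded_coboundaries G \<rho> (Suc k)"
      using restrict_invariant[OF b(1)] by (auto simp: bounded_coboundaries_def)
  qed
  then show ?thesis
    unfolding bounded_cohomology_group_def using K.trivial_self_quotient by (simp only:)
qed

lemma Xsep_boundedly_acyclicI:
  assumes "\<And>S. finite S \<Longrightarrow> S \<subseteq> carrier G \<Longrightarrow> \<exists>lamp A. lamplighter G S lamp A"
  shows "Xsep_boundedly_acyclic TYPE('e::banach) TYPE('f::banach) G"
  unfolding Xsep_boundedly_acyclic_def
proof (intro allI impI, elim conjE)
  fix \<rho> :: "'a \<Rightarrow> 'e \<Rightarrow> 'e" and n :: nat
  assume sep: "separable_space (euclidean :: 'e topology)" and dual: "dual_banach_module TYPE('f) G \<rho>"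
    and "1 \<le> n"
  then obtain k where n: "n = Suc k" by (cases n) auto
  have \<rho>: "banach_module G \<rho>" using dual by (simp add: dual_banach_module_def)
  obtain \<sigma> :: "'a \<Rightarrow> 'f \<Rightarrow> 'f" and T :: "'e \<Rightarrow> ('f \<Rightarrow>\<^sub>L real)" where
    \<sigma>: "banach_module G \<sigma>" and T: "linear T" "surj T" "\<And>v. norm (T v) = norm v"
    and act: "\<And>g v. g \<in> carrier G \<Longrightarrow> T (\<rho> g v) = contragredient G \<sigma> g (T v)"
    using dual by (auto simp: dual_banach_module_def)
  interpret dual_pairing T by (rule dual_pairing.intro[OF T])
  interpret dual_module G T \<rho> \<sigma>
  proof unfold_locales
    fix g v \<phi> assume g: "g \<in> carrier G"
    \<comment> \<open>\<open>Blinfun\<close> represents the given function only if that is bounded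
      linear, so this is checked before the contragredient action is evaluated.\<close>
    have "bounded_linear (\<sigma> (inv g))"
      by (rule bounded_linear_intro[of _ 1])
         (use banach_module_linear[OF \<sigma>, of "inv g"] banach_module_norm[OF \<sigma>, of "inv g"] g
          in \<open>auto simp: linear_add linear_scale\<close>)
    then have "bounded_linear (\<lambda>w. T v (\<sigma> (inv g) w))"
      by (rule bounded_linear_compose[OF blinfun.bounded_linear_right])
    then show "T (\<rho> g v) \<phi> = T v (\<sigma> (inv g) \<phi>)"
      by (simp add: act[OF g] contragredient_def bounded_linear_Blinfun_apply)
  qed (rule \<rho>)
  obtain D :: "'e set" where D: "countable D" "closure D = UNIV"
    using sep by (auto simp: separable_space_def)
  show "trivial_group (bounded_cohomology_group G \<rho> n)"
    unfolding n
  proof (rule trivial_bounded_cohomology[OF \<rho>])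
    fix c C assume "inv_cochain G \<rho> (Suc k) C c" "\<And>xs. xs \<in> tuples G (Suc (Suc k)) \<Longrightarrow> delta c xs = 0"
    from bounded_primitive[OF D assms this]
    show "\<exists>b K. inv_cochain G \<rho> k K b \<and> (\<forall>xs\<in>tuples G (Suc k). c xs = delta b xs)" by metis
  qed
qed

end

section \<open>Interval exchanges\<close>

text \<open>The infinite piece \<open>{a..}\<close> is translated by some \<open>c\<close>. The
  other pieces are bounded and translated too, so \<open>f\<close> preserves the length of
  \<open>{0..<a}\<close>; its image is \<open>{0..<a + c}\<close>, hence
  \<open>c = 0\<close>.\<close>

lemma interval_exchange_bounded_support:
  assumes "f \<in> interval_exchanges"
  obtains m where "\<forall>x\<ge>m. f x = x"
proof -
  obtain P where P: "finite P" "partition_on {0..} P"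
    and shape: "\<forall>J\<in>P. (\<exists>a b. J = {a..<b}) \<or> (\<exists>a. J = {a..})"
    and trans: "\<forall>J\<in>P. \<exists>c. \<forall>x\<in>J. f x = x + c" and f: "f \<in> Bij {0..}"
    using assms by (rule interval_exchangesE)
  have inj: "inj_on f {0..}" and im: "f ` {0..} = {0..}" using f by (auto simp: Bij_def bij_betw_def)
  have U: "\<Union>P = {0..}" using P(2) by (auto simp: partition_on_def)
  have disj: "J \<inter> K = {}" if "J \<in> P" "K \<in> P" "J \<noteq> K" for J K
    using P(2) that by (auto simp: partition_on_def disjoint_def)
  \<comment> \<open>Otherwise \<open>{0..}\<close> would be a finite union of bounded
    pieces.\<close>
  have "\<exists>J\<in>P. \<exists>a. J = {a..}"
  proof (rule ccontr)
    assume "\<not> (\<exists>J\<in>P. \<exists>a. J = {a..})"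
    then have "bounded J" if "J \<in> P" for J
    proof -
      from that shape \<open>\<not> _\<close> obtain a b where "J = {a..<b}" by blast
      then show ?thesis using bounded_subset[OF bounded_cbox[of a b], of J] by (auto simp: cbox_interval)
    qed
    then have "bounded (\<Union>P)" using P(1) by (intro bounded_Union) auto
    then show False unfolding U bounded_real by (metis abs_ge_self atLeast_iff dual_order.trans
       gt_ex linorder_not_less max.cobounded1 max.cobounded2)
  qed
  then obtain J a where J: "J \<in> P" "J = {a..}" by blast
  have a: "a \<ge> 0" using U J by auto
  obtain c where c: "\<And>x. x \<ge> a \<Longrightarrow> f x = x + c" using trans J by auto
  have ac: "a + c \<ge> 0"
  proof -
    have "f a \<in> {0..}" using a im by blast
    then show ?thesis using c[of a] by simp
  qed
  define Q where "Q = P - {J}"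
  have Q: "finite Q" using P by (simp add: Q_def)
  have KQ: "K \<subseteq> {0..<a}" if "K \<in> Q" for K
  proof
    fix x assume x: "x \<in> K"
    have "K \<in> P" "K \<noteq> J" using that by (simp_all add: Q_def)
    then have "x \<notin> J" using disj[OF _ J(1)] x by blast
    moreover have "x \<in> {0..}" using U x \<open>K \<in> P\<close> by blast
    ultimately show "x \<in> {0..<a}" unfolding J(2) by simp
  qed
  have UQ: "\<Union>Q = {0..<a}"
  proof
    show "\<Union>Q \<subseteq> {0..<a}" using KQ by blast
    show "{0..<a} \<subseteq> \<Union>Q"
    proof
      fix x assume x: "x \<in> {0..<a}"
      then have "x \<in> \<Union>P" unfolding U by simp
      then obtain K where K: "K \<in> P" "x \<in> K" by blast
      have "x \<notin> J" using x J(2) by simp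
      then have "K \<in> Q" using K by (auto simp: Q_def)
      then show "x \<in> \<Union>Q" using K(2) by blast
    qed
  qed
  have KK: "\<exists>p q e. p \<le> q \<and> K = {p..<q} \<and> f ` K = {p + e..<q + e}" if K: "K \<in> Q" for K
  proof -
    have KP: "K \<in> P" "K \<noteq> {}" using K P(2) by (auto simp: Q_def partition_on_def)
    have "\<nexists>p. K = {p..}"
    proof
      assume "\<exists>p. K = {p..}"
      then obtain p where "K = {p..}" ..
      then have "max p a \<in> K" by simp
      then show False using KQ[OF K] by auto
    qed
    then obtain p q where pq: "K = {p..<q}" using shape KP by blast
    obtain e where e: "\<And>x. x \<in> K \<Longrightarrow> f x = x + e" using trans KP by blast
    have "f ` K = (\<lambda>x. x + e) ` K" using e by (rule image_cong[OF refl])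
    then have "f ` K = {p + e..<q + e}" unfolding pq by simp
    moreover have "p \<le> q" using KP pq by auto
    ultimately show ?thesis using pq by blast
  qed
  \<comment> \<open>By bijectivity, the image of \<open>{0..<a}\<close> is the complement of the
    image of the infinite piece.\<close>
  have "f ` {0..<a} = f ` ({0..} - {a..})" using a by (intro arg_cong[of _ _ "image f"]) auto
  also have "\<dots> = f ` {0..} - f ` {a..}"
    by (rule inj_on_image_set_diff[OF inj]) (use a in auto)
  also have "f ` {a..} = {a + c..}"
  proof -
    have "f ` {a..} = (\<lambda>x. x + c) ` {a..}" by (rule image_cong) (auto simp: c)
    then show ?thesis using image_add_atLeast[of c a] by (simp add: add.commute)
  qed
  finally have fa: "f ` {0..<a} = {0..<a + c}" using im by auto
  have meas: "K \<in> sets lborel" "f ` K \<in> sets lborel" "emeasure lborel K \<noteq> \<infinity>" "emeasure lborel (f ` K) \<noteq> \<infinity>"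
    "measure lborel (f ` K) = measure lborel K" if "K \<in> Q" for K
    using KK[OF that] by auto
  have dQ: "disjoint_family_on (\<lambda>K. K) Q"
    using disj by (auto simp: disjoint_family_on_def Q_def)
  have dfQ: "disjoint_family_on (\<lambda>K. f ` K) Q"
    unfolding disjoint_family_on_def
  proof (intro ballI impI)
    fix K K' assume K: "K \<in> Q" "K' \<in> Q" "K \<noteq> K'"
    have "K \<subseteq> {0..}" "K' \<subseteq> {0..}" using KQ[OF K(1)] KQ[OF K(2)] by auto
    from inj_on_image_Int[OF inj this] show "f ` K \<inter> f ` K' = {}"
      using disj[of K K'] K by (simp add: Q_def)
  qed
  have "measure lborel (f ` {0..<a}) = measure lborel (\<Union>K\<in>Q. f ` K)"
    unfolding UQ[symmetric] image_Union by simp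
  also have "\<dots> = (\<Sum>K\<in>Q. measure lborel (f ` K))"
    by (rule measure_finite_Union[OF Q _ dfQ]) (use meas in auto)
  also have "\<dots> = (\<Sum>K\<in>Q. measure lborel K)" by (rule sum.cong) (simp_all add: meas)
  also have "\<dots> = measure lborel (\<Union>K\<in>Q. K)"
    by (rule measure_finite_Union[OF Q _ dQ, symmetric]) (use meas in auto)
  also have "\<dots> = measure lborel {0..<a}" using UQ by simp
  finally have "c = 0" using a ac unfolding fa by simp
  then have "\<forall>x\<ge>a. f x = x" using c by simp
  then show thesis by (rule that)
qed

section \<open>Block permutations and blockwise maps\<close>

definition block :: "real \<Rightarrow> real \<Rightarrow> nat" where
  "block n x = nat \<lfloor>x / n\<rfloor>"

lemma block_bounds:
  assumes "n > 0" "x \<ge> 0"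
  shows "n * real (block n x) \<le> x" "x < n * real (block n x) + n"
proof -
  have "real (block n x) = of_int \<lfloor>x / n\<rfloor>" using assms by (simp add: block_def)
  moreover have "of_int \<lfloor>x / n\<rfloor> \<le> x / n" "x / n < of_int \<lfloor>x / n\<rfloor> + 1" by linarith+
  ultimately have "real (block n x) \<le> x / n" "x / n < real (block n x) + 1" by simp_all
  then show "n * real (block n x) \<le> x" "x < n * real (block n x) + n"
    unfolding pos_le_divide_eq[OF assms(1)] pos_divide_less_eq[OF assms(1)]
    by (simp_all add: algebra_simps)
qed

lemma block_eq:
  assumes "n > 0" "0 \<le> y" "y < n"
  shows "block n (n * real j + y) = j"
proof -
  have "\<lfloor>(n * real j + y) / n\<rfloor> = int j"
    using assms by (intro floor_unique) (simp_all add: field_simps)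
  then show ?thesis by (simp add: block_def)
qed

lemma block_cases:
  assumes "n > 0" "x \<ge> 0"
  obtains j y where "x = n * real j + y" "0 \<le> y" "y < n"
  using block_bounds[OF assms] that[of "block n x" "x - n * real (block n x)"] by simp

text \<open>Here \<open>n\<close> is the real block length and block \<open>j\<close> is
  \<open>{n * real j..<n * real j + n}\<close>; offsets within a block are kept.\<close>

definition block_perm :: "real \<Rightarrow> (nat \<Rightarrow> nat) \<Rightarrow> real \<Rightarrow> real" where
  "block_perm n \<pi> = (\<lambda>x\<in>{0..}. n * real (\<pi> (block n x)) + (x - n * real (block n x)))"

text \<open>This will be the lamp map: \<open>z j\<close>, given on block \<open>0\<close>, is
  transported to block \<open>j\<close>.\<close>

definition block_map :: "real \<Rightarrow> (nat \<Rightarrow> real \<Rightarrow> real) \<Rightarrow> real \<Rightarrow> real" where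
  "block_map n z = (\<lambda>x\<in>{0..}. n * real (block n x) + z (block n x) (x - n * real (block n x)))"

lemma block_perm_apply: "n > 0 \<Longrightarrow> 0 \<le> y \<Longrightarrow> y < n \<Longrightarrow> block_perm n \<pi> (n * real j + y) = n * real (\<pi> j) + y"
  by (simp add: block_perm_def block_eq)

lemma block_map_apply: "n > 0 \<Longrightarrow> 0 \<le> y \<Longrightarrow> y < n \<Longrightarrow> block_map n z (n * real j + y) = n * real j + z j y"
  by (simp add: block_map_def block_eq)

lemma block_ext:
  assumes "n > 0" "f \<in> extensional {0..}" "g \<in> extensional {0..}"
    and "\<And>j y. 0 \<le> y \<Longrightarrow> y < n \<Longrightarrow> f (n * real j + y) = g (n * real j + y)"
  shows "f = g"
  using assms(2,3)
proof (rule extensionalityI)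
  fix x :: real assume "x \<in> {0..}"
  then have "0 \<le> x" by simp
  with assms(1) obtain j y where "x = n * real j + y" "0 \<le> y" "y < n" by (rule block_cases)
  then show "f x = g x" using assms(4) by simp
qed

lemma block_perm_extensional: "block_perm n \<pi> \<in> extensional {0..}"
  by (simp add: block_perm_def)

lemma block_map_extensional: "block_map n z \<in> extensional {0..}"
  by (simp add: block_map_def)

lemma compose_block_perm:
  assumes "n > 0"
  shows "compose {0..} (block_perm n \<pi>) (block_perm n \<pi>') = block_perm n (\<pi> \<circ> \<pi>')"
  by (rule block_ext[OF assms compose_extensional block_perm_extensional])
     (use assms in \<open>simp add: compose_def block_perm_apply\<close>)

lemma block_perm_id: "block_perm n id = (\<lambda>x\<in>{0..}. x)"
  by (simp add: block_perm_def)

lemma block_perm_Bij: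
  assumes n: "n > 0" and \<pi>: "bij \<pi>"
  shows "block_perm n \<pi> \<in> Bij {0..}"
proof -
  obtain \<pi>' where \<pi>': "\<And>j. \<pi>' (\<pi> j) = j" "\<And>j. \<pi> (\<pi>' j) = j"
    using \<pi> by (metis bij_pointE)
  have inv: "block_perm n \<pi>' (block_perm n \<pi> x) = x" "block_perm n \<pi> (block_perm n \<pi>' x) = x"
    and pos: "0 \<le> block_perm n \<pi> x" "0 \<le> block_perm n \<pi>' x" if x: "0 \<le> x" for x
  proof -
    obtain j y where "x = n * real j + y" "0 \<le> y" "y < n" using block_cases[OF n x] .
    then show "block_perm n \<pi>' (block_perm n \<pi> x) = x" "block_perm n \<pi> (block_perm n \<pi>' x) = x"
      "0 \<le> block_perm n \<pi> x" "0 \<le> block_perm n \<pi>' x"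
      using n \<pi>' by (simp_all add: block_perm_apply)
  qed
  have "bij_betw (block_perm n \<pi>) {0..} {0..}"
    by (rule bij_betw_byWitness[of _ "block_perm n \<pi>'"]) (use inv pos in auto)
  then show ?thesis by (simp add: Bij_def block_perm_extensional)
qed

text \<open>The pieces are the first \<open>N\<close> blocks, each translated as a whole, and the
  fixed tail.\<close>

lemma block_perm_interval_exchange:
  assumes n: "n > 0" and \<pi>: "\<pi> permutes {..<N}"
  shows "block_perm n \<pi> \<in> interval_exchanges"
proof (rule interval_exchangesI)
  let ?I = "\<lambda>j. {n * real j..<n * real j + n}"
  let ?P = "insert {n * real N..} (?I ` {..<N})"
  show "block_perm n \<pi> \<in> Bij {0..}" by (rule block_perm_Bij[OF n permutes_bij[OF \<pi>]])
  show "finite ?P" by simp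
  have I: "x \<in> ?I j \<longleftrightarrow> x \<ge> 0 \<and> block n x = j" for x j
  proof
    assume "x \<in> ?I j"
    moreover from this n have "x \<ge> 0" by (auto intro: order_trans[rotated])
    ultimately show "x \<ge> 0 \<and> block n x = j"
      using block_eq[OF n, of "x - n * real j" j] by auto
  next
    assume "x \<ge> 0 \<and> block n x = j"
    then show "x \<in> ?I j" using block_bounds[OF n, of x] by auto
  qed
  have T: "x \<in> {n * real N..} \<longleftrightarrow> x \<ge> 0 \<and> N \<le> block n x" for x
  proof
    assume x: "x \<in> {n * real N..}"
    then have "0 \<le> x" using n by (auto intro: order_trans[rotated])
    then have "n * real N < n * real (block n x) + n" using block_bounds(2)[OF n] x by fastforce
    then have "n * real N < n * (real (block n x) + 1)" by (simp add: algebra_simps)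
    then have "real N < real (block n x) + 1" using n by simp
    then show "x \<ge> 0 \<and> N \<le> block n x" using \<open>0 \<le> x\<close> by linarith
  next
    assume x: "x \<ge> 0 \<and> N \<le> block n x"
    then have "n * real N \<le> n * real (block n x)" using n by simp
    then show "x \<in> {n * real N..}" using block_bounds(1)[OF n] x by fastforce
  qed
  show "partition_on {0..} ?P"
  proof (rule partition_onI)
    show "\<Union>?P = {0..}"
    proof (intro equalityI subsetI)
      fix x assume "x \<in> \<Union>?P" then show "x \<in> {0..}" using I T by auto
    next
      fix x :: real assume "x \<in> {0..}"
      then have x: "0 \<le> x" by simp
      show "x \<in> \<Union>?P"
      proof (cases "block n x < N")
        case True
        have "x \<in> ?I (block n x)" using I x by blast
        then show ?thesis using True by blast
      next
        case False
        then have "x \<in> {n * real N..}" using T x by auto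
        then show ?thesis by blast
      qed
    qed
    show "disjnt p q" if "p \<in> ?P" "q \<in> ?P" "p \<noteq> q" for p q
    proof -
      have "x \<notin> q" if "x \<in> p" for x
        using \<open>p \<in> ?P\<close> \<open>q \<in> ?P\<close> \<open>p \<noteq> q\<close> that I[of x] T[of x] by (elim insertE imageE) auto
      then show ?thesis by (auto simp: disjnt_def)
    qed
    show "{} \<notin> ?P" using n by auto
  qed
  fix J assume "J \<in> ?P"
  then consider "J = {n * real N..}" | j where "J = ?I j" by blast
  then show "((\<exists>a b. J = {a..<b}) \<or> (\<exists>a. J = {a..})) \<and> (\<exists>c. \<forall>x\<in>J. block_perm n \<pi> x = x + c)"
  proof cases
    case 1
    have "block_perm n \<pi> x = x + 0" if "x \<in> J" for x
    proof -
      have "x \<ge> 0" "N \<le> block n x" using T[of x] that 1 by simp_all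
      then show ?thesis using permutes_not_in[OF \<pi>, of "block n x"] by (simp add: block_perm_def)
    qed
    then show ?thesis using 1 by blast
  next
    case (2 j)
    have "block_perm n \<pi> x = x + (n * real (\<pi> j) - n * real j)" if "x \<in> J" for x
    proof -
      have "x \<ge> 0" "block n x = j" using I[of x j] that 2 by simp_all
      then show ?thesis by (simp add: block_perm_def)
    qed
    then show ?thesis using 2 by blast
  qed
qed

definition supported :: "real \<Rightarrow> (real \<Rightarrow> real) set" where
  "supported n = {f \<in> Bij {0..}. \<forall>x\<ge>n. f x = x}"

text \<open>A value \<open>f x \<ge> n\<close> would be fixed by \<open>f\<close>, so it would equal
  \<open>x\<close> by injectivity.\<close>

lemma supported_range:
  assumes f: "f \<in> supported n" and "0 \<le> x" "x < n"
  shows "0 \<le> f x" "f x < n"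
proof -
  have inj: "inj_on f {0..}" and im: "f ` {0..} = {0..}"
    using f by (auto simp: supported_def Bij_def bij_betw_def)
  show "0 \<le> f x" using im assms by blast
  show "f x < n"
  proof (rule ccontr)
    assume "\<not> f x < n"
    then have "f (f x) = f x" using f by (simp add: supported_def)
    then have "f x = x" using inj_onD[OF inj] \<open>0 \<le> f x\<close> assms by simp
    then show False using assms \<open>\<not> f x < n\<close> by simp
  qed
qed

lemma id_supported: "(\<lambda>x\<in>{0..}. x) \<in> supported n" if "n > 0"
  using that id_Bij by (simp add: supported_def)

lemma compose_block_map:
  assumes n: "n > 0" and z': "\<And>j. z' j \<in> supported n"
  shows "compose {0..} (block_map n z) (block_map n z') = block_map n (\<lambda>j. compose {0..} (z j) (z' j))"
  by (rule block_ext[OF n compose_extensional block_map_extensional])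
     (use n supported_range[OF z'] in \<open>simp add: compose_def block_map_apply\<close>)

text \<open>Conjugation by a block permutation relocates the lamps; since \<open>\<pi>\<close> is an
  involution, \<open>z \<circ> \<pi>\<close> contains no inverse.\<close>

lemma block_perm_block_map:
  assumes n: "n > 0" and z: "\<And>j. z j \<in> supported n" and \<pi>: "\<And>j. \<pi> (\<pi> j) = j"
  shows "compose {0..} (block_perm n \<pi>) (block_map n z) =
    compose {0..} (block_map n (z \<circ> \<pi>)) (block_perm n \<pi>)"
  by (rule block_ext[OF n compose_extensional compose_extensional])
     (use n supported_range[OF z] \<pi> in \<open>simp add: compose_def block_map_apply block_perm_apply\<close>)

lemma block_map_id: "n > 0 \<Longrightarrow> block_map n (\<lambda>_. \<lambda>x\<in>{0..}. x) = (\<lambda>x\<in>{0..}. x)"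
  using block_bounds by (auto simp: block_map_def fun_eq_iff)

lemma block_map_single_0:
  assumes n: "n > 0" and s: "s \<in> supported n"
  shows "block_map n ((\<lambda>_. \<lambda>x\<in>{0..}. x)(0 := s)) = s"
proof (rule block_ext[OF n block_map_extensional])
  show "s \<in> extensional {0..}" using s by (simp add: supported_def Bij_def)
  fix j :: nat and y :: real assume y: "0 \<le> y" "y < n"
  show "block_map n ((\<lambda>_. \<lambda>x\<in>{0..}. x)(0 := s)) (n * real j + y) = s (n * real j + y)"
  proof (cases "j = 0")
    case False
    then have "n * 1 \<le> n * real j" using n by (intro mult_left_mono) auto
    then have "n \<le> n * real j + y" using y by linarith
    then have "s (n * real j + y) = n * real j + y" using s by (simp add: supported_def)
    then show ?thesis using False n y by (simp add: block_map_apply)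
  qed (use n y block_map_apply[OF n y, of _ 0] in simp)
qed

lemma compose_id_left: "f \<in> extensional A \<Longrightarrow> f \<in> A \<rightarrow> A \<Longrightarrow> compose A (\<lambda>x\<in>A. x) f = f"
  by (auto simp: compose_def extensional_def fun_eq_iff)

lemma compose_id_right: "f \<in> extensional A \<Longrightarrow> compose A f (\<lambda>x\<in>A. x) = f"
  by (auto simp: compose_def extensional_def fun_eq_iff)

text \<open>Writing into an empty block is left multiplication by a single lamp. The case
  \<open>j = 0\<close> yields the axiom \<open>lamp_mult\<close>, general \<open>j\<close> an
  induction over the nontrivial lamps.\<close>

lemma block_map_update:
  assumes n: "n > 0" and z: "\<And>i. z i \<in> supported n" "z j = (\<lambda>x\<in>{0..}. x)" and s: "s \<in> supported n"
  shows "block_map n (z(j := s)) = compose {0..} (block_map n ((\<lambda>_. \<lambda>x\<in>{0..}. x)(j := s))) (block_map n z)"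
proof -
  have ext: "f \<in> extensional {0..}" "f \<in> {0..} \<rightarrow> {0..}" if "f \<in> supported n" for f
    using that by (auto simp: supported_def Bij_def bij_betw_def)
  have "(\<lambda>i. compose {0..} (((\<lambda>_. \<lambda>x\<in>{0..}. x)(j := s)) i) (z i)) = z(j := s)"
  proof
    fix i show "compose {0..} (((\<lambda>_. \<lambda>x\<in>{0..}. x)(j := s)) i) (z i) = (z(j := s)) i"
      using compose_id_left[OF ext[OF z(1)[of i]]] compose_id_right[OF ext(1)[OF s]] z(2)
      by (cases "i = j") (simp_all only: fun_upd_apply simp_thms if_True if_False)
  qed
  then show ?thesis unfolding compose_block_map[OF n z(1)] by simp
qed

section \<open>Double transpositions and the derived subgroups\<close>

definition double_swap :: "nat \<Rightarrow> nat \<Rightarrow> nat \<Rightarrow> nat \<Rightarrow> nat \<Rightarrow> nat" where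
  "double_swap a b c e = Transposition.transpose a b \<circ> Transposition.transpose c e"

lemma double_swap_apply:
  "distinct [a, b, c, e] \<Longrightarrow> double_swap a b c e j =
    (if j = a then b else if j = b then a else if j = c then e else if j = e then c else j)"
  by (auto simp: double_swap_def Transposition.transpose_def)

lemma double_swap_involution: "distinct [a, b, c, e] \<Longrightarrow> double_swap a b c e (double_swap a b c e j) = j"
  by (simp add: double_swap_apply)

lemma double_swap_permutes:
  "a < N \<Longrightarrow> b < N \<Longrightarrow> c < N \<Longrightarrow> e < N \<Longrightarrow> double_swap a b c e permutes {..<N}"
  unfolding double_swap_def by (intro permutes_compose permutes_swap_id) auto

text \<open>For involutions \<open>x\<close> and \<open>y\<close> the commutator is
  \<open>x y x y\<close>; the spare points \<open>p\<close> and \<open>q\<close> allow both factors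
  to be double transpositions.\<close>

lemma double_swap_commutator:
  assumes "distinct [a, b, c, e, p, q]"
  shows "double_swap a b p q \<circ> double_swap a c b e \<circ> double_swap a b p q \<circ> double_swap a c b e
    = double_swap a b c e"
proof
  fix j
  have d: "distinct [a, b, p, q]" "distinct [a, c, b, e]" "distinct [a, b, c, e]" using assms by auto
  have ne: "a \<noteq> b" "a \<noteq> c" "a \<noteq> e" "a \<noteq> p" "a \<noteq> q" "b \<noteq> c" "b \<noteq> e" "b \<noteq> p" "b \<noteq> q"
    "c \<noteq> e" "c \<noteq> p" "c \<noteq> q" "e \<noteq> p" "e \<noteq> q" "p \<noteq> q"
    using assms by simp_all
  consider "j = a" | "j = b" | "j = c" | "j = e" | "j = p" | "j = q" | "j \<notin> {a, b, c, e, p, q}" by blast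
  then show "(double_swap a b p q \<circ> double_swap a c b e \<circ> double_swap a b p q \<circ> double_swap a c b e) j
    = double_swap a b c e j"
    by cases (simp_all add: ne ne[symmetric] double_swap_apply[OF d(1)] double_swap_apply[OF d(2)]
      double_swap_apply[OF d(3)])
qed

lemma fresh_nats:
  fixes B :: "nat set"
  assumes "finite B"
  obtains p q r s where "distinct [p, q, r, s]" "p \<notin> B" "q \<notin> B" "r \<notin> B" "s \<notin> B"
proof -
  obtain m where m: "\<And>i. i \<in> B \<Longrightarrow> i < m"
    using assms finite_nat_set_iff_bounded[of B] by blast
  have "m + i \<notin> B" for i using m[of "m + i"] by auto
  from that[of "m + 0" "m + 1" "m + 2" "m + 3", OF _ this this this this] show thesis by simp
qed

abbreviation IET_derived :: "nat \<Rightarrow> (real \<Rightarrow> real) set" where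
  "IET_derived d \<equiv> (derived IET ^^ d) (carrier IET)"

lemma carrier_IET: "carrier IET = interval_exchanges"
  by (simp add: IET_def)

lemma interval_exchange_Bij: "f \<in> interval_exchanges \<Longrightarrow> f \<in> Bij {0..}"
  by (simp add: interval_exchanges_def)

lemma IET_mult: "f \<in> interval_exchanges \<Longrightarrow> g \<in> interval_exchanges \<Longrightarrow> f \<otimes>\<^bsub>IET\<^esub> g = compose {0..} f g"
  by (simp add: IET_def BijGroup_def interval_exchange_Bij)

lemma IET_one: "\<one>\<^bsub>IET\<^esub> = (\<lambda>x\<in>{0..}. x)"
  by (simp add: IET_def BijGroup_def)

lemma IET_derived_subgroup: "subgroup (IET_derived d) IET"
  by (rule group.exp_of_derived_is_subgroup[OF IET_group group.subgroup_self[OF IET_group]])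

lemma IET_derived_subset: "IET_derived d \<subseteq> interval_exchanges"
  using subgroup.subset[OF IET_derived_subgroup] by (simp add: carrier_IET)

lemma compose_double_swap:
  assumes "n > 0" "distinct [a, b, c, e]"
  shows "compose {0..} (block_perm n (double_swap a b c e)) (block_perm n (double_swap a b c e)) = (\<lambda>x\<in>{0..}. x)"
proof -
  have "double_swap a b c e \<circ> double_swap a b c e = id"
    using double_swap_involution[OF assms(2)] by (simp add: fun_eq_iff)
  then show ?thesis by (simp only: compose_block_perm[OF assms(1)] block_perm_id)
qed

lemma double_swap_interval_exchange:
  assumes "n > 0"
  shows "block_perm n (double_swap a b c e) \<in> interval_exchanges"
proof (rule block_perm_interval_exchange[OF assms double_swap_permutes])
  show "a < Suc (a + b + c + e)" "b < Suc (a + b + c + e)" "c < Suc (a + b + c + e)" "e < Suc (a + b + c + e)"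
    by simp_all
qed

text \<open>Double transpositions are commutators of double transpositions, so they survive in every
  derived subgroup.\<close>

lemma double_swap_derived:
  assumes n: "n > 0"
  shows "distinct [a, b, c, e] \<Longrightarrow> block_perm n (double_swap a b c e) \<in> IET_derived d"
proof (induction d arbitrary: a b c e)
  case 0
  then show ?case using double_swap_interval_exchange[OF n] by (simp add: carrier_IET)
next
  case (Suc d)
  interpret group IET by (rule IET_group)
  have "finite {a, b, c, e}" by simp
  from fresh_nats[OF this] obtain p q r s where pq: "distinct [p, q, r, s]"
    "p \<notin> {a, b, c, e}" "q \<notin> {a, b, c, e}" "r \<notin> {a, b, c, e}" "s \<notin> {a, b, c, e}" .
  then have d: "distinct [a, b, c, e, p, q]" using Suc.prems by auto
  then have dx: "distinct [a, b, p, q]" and dy: "distinct [a, c, b, e]" by auto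
  let ?x = "block_perm n (double_swap a b p q)" and ?y = "block_perm n (double_swap a c b e)"
  have xy: "?x \<in> IET_derived d" "?y \<in> IET_derived d" by (rule Suc.IH[OF dx], rule Suc.IH[OF dy])
  note cl = double_swap_interval_exchange[OF n]
  \<comment> \<open>Both factors are involutions, so their commutator is the product in
    \<open>double_swap_commutator\<close>.\<close>
  have inv: "inv\<^bsub>IET\<^esub> ?x = ?x" "inv\<^bsub>IET\<^esub> ?y = ?y"
    by (rule inv_equality; simp only: IET_mult[OF cl cl] compose_double_swap[OF n dx]
        compose_double_swap[OF n dy] IET_one carrier_IET cl)+
  have comp: "compose {0..} f g \<in> interval_exchanges" if "f \<in> interval_exchanges" "g \<in> interval_exchanges" for f g
    using m_closed[of f g] that by (simp add: carrier_IET IET_mult)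
  have "?x \<otimes>\<^bsub>IET\<^esub> ?y \<otimes>\<^bsub>IET\<^esub> inv\<^bsub>IET\<^esub> ?x \<otimes>\<^bsub>IET\<^esub> inv\<^bsub>IET\<^esub> ?y =
      compose {0..} (compose {0..} (compose {0..} ?x ?y) ?x) ?y"
    unfolding inv by (simp only: IET_mult cl comp)
  also have "\<dots> = block_perm n (double_swap a b c e)"
    by (simp only: compose_block_perm[OF n] double_swap_commutator[OF d])
  finally have "block_perm n (double_swap a b c e) \<in> derived_set IET (IET_derived d)"
    by (intro UN_I[OF xy(1)] UN_I[OF xy(2)]) (simp only: singleton_iff)
  then have "block_perm n (double_swap a b c e) \<in> derived IET (IET_derived d)"
    unfolding derived_def by (rule generate.incl)
  then show ?case by simp
qed

text \<open>The block length bounds the supports of \<open>S\<close>, the lamp map is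
  \<open>block_map\<close>, and \<open>A N\<close> collects the permutations of the first
  \<open>N\<close> blocks that lie in the derived subgroup.\<close>

lemma IET_lamplighter:
  assumes S: "finite S" "S \<subseteq> IET_derived d"
  shows "\<exists>lamp A. lamplighter (derived_subgroup IET d) S lamp A"
proof -
  let ?G = "derived_subgroup IET d" and ?one = "(\<lambda>x\<in>{0..}. x) :: real \<Rightarrow> real"
  have carrier: "carrier ?G = IET_derived d" by (simp add: derived_subgroup_def)
  have one: "\<one>\<^bsub>?G\<^esub> = ?one" by (simp add: derived_subgroup_def IET_one)
  have ie: "f \<in> interval_exchanges" if "f \<in> IET_derived d" for f using that IET_derived_subset by blast
  have mult: "f \<otimes>\<^bsub>?G\<^esub> g = compose {0..} f g" if "f \<in> IET_derived d" "g \<in> IET_derived d" for f g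
    using IET_mult[OF ie[OF that(1)] ie[OF that(2)]] by (simp add: derived_subgroup_def)
  have comp: "compose {0..} f g \<in> IET_derived d" if "f \<in> IET_derived d" "g \<in> IET_derived d" for f g
    using subgroup.m_closed[OF IET_derived_subgroup that] IET_mult[OF ie[OF that(1)] ie[OF that(2)]] by simp
  have one_d: "?one \<in> IET_derived d"
    using subgroup.one_closed[OF IET_derived_subgroup] by (simp add: IET_one)
  have "group ?G"
    unfolding derived_subgroup_def by (rule subgroup.subgroup_is_group[OF IET_derived_subgroup IET_group])
  have "\<forall>s\<in>S. \<exists>m. \<forall>x\<ge>m. s x = x"
  proof
    fix s assume "s \<in> S"
    then have "s \<in> interval_exchanges" using S(2) ie by blast
    then obtain m where "\<forall>x\<ge>m. s x = x" by (rule interval_exchange_bounded_support)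
    then show "\<exists>m. \<forall>x\<ge>m. s x = x" ..
  qed
  from bchoice[OF this] obtain m where m: "\<forall>s\<in>S. \<forall>x\<ge>m s. s x = x" ..
  \<comment> \<open>The entry \<open>1\<close> keeps the block length positive, also for empty
    \<open>S\<close>.\<close>
  define n where "n = Max (insert 1 (m ` S))"
  have "1 \<le> n" unfolding n_def using S(1) by (intro Max_ge) auto
  then have n: "n > 0" by simp
  have supp: "s \<in> supported n" if s: "s \<in> S" for s
  proof -
    have "m s \<le> n" unfolding n_def using S(1) s by (intro Max_ge) auto
    then have "\<forall>x\<ge>n. s x = x" using m s by (meson order_trans)
    moreover have "s \<in> Bij {0..}" using S(2) s interval_exchange_Bij[OF ie] by blast
    ultimately show ?thesis by (simp add: supported_def)
  qed
  note one_supp = id_supported[OF n]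
  have z_supp: "z j \<in> supported n" if "z \<in> lamps ?G S" for z j
  proof -
    have "z j \<in> insert ?one S" using that by (auto simp: lamps_def one)
    then show ?thesis by (rule insertE) (simp_all only: supp one_supp)
  qed
  \<comment> \<open>The copy of \<open>s\<close> in block \<open>j\<close> is conjugate to
    \<open>s\<close> by a double transposition that exchanges \<open>0\<close> and \<open>j\<close>
    and lies in the derived subgroup itself.\<close>
  have single: "block_map n ((\<lambda>_. ?one)(j := s)) \<in> IET_derived d" if s: "s \<in> S" for s j
  proof (cases "j = 0")
    case True
    then show ?thesis using block_map_single_0[OF n supp[OF s]] s S by auto
  next
    case False
    have "finite {0, j}" by simp
    from fresh_nats[OF this] obtain p q r r' where "distinct [p, q, r, r']"
      "p \<notin> {0, j}" "q \<notin> {0, j}" "r \<notin> {0, j}" "r' \<notin> {0, j}" .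
    then have dist: "distinct [0, j, p, q]" using False by auto
    let ?\<pi> = "double_swap 0 j p q" and ?s0 = "(\<lambda>_. ?one)(0 := s)" and ?sj = "(\<lambda>_. ?one)(j := s)"
    let ?t = "block_perm n ?\<pi>"
    have t: "?t \<in> IET_derived d" by (rule double_swap_derived[OF n dist])
    have "?s0 i \<in> supported n" for i using supp[OF s] one_supp by simp
    note block_perm_block_map[where z = ?s0 and \<pi> = ?\<pi>, OF n this double_swap_involution[OF dist]]
    moreover have "?s0 \<circ> ?\<pi> = ?sj"
      using dist by (auto simp: fun_eq_iff double_swap_apply)
    ultimately have eq: "compose {0..} ?t s = compose {0..} (block_map n ?sj) ?t"
      by (simp only: block_map_single_0[OF n supp[OF s]])
    have tt: "compose {0..} ?t ?t = ?one" by (rule compose_double_swap[OF n dist])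
    have "compose {0..} (compose {0..} (block_map n ?sj) ?t) ?t = compose {0..} (block_map n ?sj) (compose {0..} ?t ?t)"
      by (rule compose_assoc[symmetric]) (use interval_exchange_Bij[OF ie[OF t]] in \<open>auto simp: Bij_def bij_betw_def\<close>)
    then have "block_map n ?sj = compose {0..} (compose {0..} ?t s) ?t"
      unfolding eq tt compose_id_right[OF block_map_extensional] by simp
    then show ?thesis using comp[OF comp[OF t] t, of s] s S by auto
  qed
  \<comment> \<open>Nontrivial lamps are removed one at a time, each as a left factor of the form
    treated in \<open>single\<close>.\<close>
  have lamp_closed: "block_map n z \<in> IET_derived d" if z: "z \<in> lamps ?G S" for z
  proof -
    have "finite {j. z j \<noteq> ?one}" using z by (simp add: lamps_def one)
    then show ?thesis
      using z
    proof (induction "{j. z j \<noteq> ?one}" arbitrary: z rule: finite_induct)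
      case empty
      then have "z j = ?one" for j by blast
      then have "z = (\<lambda>_. ?one)" by (rule ext)
      then show ?case by (simp only: block_map_id[OF n] one_d)
    next
      case (insert j F)
      let ?z = "z(j := ?one)"
      have F: "F = {i. ?z i \<noteq> ?one}" using insert(2,4) by auto
      have z: "?z \<in> lamps ?G S"
        using insert.prems insert(1) unfolding F by (auto simp: lamps_def one)
      have "z j \<noteq> ?one" using insert(4) by blast
      then have zj: "z j \<in> S" using insert.prems by (auto simp: lamps_def one)
      have "block_map n (?z(j := z j)) = compose {0..} (block_map n ((\<lambda>_. ?one)(j := z j))) (block_map n ?z)"
        by (rule block_map_update[where z = ?z, OF n z_supp[OF z] _ supp[OF zj]]) simp
      then show ?case using comp[OF single[OF zj] insert.hyps(3)[OF F z]] by simp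
    qed
  qed
  \<comment> \<open>Intersecting with the derived subgroup avoids determining which block permutations it contains.\<close>
  define A where "A N = block_perm n ` {\<pi>. \<pi> permutes {..<N}} \<inter> IET_derived d" for N
  have A_mult: "compose {0..} f g \<in> A N" if fg: "f \<in> A N" "g \<in> A N" for f g N
  proof -
    obtain \<pi> \<pi>' where "\<pi> permutes {..<N}" "\<pi>' permutes {..<N}" "f = block_perm n \<pi>" "g = block_perm n \<pi>'"
      using fg by (auto simp: A_def)
    then have "compose {0..} f g \<in> block_perm n ` {\<pi>. \<pi> permutes {..<N}}"
      by (auto simp: compose_block_perm[OF n] intro: permutes_compose)
    then show ?thesis using comp fg by (simp add: A_def)
  qed
  have one_A: "?one \<in> A N" for N
  proof -
    have "block_perm n id \<in> block_perm n ` {\<pi>. \<pi> permutes {..<N}}"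
      by (intro imageI CollectI permutes_id)
    then show ?thesis unfolding A_def block_perm_id using one_d by (rule IntI)
  qed
  have "lamplighter ?G S (block_map n) A"
  proof (intro lamplighter.intro lamplighter_axioms.intro \<open>group ?G\<close>)
    show "finite S" "S \<subseteq> carrier ?G" using S by (simp_all add: carrier)
    show "block_map n z \<in> carrier ?G" if "z \<in> lamps ?G S" for z
      unfolding carrier by (rule lamp_closed[OF that])
    show "s \<otimes>\<^bsub>?G\<^esub> block_map n z = block_map n (z(0 := s))"
      if z: "z \<in> lamps ?G S" "z 0 = \<one>\<^bsub>?G\<^esub>" and s: "s \<in> S" for z s
      using block_map_update[where z = z, OF n z_supp[OF z(1)] z(2)[unfolded one] supp[OF s]]
        block_map_single_0[OF n supp[OF s]] mult[OF _ lamp_closed[OF z(1)], of s] s S by auto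
    show "finite (A N)" for N by (simp add: A_def finite_permutations)
    show "A N \<noteq> {}" for N using one_A by blast
    show "A N \<subseteq> carrier ?G" for N by (simp add: A_def carrier)
  next
    fix B :: "nat set" and a b :: nat assume B: "finite B"
    have "finite (B \<union> {a, b})" using B by simp
    from fresh_nats[OF this] obtain p q r s where fresh: "distinct [p, q, r, s]" "p \<notin> B \<union> {a, b}" "q \<notin> B \<union> {a, b}"
      "r \<notin> B \<union> {a, b}" "s \<notin> B \<union> {a, b}" .
    \<comment> \<open>The second transposition, of \<open>p\<close> and \<open>q\<close> outside
      \<open>B\<close>, makes the permutation even. If \<open>a = b\<close>, the identity is wanted
      on \<open>B\<close>, and all four points are taken fresh.\<close>
    define a' b' where "a' = (if a = b then r else a)" and "b' = (if a = b then s else b)"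
    have dist: "distinct [a', b', p, q]" using fresh by (auto simp: a'_def b'_def)
    let ?\<pi> = "double_swap a' b' p q" and ?N0 = "Suc (a' + b' + p + q)"
    let ?t = "block_perm n ?\<pi>"
    have t: "?t \<in> IET_derived d" by (rule double_swap_derived[OF n dist])
    have perm: "?\<pi> permutes {..<N}" if "N \<ge> ?N0" for N
      using that by (intro double_swap_permutes) auto
    have inv: "?\<pi> (?\<pi> j) = j" for j by (rule double_swap_involution[OF dist])
    have onB: "?\<pi> j = Transposition.transpose a b j" if "j \<in> B" for j
      unfolding double_swap_apply[OF dist] using fresh that
      by (auto simp: a'_def b'_def Transposition.transpose_def)
    have "?\<pi> j < N" if "N \<ge> ?N0" "j < N" for j N
      using permutes_in_image[OF perm[OF that(1)], of j] that(2) by simp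
    moreover have tA: "?t \<in> A N" if "N \<ge> ?N0" for N using perm[OF that] t by (simp add: A_def)
    moreover have "?t \<otimes>\<^bsub>?G\<^esub> x \<in> A N" if "N \<ge> ?N0" "x \<in> A N" for N x
      using A_mult[OF tA[OF that(1)] that(2)] that(2) mult[OF t] by (simp add: A_def)
    moreover have "?t \<otimes>\<^bsub>?G\<^esub> block_map n z = block_map n (z \<circ> ?\<pi>) \<otimes>\<^bsub>?G\<^esub> ?t" if z: "z \<in> lamps ?G S" for z
    proof -
      have "z \<circ> ?\<pi> \<in> lamps ?G S"
        by (rule lamps_comp[OF z]) (rule permutes_inj[OF perm[OF order.refl]])
      then show ?thesis
        using block_perm_block_map[where z = z and \<pi> = ?\<pi>, OF n z_supp[OF z] inv] mult[OF t lamp_closed[OF z]]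
          mult[OF lamp_closed t] by simp
    qed
    ultimately show "\<exists>\<pi> N0 t. (\<forall>j. \<pi> (\<pi> j) = j) \<and> (\<forall>j\<in>B. \<pi> j = Transposition.transpose a b j) \<and>
        (\<forall>N\<ge>N0. (\<forall>j<N. \<pi> j < N) \<and> t \<in> A N \<and> (\<forall>x\<in>A N. t \<otimes>\<^bsub>?G\<^esub> x \<in> A N)) \<and>
        (\<forall>z\<in>lamps ?G S. t \<otimes>\<^bsub>?G\<^esub> block_map n z = block_map n (z \<circ> \<pi>) \<otimes>\<^bsub>?G\<^esub> t)"
      using inv onB by (intro exI[of _ ?\<pi>] exI[of _ ?N0] exI[of _ ?t]) simp
  qed
  then show ?thesis by blast
qed

theorem corollary1p18:
  shows "Xsep_boundedly_acyclic TYPE('e::banach) TYPE('f::banach) IET \<and>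
         (\<forall>d\<ge>1. Xsep_boundedly_acyclic TYPE('e) TYPE('f) (derived_subgroup IET d))"
proof -
  have "Xsep_boundedly_acyclic TYPE('e) TYPE('f) (derived_subgroup IET d)" for d
  proof (rule group.Xsep_boundedly_acyclicI)
    show "group (derived_subgroup IET d)"
      unfolding derived_subgroup_def by (rule subgroup.subgroup_is_group[OF IET_derived_subgroup IET_group])
    show "\<exists>lamp A. lamplighter (derived_subgroup IET d) S lamp A"
      if "finite S" "S \<subseteq> carrier (derived_subgroup IET d)" for S
      using that by (intro IET_lamplighter) (simp_all add: derived_subgroup_def)
  qed
  \<comment> \<open>The value \<open>d = 0\<close> covers the full group.\<close>
  moreover have "derived_subgroup IET 0 = IET" by (simp add: derived_subgroup_def)
  ultimately show ?thesis by metis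
qed

end
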